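(* Suppose $pq\le \frac14$. Then the initial-boundary value problem $\Sigma^0$ has a unique non-negative solution $$N=(N_1,N_2,N_3,N_4)\in C\big([0,T]\times[a_1,b_1]\times[a_2,b_2];\mathbb{R}^4\big)$$ such that: (i) $\|N\|\le \dfrac{1+\sqrt{1-4pq}}{2p}$; (ii) for $i=1,2,3,4$ the partial derivatives $\frac{\partial N_i}{\partial t},\frac{\partial N_i}{\partial x},\frac{\partial N_i}{\partial y}$ are defined in $]0,T[\times]a_1,b_1[\times]a_2,b_2[$ except possibly on a finite number of planes including the four planes with respective equations $$-ct+x=a_1,\qquad -ct+y=a_2,\qquad ct+y=b_2,\qquad ct+x=b_1;$$ (iii) for $i=1,2,3,4$ these partial derivatives are continuous and bounded (on their domain of definition), and satisfy $$\max_{1\le i\le 4}\left\{\|N_i\|_\infty,\left\|\frac{\partial N_i}{\partial t}\right\|_\infty,\left\|\frac{\partial N_i}{\partial x}\right\|_\infty,\left\|\frac{\partial N_i}{\partial y}\right\|_\infty\right\}\le \max\left\{1,\frac2c\right\}\frac{1+\sqrt{1-4pq}}{2p}.$$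
   Context: Let $c>0$, $S>0$, $T>0$, $a_1<b_1$, $a_2<b_2$ be real constants and $\mathscr{P}=[0,T]\times[a_1,b_1]\times[a_2,b_2]$, with interior $\mathring{\mathscr{P}}$. $C(X,Y)$ (also written $C(X;Y)$) denotes the set of continuous functions from $X$ to $Y$. For $N=(N_1,N_2,N_3,N_4)$ put $Q(N)=2cS(N_2N_3-N_1N_4)$. Problem $\Sigma^0$: find $N=(N_1,\dots,N_4)$ on $\mathscr{P}$ such that for $(t,x,y)\in\mathring{\mathscr{P}}$ $$\frac{\partial N_1}{\partial t}+c\frac{\partial N_1}{\partial x}=Q(N),\quad \frac{\partial N_2}{\partial t}+c\frac{\partial N_2}{\partial y}=-Q(N),\quad \frac{\partial N_3}{\partial t}-c\frac{\partial N_3}{\partial y}=-Q(N),\quad \frac{\partial N_4}{\partial t}-c\frac{\partial N_4}{\partial x}=Q(N),$$ with initial conditions $N_i(0,x,y)=N_i^0(x,y)$ for $(x,y)\in[a_1,b_1]\times[a_2,b_2]$, $i=1,\dots,4$, and boundary conditions $N_1(t,a_1,y)=N_1^-(t,y)$ and $N_4(t,b_1,y)=N_4^+(t,y)$ for $(t,y)\in[0,T]\times[a_2,b_2]$; $N_2(t,x,a_2)=N_2^-(t,x)$ and $N_3(t,x,b_2)=N_3^+(t,x)$ for $(t,x)\in[0,T]\times[a_1,b_1]$. The left-hand side of each equation is understood as the derivative of the unknown along the corresponding characteristic direction (it equals the displayed combination of partial derivatives wherever these exist and are continuous). Standing assumptions on the data: $N_1^0,N_2^0,N_3^0,N_4^0,N_1^-,N_2^-,N_3^+,N_4^+$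 are non-negative and continuous, with bounded and continuous first order partial derivatives, and satisfy the compatibility conditions $N_1^0(a_1,y)=N_1^-(0,y)$, $N_4^0(b_1,y)=N_4^+(0,y)$ for $y\in[a_2,b_2]$, and $N_2^0(x,a_2)=N_2^-(0,x)$, $N_3^0(x,b_2)=N_3^+(0,x)$ for $x\in[a_1,b_1]$. Norms: for a bounded real function $u$ with domain $D_u$, $\|u\|_\infty=\sup_{D_u}|u|$; for $U=(U_1,\dots,U_4)$, $\|U\|=\max_{1\le i\le4}\|U_i\|_\infty$; for a bounded function $u(\alpha,\beta)$ of two variables with bounded first partial derivatives, $\|u\|_1=\max\{\|u\|_\infty,\|\partial u/\partial\alpha\|_\infty,\|\partial u/\partial\beta\|_\infty\}$. Constants: $$p=4cS\left(1+2\max\left\{4T,\tfrac2c(b_1-a_1),\tfrac1c(b_2-a_2)\right\}\right),$$ $$q=\max\Big\{\max\{1,2c\}\|N_1^0\|_1,\ (1+c)\|N_1^-\|_1,\ \max\{1,2c\}\|N_2^0\|_1,\ \max\{2,1+c\}\|N_2^-\|_1,\ \max\{1,2c\}\|N_3^0\|_1,\ \max\{2,1+c\}\|N_3^+\|_1,\ \max\{1,2c\}\|N_4^0\|_1,\ (2+c)\|N_4^+\|_1\Big\}.$$ "Non-negative" means every component is $\ge0$. *)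

theory Defs
  imports "HOL-Analysis.Analysis"
begin

text \<open>Points of space-time are triples \<open>(t, x, y)\<close>. Functions are total, so only their values on the
  sets given explicitly below matter.\<close>

definition slab :: "real \<Rightarrow> real \<Rightarrow> real \<Rightarrow> real \<Rightarrow> real \<Rightarrow> (real \<times> real \<times> real) set" where
  "slab T a1 b1 a2 b2 = {0..T} \<times> {a1..b1} \<times> {a2..b2}"

definition slab_interior :: "real \<Rightarrow> real \<Rightarrow> real \<Rightarrow> real \<Rightarrow> real \<Rightarrow> (real \<times> real \<times> real) set" where
  "slab_interior T a1 b1 a2 b2 = {0<..<T} \<times> {a1<..<b1} \<times> {a2<..<b2}"

definition sup_norm :: "'a set \<Rightarrow> ('a \<Rightarrow> real) \<Rightarrow> real" where
  "sup_norm D u = (SUP z\<in>D. \<bar>u z\<bar>)"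

definition sup_norm4 :: "'a set \<Rightarrow> ('a \<Rightarrow> real ^ 4) \<Rightarrow> real" where
  "sup_norm4 D U = Max (range (\<lambda>i. sup_norm D (\<lambda>z. U z $ i)))"

definition partial_t :: "(real \<times> real \<times> real \<Rightarrow> real) \<Rightarrow> real \<times> real \<times> real \<Rightarrow> real" where
  "partial_t u = (\<lambda>(t, x, y). deriv (\<lambda>s. u (s, x, y)) t)"

definition partial_x :: "(real \<times> real \<times> real \<Rightarrow> real) \<Rightarrow> real \<times> real \<times> real \<Rightarrow> real" where
  "partial_x u = (\<lambda>(t, x, y). deriv (\<lambda>s. u (t, s, y)) x)"

definition partial_y :: "(real \<times> real \<times> real \<Rightarrow> real) \<Rightarrow> real \<times> real \<times> real \<Rightarrow> real" where
  "partial_y u = (\<lambda>(t, x, y). deriv (\<lambda>s. u (t, x, s)) y)"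

definition has_partials_at :: "(real \<times> real \<times> real \<Rightarrow> real) \<Rightarrow> real \<times> real \<times> real \<Rightarrow> bool" where
  "has_partials_at u = (\<lambda>(t, x, y).
     (\<lambda>s. u (s, x, y)) differentiable at t \<and>
     (\<lambda>s. u (t, s, y)) differentiable at x \<and>
     (\<lambda>s. u (t, x, s)) differentiable at y)"

definition partial_1 :: "(real \<times> real \<Rightarrow> real) \<Rightarrow> real \<times> real \<Rightarrow> real" where
  "partial_1 u = (\<lambda>(\<alpha>, \<beta>). deriv (\<lambda>s. u (s, \<beta>)) \<alpha>)"

definition partial_2 :: "(real \<times> real \<Rightarrow> real) \<Rightarrow> real \<times> real \<Rightarrow> real" where
  "partial_2 u = (\<lambda>(\<alpha>, \<beta>). deriv (\<lambda>s. u (\<alpha>, s)) \<beta>)"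

text \<open>Initial and boundary data on the rectangle \<open>[l1, h1] \<times> [l2, h2]\<close>: non-negative and continuous
  up to the boundary. The first partial derivatives are only required in the open rectangle, where they
  are bounded and continuous; this includes data that are continuously differentiable on the closed
  rectangle, and \<open>norm1\<close> then agrees with the norm taken over the closed rectangle.\<close>

definition admissible_datum ::
    "real \<Rightarrow> real \<Rightarrow> real \<Rightarrow> real \<Rightarrow> (real \<times> real \<Rightarrow> real) \<Rightarrow> bool" where
  "admissible_datum l1 h1 l2 h2 u \<longleftrightarrow>
     (\<forall>w \<in> {l1..h1} \<times> {l2..h2}. 0 \<le> u w) \<and>
     continuous_on ({l1..h1} \<times> {l2..h2}) u \<and>
     (\<forall>\<alpha> \<in> {l1<..<h1}. \<forall>\<beta> \<in> {l2<..<h2}.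
        (\<lambda>s. u (s, \<beta>)) differentiable at \<alpha> \<and> (\<lambda>s. u (\<alpha>, s)) differentiable at \<beta>) \<and>
     continuous_on ({l1<..<h1} \<times> {l2<..<h2}) (partial_1 u) \<and>
     continuous_on ({l1<..<h1} \<times> {l2<..<h2}) (partial_2 u) \<and>
     bounded (partial_1 u ` ({l1<..<h1} \<times> {l2<..<h2})) \<and>
     bounded (partial_2 u ` ({l1<..<h1} \<times> {l2<..<h2}))"

definition norm1 :: "real \<Rightarrow> real \<Rightarrow> real \<Rightarrow> real \<Rightarrow> (real \<times> real \<Rightarrow> real) \<Rightarrow> real" where
  "norm1 l1 h1 l2 h2 u =
     Max {sup_norm ({l1..h1} \<times> {l2..h2}) u,
          sup_norm ({l1<..<h1} \<times> {l2<..<h2}) (partial_1 u),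
          sup_norm ({l1<..<h1} \<times> {l2<..<h2}) (partial_2 u)}"

definition collision :: "real \<Rightarrow> real \<Rightarrow> real ^ 4 \<Rightarrow> real" where
  "collision c S N = 2 * c * S * (N $ 2 * N $ 3 - N $ 1 * N $ 4)"

text \<open>Each left-hand side of the system is the derivative along the characteristic direction
  \<open>(1, v1, v2)\<close>, where \<open>(v1, v2)\<close> is the velocity of the species.\<close>

definition has_char_derivative ::
    "(real \<times> real \<times> real \<Rightarrow> real) \<Rightarrow> real \<Rightarrow> real \<Rightarrow> real \<Rightarrow> real \<times> real \<times> real \<Rightarrow> bool" where
  "has_char_derivative u v1 v2 D = (\<lambda>(t, x, y).
     ((\<lambda>s. u (t + s, x + v1 * s, y + v2 * s)) has_real_derivative D) (at 0))"

definition solves_Sigma0 ::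
    "real \<Rightarrow> real \<Rightarrow> real \<Rightarrow> real \<Rightarrow> real \<Rightarrow> real \<Rightarrow> real \<Rightarrow> (real \<times> real \<Rightarrow> real ^ 4) \<Rightarrow>
     (real \<times> real \<Rightarrow> real) \<Rightarrow> (real \<times> real \<Rightarrow> real) \<Rightarrow> (real \<times> real \<Rightarrow> real) \<Rightarrow> (real \<times> real \<Rightarrow> real) \<Rightarrow>
     (real \<times> real \<times> real \<Rightarrow> real ^ 4) \<Rightarrow> bool" where
  "solves_Sigma0 c S T a1 b1 a2 b2 N0 N1m N2m N3p N4p N \<longleftrightarrow>
     (\<forall>z \<in> slab_interior T a1 b1 a2 b2.
        has_char_derivative (\<lambda>z. N z $ 1) c 0 (collision c S (N z)) z \<and>
        has_char_derivative (\<lambda>z. N z $ 2) 0 c (- collision c S (N z)) z \<and>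
        has_char_derivative (\<lambda>z. N z $ 3) 0 (- c) (- collision c S (N z)) z \<and>
        has_char_derivative (\<lambda>z. N z $ 4) (- c) 0 (collision c S (N z)) z) \<and>
     (\<forall>x \<in> {a1..b1}. \<forall>y \<in> {a2..b2}. \<forall>i. N (0, x, y) $ i = N0 (x, y) $ i) \<and>
     (\<forall>t \<in> {0..T}. \<forall>y \<in> {a2..b2}.
        N (t, a1, y) $ 1 = N1m (t, y) \<and> N (t, b1, y) $ 4 = N4p (t, y)) \<and>
     (\<forall>t \<in> {0..T}. \<forall>x \<in> {a1..b1}.
        N (t, x, a2) $ 2 = N2m (t, x) \<and> N (t, x, b2) $ 3 = N3p (t, x))"

definition nonneg_solution ::
    "real \<Rightarrow> real \<Rightarrow> real \<Rightarrow> real \<Rightarrow> real \<Rightarrow> real \<Rightarrow> real \<Rightarrow> (real \<times> real \<Rightarrow> real ^ 4) \<Rightarrow>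
     (real \<times> real \<Rightarrow> real) \<Rightarrow> (real \<times> real \<Rightarrow> real) \<Rightarrow> (real \<times> real \<Rightarrow> real) \<Rightarrow> (real \<times> real \<Rightarrow> real) \<Rightarrow>
     (real \<times> real \<times> real \<Rightarrow> real ^ 4) \<Rightarrow> bool" where
  "nonneg_solution c S T a1 b1 a2 b2 N0 N1m N2m N3p N4p N \<longleftrightarrow>
     continuous_on (slab T a1 b1 a2 b2) N \<and>
     (\<forall>z \<in> slab T a1 b1 a2 b2. \<forall>i. 0 \<le> N z $ i) \<and>
     solves_Sigma0 c S T a1 b1 a2 b2 N0 N1m N2m N3p N4p N"

definition const_p :: "real \<Rightarrow> real \<Rightarrow> real \<Rightarrow> real \<Rightarrow> real \<Rightarrow> real \<Rightarrow> real \<Rightarrow> real" where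
  "const_p c S T a1 b1 a2 b2 =
     4 * c * S * (1 + 2 * Max {4 * T, 2 / c * (b1 - a1), 1 / c * (b2 - a2)})"

definition const_q ::
    "real \<Rightarrow> real \<Rightarrow> real \<Rightarrow> real \<Rightarrow> real \<Rightarrow> real \<Rightarrow> (real \<times> real \<Rightarrow> real ^ 4) \<Rightarrow>
     (real \<times> real \<Rightarrow> real) \<Rightarrow> (real \<times> real \<Rightarrow> real) \<Rightarrow> (real \<times> real \<Rightarrow> real) \<Rightarrow> (real \<times> real \<Rightarrow> real) \<Rightarrow>
     real" where
  "const_q c T a1 b1 a2 b2 N0 N1m N2m N3p N4p = Max
     {max 1 (2 * c) * norm1 a1 b1 a2 b2 (\<lambda>w. N0 w $ 1),
      (1 + c) * norm1 0 T a2 b2 N1m,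
      max 1 (2 * c) * norm1 a1 b1 a2 b2 (\<lambda>w. N0 w $ 2),
      max 2 (1 + c) * norm1 0 T a1 b1 N2m,
      max 1 (2 * c) * norm1 a1 b1 a2 b2 (\<lambda>w. N0 w $ 3),
      max 2 (1 + c) * norm1 0 T a1 b1 N3p,
      max 1 (2 * c) * norm1 a1 b1 a2 b2 (\<lambda>w. N0 w $ 4),
      (2 + c) * norm1 0 T a2 b2 N4p}"

definition is_plane :: "(real \<times> real \<times> real) set \<Rightarrow> bool" where
  "is_plane H \<longleftrightarrow> (\<exists>n d. n \<noteq> 0 \<and> H = {z. n \<bullet> z = d})"

definition char_planes :: "real \<Rightarrow> real \<Rightarrow> real \<Rightarrow> real \<Rightarrow> real \<Rightarrow> (real \<times> real \<times> real) set set" where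
  "char_planes c a1 b1 a2 b2 =
     {{(t, x, y). - c * t + x = a1}, {(t, x, y). - c * t + y = a2},
      {(t, x, y). c * t + y = b2}, {(t, x, y). c * t + x = b1}}"

end

theory Submission
  imports Defs
begin

text \<open>Integrating each equation along its characteristics turns the problem into a fixed point equation
  \<open>N = B + G(N)\<close>: \<open>B i\<close> carries the datum from the point where the characteristic of species \<open>i\<close>
  enters the slab, and \<open>G\<close> integrates \<open>\<plusminus> Q(N)\<close> over the time spent in the slab, at most \<open>T\<close>.

  Let \<open>K\<close> be the bound in the theorem. It is the larger root of \<open>p K\<^sup>2 - K + q = 0\<close>, hence \<open>K > 0\<close>,
  \<open>p K \<le> 1\<close> and \<open>q + p K\<^sup>2 = K\<close>, while \<open>p \<ge> 4 c S (1 + 8 T)\<close>. Space-time increments are measured by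
  \<open>omega c (t, x, y) = \<bar>t\<bar> + (\<bar>x\<bar> + \<bar>y\<bar>) / c\<close>. A function with \<open>omega\<close>-Lipschitz constant \<open>K\<close> has time
  derivatives at most \<open>K\<close> and space derivatives at most \<open>K / c\<close>, which is what the theorem demands.
  Working with Lipschitz constants instead of derivatives has the advantage that the planes across
  which the derivatives jump are invisible. The map \<open>N \<mapsto> B + G(N)\<close> preserves the set of fields bounded
  by \<open>K\<close> with Lipschitz constant \<open>K\<close> (\<open>tame_step\<close>), because \<open>B\<close> contributes at most \<open>q\<close> and the quadratic
  term at most \<open>4 c S (1 + 8 T) K\<^sup>2\<close>; and it contracts the distance of two such fields in supremum and
  Lipschitz seminorm together (\<open>near_step\<close>), because \<open>32 c S T K \<le> 1\<close>. So the Picard iterates converge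
  in both.

  For the partial derivatives the right notion is the strict derivative in a direction, a difference
  quotient whose base point may move during the limit. It exists in every direction on an open set as
  soon as the function is continuously differentiable there, it yields the continuity of the partial
  derivatives, and it passes to limits in the Lipschitz seminorm (\<open>strict_deriv_limit\<close>) and through
  integrals by dominated convergence (\<open>strict_deriv_integral\<close>). The datum carried by \<open>B i\<close> has a kink
  only where the entry point passes from the face \<open>t = 0\<close> to the lateral face, which happens on one of
  the four characteristic planes. A characteristic of another species crosses this plane at most
  once, so that integration does not see the kink (\<open>finite_irregular_on_path\<close>). Hence all iterates
  and their limit are continuously differentiable off the four planes.

  Non-negativity is shown afterwards (\<open>negative_part_halves\<close>): where a component is negative, it
  decreases at most at a rate proportional to the largest negative part, and \<open>T\<close> is so short that a lower
  bound \<open>- m\<close> improves to \<open>- m / 2\<close>. Uniqueness holds among all continuous solutions, since the same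
  halving works for the difference of two solutions in a norm with weight \<open>exp (- L t)\<close>
  (\<open>difference_halves\<close>).\<close>

section \<open>Strict directional derivatives\<close>

text \<open>The base point \<open>a n\<close> may move towards \<open>z\<close> while the increment tends to zero. This uniformity makes the
  derivative continuous without mentioning it at neighbouring points, and the existence of all
  directional derivatives in this sense replaces continuous differentiability.\<close>

definition strict_deriv :: "('a::real_normed_vector \<Rightarrow> real) \<Rightarrow> 'a \<Rightarrow> 'a \<Rightarrow> real \<Rightarrow> bool" where
  "strict_deriv u z h d \<longleftrightarrow>
     (\<forall>a s. a \<longlonglongrightarrow> z \<longrightarrow> s \<longlonglongrightarrow> 0 \<longrightarrow> (\<forall>n. s n \<noteq> 0) \<longrightarrow>
        (\<lambda>n. (u (a n + s n *\<^sub>R h) - u (a n)) / s n) \<longlonglongrightarrow> d)"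

lemma strict_derivI:
  assumes "\<And>a s. \<lbrakk>a \<longlonglongrightarrow> z; s \<longlonglongrightarrow> 0; \<And>n. s n \<noteq> 0\<rbrakk>
             \<Longrightarrow> (\<lambda>n. (u (a n + s n *\<^sub>R h) - u (a n)) / s n) \<longlonglongrightarrow> d"
  shows "strict_deriv u z h d"
  using assms unfolding strict_deriv_def by blast

lemma strict_derivD:
  "\<lbrakk>strict_deriv u z h d; a \<longlonglongrightarrow> z; s \<longlonglongrightarrow> 0; \<And>n. s n \<noteq> 0\<rbrakk>
     \<Longrightarrow> (\<lambda>n. (u (a n + s n *\<^sub>R h) - u (a n)) / s n) \<longlonglongrightarrow> d"
  unfolding strict_deriv_def by blast

lemma moved_tendsto:
  fixes a :: "nat \<Rightarrow> 'a::real_normed_vector"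
  assumes "a \<longlonglongrightarrow> z" "s \<longlonglongrightarrow> 0"
  shows "(\<lambda>n. a n + s n *\<^sub>R h) \<longlonglongrightarrow> z"
proof -
  have "(\<lambda>n. a n + s n *\<^sub>R h) \<longlonglongrightarrow> z + 0 *\<^sub>R h"
    by (intro tendsto_intros assms)
  then show ?thesis by simp
qed

lemma strict_deriv_transform:
  assumes "strict_deriv u z h d" "open V" "z \<in> V" "\<And>x. x \<in> V \<Longrightarrow> u x = v x"
  shows "strict_deriv v z h d"
proof (rule strict_derivI)
  fix a :: "nat \<Rightarrow> 'a" and s :: "nat \<Rightarrow> real"
  assume as: "a \<longlonglongrightarrow> z" "s \<longlonglongrightarrow> 0" "\<And>n. s n \<noteq> 0"
  have "\<forall>\<^sub>F n in sequentially. a n \<in> V"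
    using as(1) assms(2,3) by (rule topological_tendstoD)
  moreover have "\<forall>\<^sub>F n in sequentially. a n + s n *\<^sub>R h \<in> V"
    using moved_tendsto[OF as(1,2)] assms(2,3) by (rule topological_tendstoD)
  ultimately have "\<forall>\<^sub>F n in sequentially.
      (u (a n + s n *\<^sub>R h) - u (a n)) / s n = (v (a n + s n *\<^sub>R h) - v (a n)) / s n"
    by eventually_elim (simp add: assms(4))
  then show "(\<lambda>n. (v (a n + s n *\<^sub>R h) - v (a n)) / s n) \<longlonglongrightarrow> d"
    using strict_derivD[OF assms(1) as] by (rule Lim_transform_eventually[rotated])
qed

lemma strict_deriv_const: "strict_deriv (\<lambda>x. k) z h 0"
  by (rule strict_derivI) simp

lemma strict_deriv_affine:
  assumes "\<And>x s. u (x + s *\<^sub>R h) = u x + s * d"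
  shows "strict_deriv u z h d"
  by (rule strict_derivI) (simp add: assms)

lemma strict_deriv_add:
  assumes "strict_deriv u z h d" "strict_deriv v z h e"
  shows "strict_deriv (\<lambda>x. u x + v x) z h (d + e)"
proof (rule strict_derivI)
  fix a :: "nat \<Rightarrow> 'a" and s :: "nat \<Rightarrow> real"
  assume as: "a \<longlonglongrightarrow> z" "s \<longlonglongrightarrow> 0" "\<And>n. s n \<noteq> 0"
  show "(\<lambda>n. (u (a n + s n *\<^sub>R h) + v (a n + s n *\<^sub>R h) - (u (a n) + v (a n))) / s n) \<longlonglongrightarrow> d + e"
    using tendsto_add[OF strict_derivD[OF assms(1) as] strict_derivD[OF assms(2) as]]
    by (simp add: diff_divide_distrib add_divide_distrib algebra_simps)
qed

lemma strict_deriv_mult: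
  assumes "strict_deriv u z h d" "strict_deriv v z h e" "isCont u z" "isCont v z"
  shows "strict_deriv (\<lambda>x. u x * v x) z h (u z * e + d * v z)"
proof (rule strict_derivI)
  fix a :: "nat \<Rightarrow> 'a" and s :: "nat \<Rightarrow> real"
  assume as: "a \<longlonglongrightarrow> z" "s \<longlonglongrightarrow> 0" "\<And>n. s n \<noteq> 0"
  have "(\<lambda>n. u (a n + s n *\<^sub>R h)) \<longlonglongrightarrow> u z"
    using moved_tendsto[OF as(1,2)] assms(3) by (metis isCont_tendsto_compose)
  moreover have "(\<lambda>n. v (a n)) \<longlonglongrightarrow> v z"
    using as(1) assms(4) by (metis isCont_tendsto_compose)
  ultimately have "(\<lambda>n. u (a n + s n *\<^sub>R h) * ((v (a n + s n *\<^sub>R h) - v (a n)) / s n)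
      + (u (a n + s n *\<^sub>R h) - u (a n)) / s n * v (a n)) \<longlonglongrightarrow> u z * e + d * v z"
    by (intro tendsto_intros strict_derivD[OF assms(1) as] strict_derivD[OF assms(2) as])
  moreover have "u (a n + s n *\<^sub>R h) * ((v (a n + s n *\<^sub>R h) - v (a n)) / s n)
      + (u (a n + s n *\<^sub>R h) - u (a n)) / s n * v (a n)
      = (u (a n + s n *\<^sub>R h) * v (a n + s n *\<^sub>R h) - u (a n) * v (a n)) / s n" for n
    by (simp add: diff_divide_distrib algebra_simps)
  ultimately show "(\<lambda>n. (u (a n + s n *\<^sub>R h) * v (a n + s n *\<^sub>R h) - u (a n) * v (a n)) / s n)
      \<longlonglongrightarrow> u z * e + d * v z"
    by simp
qed

lemma strict_deriv_cmult:
  assumes "strict_deriv u z h d"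
  shows "strict_deriv (\<lambda>x. k * u x) z h (k * d)"
proof (rule strict_derivI)
  fix a :: "nat \<Rightarrow> 'a" and s :: "nat \<Rightarrow> real"
  assume as: "a \<longlonglongrightarrow> z" "s \<longlonglongrightarrow> 0" "\<And>n. s n \<noteq> 0"
  show "(\<lambda>n. (k * u (a n + s n *\<^sub>R h) - k * u (a n)) / s n) \<longlonglongrightarrow> k * d"
    using tendsto_mult_left[OF strict_derivD[OF assms as], of k] by (simp add: algebra_simps)
qed

lemma strict_deriv_compose_affine:
  fixes f :: "'a::real_normed_vector \<Rightarrow> 'b::real_normed_vector"
  assumes "strict_deriv u (f z) k d" "isCont f z" "\<And>x s. f (x + s *\<^sub>R h) = f x + s *\<^sub>R k"
  shows "strict_deriv (\<lambda>x. u (f x)) z h d"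
proof (rule strict_derivI)
  fix a :: "nat \<Rightarrow> 'a" and s :: "nat \<Rightarrow> real"
  assume as: "a \<longlonglongrightarrow> z" "s \<longlonglongrightarrow> 0" "\<And>n. s n \<noteq> 0"
  have "(\<lambda>n. f (a n)) \<longlonglongrightarrow> f z"
    using as(1) assms(2) by (metis isCont_tendsto_compose)
  from strict_derivD[OF assms(1) this as(2,3)]
  show "(\<lambda>n. (u (f (a n + s n *\<^sub>R h)) - u (f (a n))) / s n) \<longlonglongrightarrow> d"
    by (simp add: assms(3))
qed

lemma strict_deriv_imp_DERIV:
  assumes "strict_deriv u z h d"
  shows "((\<lambda>s. u (z + s *\<^sub>R h)) has_real_derivative d) (at 0)"
proof -
  have "(\<lambda>s. (u (z + s *\<^sub>R h) - u z) / s) \<midarrow>0\<rightarrow> d"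
    unfolding tendsto_at_iff_sequentially comp_def
    using strict_derivD[OF assms tendsto_const] by auto
  then show "((\<lambda>s. u (z + s *\<^sub>R h)) has_real_derivative d) (at 0)"
    unfolding DERIV_def by simp
qed

lemma strict_deriv_abs_le:
  assumes "strict_deriv u z h d" "\<And>x s. \<bar>u (x + s *\<^sub>R h) - u x\<bar> \<le> C * \<bar>s\<bar>"
  shows "\<bar>d\<bar> \<le> C"
proof -
  let ?s = "\<lambda>n. inverse (real (Suc n))"
  have "(\<lambda>n. (u (z + ?s n *\<^sub>R h) - u z) / ?s n) \<longlonglongrightarrow> d"
    by (rule strict_derivD[OF assms(1) tendsto_const LIMSEQ_inverse_real_of_nat]) simp
  then have "(\<lambda>n. \<bar>(u (z + ?s n *\<^sub>R h) - u z) / ?s n\<bar>) \<longlonglongrightarrow> \<bar>d\<bar>"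
    by (rule tendsto_rabs)
  moreover have "\<bar>(u (z + ?s n *\<^sub>R h) - u z) / ?s n\<bar> \<le> C" for n
    using assms(2)[of z "?s n"] by (simp add: abs_divide divide_le_eq)
  ultimately show ?thesis
    by (meson LIMSEQ_le_const2)
qed

text \<open>The value \<open>g (x n)\<close> differs by at most \<open>1 / (n + 1)\<close> from a difference quotient at \<open>x n\<close> with a small
  increment, and the strict limit at \<open>z\<close> applies to these quotients.\<close>

lemma strict_deriv_continuous_on:
  fixes u :: "'a::real_normed_vector \<Rightarrow> real"
  assumes "\<And>z. z \<in> D \<Longrightarrow> strict_deriv u z h (g z)"
  shows "continuous_on D g"
  unfolding continuous_on_sequentially comp_def
proof (intro allI ballI impI)
  fix x z assume z: "z \<in> D" and x: "(\<forall>n. x n \<in> D) \<and> x \<longlonglongrightarrow> z"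
  let ?q = "\<lambda>n s. (u (x n + s *\<^sub>R h) - u (x n)) / s"
  have "\<exists>s. s \<noteq> 0 \<and> \<bar>s\<bar> \<le> inverse (real (Suc n)) \<and> \<bar>?q n s - g (x n)\<bar> \<le> inverse (real (Suc n))" for n
  proof -
    let ?s = "\<lambda>m. inverse (real (Suc m))"
    have "(\<lambda>m. ?q n (?s m)) \<longlonglongrightarrow> g (x n)"
      by (rule strict_derivD[OF assms tendsto_const LIMSEQ_inverse_real_of_nat]) (use x in auto)
    then have "\<forall>\<^sub>F m in sequentially. dist (?q n (?s m)) (g (x n)) < inverse (real (Suc n))"
      by (rule tendstoD) simp
    then have "\<forall>\<^sub>F m in sequentially. m \<ge> n \<and> dist (?q n (?s m)) (g (x n)) < inverse (real (Suc n))"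
      using eventually_ge_at_top by eventually_elim auto
    then obtain m where "m \<ge> n" "dist (?q n (?s m)) (g (x n)) < inverse (real (Suc n))"
      using eventually_happens by (metis (no_types, lifting) sequentially_bot)
    then show ?thesis
      by (intro exI[of _ "?s m"]) (auto simp: dist_real_def intro: le_imp_inverse_le)
  qed
  then obtain s where s: "\<And>n. s n \<noteq> 0" "\<And>n. \<bar>s n\<bar> \<le> inverse (real (Suc n))"
      "\<And>n. \<bar>?q n (s n) - g (x n)\<bar> \<le> inverse (real (Suc n))" by metis
  have s0: "s \<longlonglongrightarrow> 0"
    by (rule Lim_null_comparison[OF _ LIMSEQ_inverse_real_of_nat]) (use s(2) in simp)
  have "(\<lambda>n. ?q n (s n)) \<longlonglongrightarrow> g z"
    by (rule strict_derivD[OF assms[OF z] _ s0 s(1)]) (use x in auto)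
  moreover have "(\<lambda>n. ?q n (s n) - g (x n)) \<longlonglongrightarrow> 0"
    by (rule Lim_null_comparison[OF _ LIMSEQ_inverse_real_of_nat]) (use s(3) in simp)
  ultimately show "(\<lambda>n. g (x n)) \<longlonglongrightarrow> g z"
    using tendsto_diff by fastforce
qed

text \<open>A small Lipschitz constant of \<open>f k - u\<close> makes all difference quotients of \<open>f k\<close> and \<open>u\<close> close, uniformly
  in base point and increment, so the two limits may be exchanged.\<close>

lemma strict_deriv_limit:
  fixes u :: "'a::real_normed_vector \<Rightarrow> real"
  assumes sd: "\<And>k. \<exists>d. strict_deriv (f k) z h d"
    and lip: "\<And>k x s. \<bar>(f k (x + s *\<^sub>R h) - u (x + s *\<^sub>R h)) - (f k x - u x)\<bar> \<le> e k * \<bar>s\<bar>"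
    and e: "e \<longlonglongrightarrow> (0::real)"
  shows "\<exists>d. strict_deriv u z h d"
proof -
  obtain d where d: "\<And>k. strict_deriv (f k) z h (d k)" using sd by metis
  have dd: "\<bar>d k - d j\<bar> \<le> e k + e j" for k j
  proof -
    have "strict_deriv (\<lambda>x. f k x + (-1) * f j x) z h (d k + (-1) * d j)"
      by (intro strict_deriv_add strict_deriv_cmult d)
    moreover have "\<bar>(f k (x + s *\<^sub>R h) + (-1) * f j (x + s *\<^sub>R h)) - (f k x + (-1) * f j x)\<bar>
        \<le> (e k + e j) * \<bar>s\<bar>" for x s
      using lip[of k x s] lip[of j x s] by (simp add: algebra_simps)
    ultimately show ?thesis using strict_deriv_abs_le by fastforce
  qed
  have "Cauchy d"
  proof (rule metric_CauchyI)
    fix \<epsilon> :: real assume "\<epsilon> > 0"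
    then have "\<forall>\<^sub>F k in sequentially. \<bar>e k\<bar> < \<epsilon> / 2"
      using tendstoD[OF e, of "\<epsilon> / 2"] by (simp add: dist_real_def)
    then obtain M where M: "\<And>k. k \<ge> M \<Longrightarrow> \<bar>e k\<bar> < \<epsilon> / 2"
      unfolding eventually_sequentially by blast
    show "\<exists>M. \<forall>m\<ge>M. \<forall>n\<ge>M. dist (d m) (d n) < \<epsilon>"
    proof (intro exI allI impI)
      fix m n assume "m \<ge> M" "n \<ge> M"
      with M[of m] M[of n] dd[of m n] show "dist (d m) (d n) < \<epsilon>"
        by (simp add: dist_real_def)
    qed
  qed
  then obtain l where l: "d \<longlonglongrightarrow> l"
    using Cauchy_convergent_iff convergent_def by blast
  have "strict_deriv u z h l"
  proof (rule strict_derivI)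
    fix a :: "nat \<Rightarrow> 'a" and s :: "nat \<Rightarrow> real"
    assume as: "a \<longlonglongrightarrow> z" "s \<longlonglongrightarrow> 0" "\<And>n. s n \<noteq> 0"
    let ?q = "\<lambda>v n. (v (a n + s n *\<^sub>R h) - v (a n)) / s n"
    have le: "\<bar>?q (f k) n - ?q u n\<bar> \<le> e k" for k n
    proof -
      have "?q (f k) n - ?q u n
          = ((f k (a n + s n *\<^sub>R h) - u (a n + s n *\<^sub>R h)) - (f k (a n) - u (a n))) / s n"
        by (simp add: diff_divide_distrib)
      with lip[of k "a n" "s n"] as(3)[of n] show ?thesis
        by (simp add: abs_divide divide_le_eq)
    qed
    have unif: "uniform_limit UNIV (\<lambda>k. ?q (f k)) (?q u) sequentially"
    proof (rule uniform_limitI)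
      fix \<epsilon> :: real assume "\<epsilon> > 0"
      from tendstoD[OF e this] show "\<forall>\<^sub>F k in sequentially. \<forall>n\<in>UNIV. dist (?q (f k) n) (?q u n) < \<epsilon>"
      proof eventually_elim
        case (elim k)
        then have "e k < \<epsilon>" by (simp add: dist_real_def)
        then show ?case unfolding dist_real_def by (intro ballI le_less_trans[OF le])
      qed
    qed
    have q: "?q (f k) \<longlonglongrightarrow> d k" for k by (rule strict_derivD[OF d as])
    show "?q u \<longlonglongrightarrow> l"
      by (rule swap_uniform_limit'[OF _ l unif])
         (simp_all only: q eventually_True UNIV_I sequentially_bot not_False_eq_True)
  qed
  then show ?thesis by blast
qed

text \<open>Dominated convergence under the integral. The exceptional set \<open>X\<close> accommodates the parameters at which
  the path \<open>\<theta> \<mapsto> \<phi> \<theta>\<close> meets a plane where the integrand has a kink.\<close>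

lemma strict_deriv_integral:
  fixes \<phi> :: "real \<Rightarrow> 'a::real_normed_vector \<Rightarrow> real"
  assumes fin: "finite X"
    and sd: "\<And>\<theta>. \<theta> \<in> {0..1} - X \<Longrightarrow> \<exists>d. strict_deriv (\<phi> \<theta>) z h d"
    and lip: "\<And>\<theta> x s. \<theta> \<in> {0..1} \<Longrightarrow> \<bar>\<phi> \<theta> (x + s *\<^sub>R h) - \<phi> \<theta> x\<bar> \<le> C * \<bar>s\<bar>"
    and cont: "\<And>x. continuous_on {0..1} (\<lambda>\<theta>. \<phi> \<theta> x)"
  shows "\<exists>d. strict_deriv (\<lambda>x. integral {0..1} (\<lambda>\<theta>. \<phi> \<theta> x)) z h d"
proof -
  obtain d where d: "\<And>\<theta>. \<theta> \<in> {0..1} - X \<Longrightarrow> strict_deriv (\<phi> \<theta>) z h (d \<theta>)"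
    using sd by metis
  let ?S = "{0..1} - X"
  have neg: "negligible X" using fin by (rule negligible_finite)
  have int: "integral {0..1} f = integral ?S f" for f :: "real \<Rightarrow> real"
    by (rule integral_spike_set) (rule negligible_subset[OF neg], auto)+
  have int': "f integrable_on ?S" if "f integrable_on {0..1}" for f :: "real \<Rightarrow> real"
    by (rule integrable_spike_set[OF that]) (rule negligible_subset[OF neg], auto)+
  have ig: "(\<lambda>\<theta>. \<phi> \<theta> x) integrable_on {0..1}" for x
    by (rule integrable_continuous_real[OF cont])
  have "strict_deriv (\<lambda>x. integral {0..1} (\<lambda>\<theta>. \<phi> \<theta> x)) z h (integral ?S d)"
  proof (rule strict_derivI)
    fix a :: "nat \<Rightarrow> 'a" and s :: "nat \<Rightarrow> real"
    assume as: "a \<longlonglongrightarrow> z" "s \<longlonglongrightarrow> 0" "\<And>n. s n \<noteq> 0"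
    let ?q = "\<lambda>n \<theta>. (\<phi> \<theta> (a n + s n *\<^sub>R h) - \<phi> \<theta> (a n)) / s n"
    have "(integral {0..1} (\<lambda>\<theta>. \<phi> \<theta> (a n + s n *\<^sub>R h)) - integral {0..1} (\<lambda>\<theta>. \<phi> \<theta> (a n))) / s n
        = integral ?S (?q n)" for n
      by (simp add: int integral_diff[OF int'[OF ig] int'[OF ig]])
    moreover have "(\<lambda>n. integral ?S (?q n)) \<longlonglongrightarrow> integral ?S d"
    proof (rule dominated_convergence(2))
      show "?q n integrable_on ?S" for n
        by (rule int'[OF integrable_on_divide[OF integrable_diff[OF ig ig]]])
      show "(\<lambda>_. C) integrable_on ?S" by (intro int' integrable_const_ivl)
      show "norm (?q n \<theta>) \<le> C" if "\<theta> \<in> ?S" for n \<theta>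
        using lip[of \<theta> "a n" "s n"] that as(3)[of n] by (simp add: abs_divide divide_le_eq)
      show "(\<lambda>n. ?q n \<theta>) \<longlonglongrightarrow> d \<theta>" if "\<theta> \<in> ?S" for \<theta>
        using strict_derivD[OF d[OF that] as] .
    qed
    ultimately show "(\<lambda>n. (integral {0..1} (\<lambda>\<theta>. \<phi> \<theta> (a n + s n *\<^sub>R h))
        - integral {0..1} (\<lambda>\<theta>. \<phi> \<theta> (a n))) / s n) \<longlonglongrightarrow> integral ?S d"
      by (simp only:)
  qed
  then show ?thesis by blast
qed

lemma strict_deriv_add_direction:
  assumes "strict_deriv u z h d" "strict_deriv u z k e"
  shows "strict_deriv u z (h + k) (d + e)"
proof (rule strict_derivI)
  fix a :: "nat \<Rightarrow> 'a" and s :: "nat \<Rightarrow> real"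
  assume as: "a \<longlonglongrightarrow> z" "s \<longlonglongrightarrow> 0" "\<And>n. s n \<noteq> 0"
  have "(\<lambda>n. (u (a n + s n *\<^sub>R k + s n *\<^sub>R h) - u (a n + s n *\<^sub>R k)) / s n
      + (u (a n + s n *\<^sub>R k) - u (a n)) / s n) \<longlonglongrightarrow> d + e"
    by (intro tendsto_add strict_derivD[OF assms(1) moved_tendsto[OF as(1,2)] as(2,3)]
        strict_derivD[OF assms(2) as])
  then show "(\<lambda>n. (u (a n + s n *\<^sub>R (h + k)) - u (a n)) / s n) \<longlonglongrightarrow> d + e"
    by (simp add: add_divide_distrib[symmetric] algebra_simps)
qed

lemma strict_deriv_scale_direction:
  assumes "strict_deriv u z h d"
  shows "strict_deriv u z (r *\<^sub>R h) (r * d)"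
proof (cases "r = 0")
  case True
  then show ?thesis by (auto intro: strict_deriv_affine)
next
  case False
  show ?thesis
  proof (rule strict_derivI)
    fix a :: "nat \<Rightarrow> 'a" and s :: "nat \<Rightarrow> real"
    assume as: "a \<longlonglongrightarrow> z" "s \<longlonglongrightarrow> 0" "\<And>n. s n \<noteq> 0"
    have "(\<lambda>n. s n * r) \<longlonglongrightarrow> 0" using tendsto_mult_left_zero[OF as(2)] .
    then have "(\<lambda>n. (u (a n + (s n * r) *\<^sub>R h) - u (a n)) / (s n * r)) \<longlonglongrightarrow> d"
      by (rule strict_derivD[OF assms as(1)]) (use as(3) False in simp)
    from tendsto_mult_left[OF this, of r]
    show "(\<lambda>n. (u (a n + s n *\<^sub>R r *\<^sub>R h) - u (a n)) / s n) \<longlonglongrightarrow> r * d"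
      using False as(3) by simp
  qed
qed

text \<open>The mean value inequality for \<open>r \<mapsto> u (a + r h) - r g z\<close> compares the quotient with \<open>g z\<close>.\<close>

lemma strict_deriv_of_continuous_derivative:
  assumes "open V" "z \<in> V" "continuous_on V g"
    and der: "\<And>x. x \<in> V \<Longrightarrow> ((\<lambda>s. u (x + s *\<^sub>R h)) has_real_derivative g x) (at 0)"
  shows "strict_deriv u z h (g z)"
proof (rule strict_derivI)
  fix a :: "nat \<Rightarrow> 'a" and s :: "nat \<Rightarrow> real"
  assume as: "a \<longlonglongrightarrow> z" "s \<longlonglongrightarrow> 0" "\<And>n. s n \<noteq> 0"
  show "(\<lambda>n. (u (a n + s n *\<^sub>R h) - u (a n)) / s n) \<longlonglongrightarrow> g z"
  proof (rule tendstoI)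
    fix \<epsilon> :: real assume "\<epsilon> > 0"
    have "isCont g z" using assms(1-3) by (simp add: continuous_on_eq_continuous_at)
    then obtain \<delta>' where \<delta>': "\<delta>' > 0" "\<And>x. dist x z < \<delta>' \<Longrightarrow> dist (g x) (g z) < \<epsilon> / 2"
      using \<open>\<epsilon> > 0\<close> unfolding continuous_at_eps_delta by (meson half_gt_zero)
    obtain \<rho> where \<rho>: "\<rho> > 0" "ball z \<rho> \<subseteq> V" using assms(1,2) openE by blast
    define \<delta> where "\<delta> = min \<delta>' \<rho>"
    have "\<delta> > 0" using \<delta>' \<rho> by (simp add: \<delta>_def)
    have "\<forall>\<^sub>F n in sequentially. dist (a n) z < \<delta>" by (rule tendstoD[OF as(1) \<open>\<delta> > 0\<close>])
    moreover have "\<forall>\<^sub>F n in sequentially. dist (a n + s n *\<^sub>R h) z < \<delta>"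
      by (rule tendstoD[OF moved_tendsto[OF as(1,2)] \<open>\<delta> > 0\<close>])
    ultimately show "\<forall>\<^sub>F n in sequentially. dist ((u (a n + s n *\<^sub>R h) - u (a n)) / s n) (g z) < \<epsilon>"
    proof eventually_elim
      case (elim n)
      let ?\<psi> = "\<lambda>r. u (a n + r *\<^sub>R h) - r * g z"
      have near: "a n + r *\<^sub>R h \<in> ball z \<delta>" if r: "r \<in> closed_segment 0 (s n)" for r
      proof -
        obtain l where l: "0 \<le> l" "l \<le> 1" "r = (1 - l) *\<^sub>R 0 + l *\<^sub>R s n"
          using r unfolding in_segment by blast
        have "a n + r *\<^sub>R h = (1 - l) *\<^sub>R a n + l *\<^sub>R (a n + s n *\<^sub>R h)"
          by (simp add: l(3) algebra_simps)
        moreover have "\<dots> \<in> ball z \<delta>"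
          by (rule convexD[OF convex_ball]) (use elim l in \<open>auto simp: dist_commute\<close>)
        ultimately show ?thesis by simp
      qed
      have "norm (?\<psi> (s n) - ?\<psi> 0) \<le> \<epsilon> / 2 * norm (s n - 0)"
      proof (rule field_differentiable_bound[where S = "closed_segment 0 (s n)"
            and f' = "\<lambda>r. g (a n + r *\<^sub>R h) - g z"])
        fix r assume r: "r \<in> closed_segment 0 (s n)"
        have V: "a n + r *\<^sub>R h \<in> V" using near[OF r] \<rho>(2) by (auto simp: \<delta>_def)
        have "((\<lambda>q. u (a n + r *\<^sub>R h + q *\<^sub>R h)) has_real_derivative g (a n + r *\<^sub>R h)) (at (0::real))"
          by (rule der[OF V])
        then have "((\<lambda>q. (\<lambda>p. u (a n + p *\<^sub>R h)) (r + q)) has_real_derivative g (a n + r *\<^sub>R h)) (at (0::real))"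
          by (simp add: algebra_simps)
        then have dp: "((\<lambda>p. u (a n + p *\<^sub>R h)) has_real_derivative g (a n + r *\<^sub>R h)) (at r)"
          using DERIV_at_within_shift[of "\<lambda>p. u (a n + p *\<^sub>R h)" _ r 0 UNIV] by simp
        show "(?\<psi> has_field_derivative g (a n + r *\<^sub>R h) - g z) (at r within closed_segment 0 (s n))"
          using DERIV_subset[OF DERIV_diff[OF dp DERIV_cmult_right[OF DERIV_ident, of "g z"]] subset_UNIV]
          by simp
        show "norm (g (a n + r *\<^sub>R h) - g z) \<le> \<epsilon> / 2"
          using \<delta>'(2)[of "a n + r *\<^sub>R h"] near[OF r] by (simp add: \<delta>_def dist_norm norm_minus_commute)
      qed auto
      moreover have "(u (a n + s n *\<^sub>R h) - u (a n)) / s n - g z = (?\<psi> (s n) - ?\<psi> 0) / s n"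
        using as(3)[of n] by (simp add: field_simps)
      ultimately have "\<bar>(u (a n + s n *\<^sub>R h) - u (a n)) / s n - g z\<bar> \<le> \<epsilon> / 2"
        using as(3)[of n] by (simp add: abs_divide divide_le_eq)
      with \<open>\<epsilon> > 0\<close> show ?case by (simp add: dist_real_def)
    qed
  qed
qed

section \<open>Initial and boundary data\<close>

text \<open>The consequences of admissibility that the argument needs. They carry over to exchanged and reflected
  coordinates without any computation of derivatives.\<close>

definition regular_datum :: "real \<Rightarrow> real \<Rightarrow> real \<Rightarrow> real \<Rightarrow> real \<Rightarrow> (real \<times> real \<Rightarrow> real) \<Rightarrow> bool" where
  "regular_datum l1 h1 l2 h2 n u \<longleftrightarrow>
     (\<forall>w\<in>{l1..h1} \<times> {l2..h2}. 0 \<le> u w \<and> u w \<le> n) \<and>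
     (\<forall>w\<in>{l1..h1} \<times> {l2..h2}. \<forall>w'\<in>{l1..h1} \<times> {l2..h2}.
        \<bar>u w - u w'\<bar> \<le> n * (\<bar>fst w - fst w'\<bar> + \<bar>snd w - snd w'\<bar>)) \<and>
     (\<forall>w\<in>{l1<..<h1} \<times> {l2<..<h2}. \<forall>k. \<exists>d. strict_deriv u w k d)"

lemma abs_le_sup_norm:
  assumes "bounded (u ` D)" "z \<in> D"
  shows "\<bar>u z\<bar> \<le> sup_norm D u"
proof -
  obtain B where "\<And>z. z \<in> D \<Longrightarrow> \<bar>u z\<bar> \<le> B"
    using assms(1) by (auto simp: bounded_iff)
  then have "bdd_above ((\<lambda>z. \<bar>u z\<bar>) ` D)" by (rule bdd_aboveI2)
  then show ?thesis unfolding sup_norm_def using assms(2) by (rule cSUP_upper2) simp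
qed

lemma admissible_datum_bounds:
  assumes "admissible_datum l1 h1 l2 h2 u"
  shows "w \<in> {l1..h1} \<times> {l2..h2} \<Longrightarrow> \<bar>u w\<bar> \<le> norm1 l1 h1 l2 h2 u"
    and "w \<in> {l1<..<h1} \<times> {l2<..<h2} \<Longrightarrow> \<bar>partial_1 u w\<bar> \<le> norm1 l1 h1 l2 h2 u"
    and "w \<in> {l1<..<h1} \<times> {l2<..<h2} \<Longrightarrow> \<bar>partial_2 u w\<bar> \<le> norm1 l1 h1 l2 h2 u"
proof -
  have "bounded (u ` ({l1..h1} \<times> {l2..h2}))"
    using assms unfolding admissible_datum_def
    by (intro compact_imp_bounded compact_continuous_image compact_Times compact_Icc) auto
  then show "\<bar>u w\<bar> \<le> norm1 l1 h1 l2 h2 u" if "w \<in> {l1..h1} \<times> {l2..h2}"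
    using abs_le_sup_norm[OF _ that] unfolding norm1_def by fastforce
  show "\<bar>partial_1 u w\<bar> \<le> norm1 l1 h1 l2 h2 u" if "w \<in> {l1<..<h1} \<times> {l2<..<h2}"
    using abs_le_sup_norm[OF _ that, of "partial_1 u"] assms
    unfolding norm1_def admissible_datum_def by fastforce
  show "\<bar>partial_2 u w\<bar> \<le> norm1 l1 h1 l2 h2 u" if "w \<in> {l1<..<h1} \<times> {l2<..<h2}"
    using abs_le_sup_norm[OF _ that, of "partial_2 u"] assms
    unfolding norm1_def admissible_datum_def by fastforce
qed

text \<open>The derivatives are known in the open rectangle only: the Lipschitz bound is proved there, one
  coordinate at a time, and extends to the closed rectangle by continuity.\<close>

lemma admissible_imp_regular_datum:
  assumes lt: "l1 < h1" "l2 < h2" and adm: "admissible_datum l1 h1 l2 h2 u"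
  shows "regular_datum l1 h1 l2 h2 (norm1 l1 h1 l2 h2 u) u"
proof -
  let ?n = "norm1 l1 h1 l2 h2 u"
  let ?R = "{l1..h1} \<times> {l2..h2}" and ?O = "{l1<..<h1} \<times> {l2<..<h2}"
  have cont: "continuous_on ?R u" using adm by (simp add: admissible_datum_def)
  have clos: "closure ?O = ?R" using lt by (simp add: closure_Times)
  have op: "open ?O" by (intro open_Times) auto
  have d1: "((\<lambda>s. u (s, \<beta>)) has_real_derivative partial_1 u (\<alpha>, \<beta>)) (at \<alpha>)"
    and d2: "((\<lambda>s. u (\<alpha>, s)) has_real_derivative partial_2 u (\<alpha>, \<beta>)) (at \<beta>)"
    if "(\<alpha>, \<beta>) \<in> ?O" for \<alpha> \<beta>
    using that adm unfolding admissible_datum_def partial_1_def partial_2_def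
    by (auto simp: DERIV_deriv_iff_real_differentiable)
  have lipO: "\<bar>u w - u w'\<bar> \<le> ?n * (\<bar>fst w - fst w'\<bar> + \<bar>snd w - snd w'\<bar>)" if "w \<in> ?O" "w' \<in> ?O" for w w'
  proof -
    obtain \<alpha> \<beta> \<alpha>' \<beta>' where [simp]: "w = (\<alpha>, \<beta>)" "w' = (\<alpha>', \<beta>')" by (metis surj_pair)
    have "norm (u (\<alpha>, \<beta>) - u (\<alpha>', \<beta>)) \<le> ?n * norm (\<alpha> - \<alpha>')"
      by (rule field_differentiable_bound[where S = "{l1<..<h1}" and f' = "\<lambda>s. partial_1 u (s, \<beta>)"])
         (use that d1 admissible_datum_bounds(2)[OF adm] in \<open>auto intro: DERIV_subset\<close>)
    moreover have "norm (u (\<alpha>', \<beta>) - u (\<alpha>', \<beta>')) \<le> ?n * norm (\<beta> - \<beta>')"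
      by (rule field_differentiable_bound[where S = "{l2<..<h2}" and f' = "\<lambda>s. partial_2 u (\<alpha>', s)"])
         (use that d2 admissible_datum_bounds(3)[OF adm] in \<open>auto intro: DERIV_subset\<close>)
    ultimately show ?thesis by (simp add: distrib_left)
  qed
  have lip: "\<bar>u w - u w'\<bar> \<le> ?n * (\<bar>fst w - fst w'\<bar> + \<bar>snd w - snd w'\<bar>)" if w: "w \<in> ?R" "w' \<in> ?R" for w w'
  proof -
    have "(w, w') \<in> closure (?O \<times> ?O)" using w clos by (simp add: closure_Times)
    then obtain v where v: "\<And>n. v n \<in> ?O \<times> ?O" "v \<longlonglongrightarrow> (w, w')"
      unfolding closure_sequential by blast
    have v1: "(\<lambda>n. fst (v n)) \<longlonglongrightarrow> w" and v2: "(\<lambda>n. snd (v n)) \<longlonglongrightarrow> w'"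
      using tendsto_fst[OF v(2)] tendsto_snd[OF v(2)] by simp_all
    have mem: "fst (v n) \<in> ?O" "snd (v n) \<in> ?O" for n using v(1)[of n] by auto
    have R: "?O \<subseteq> ?R" by auto
    have memR: "fst (v n) \<in> ?R" "snd (v n) \<in> ?R" for n
      by (rule subsetD[OF R mem(1)], rule subsetD[OF R mem(2)])
    have u1: "(\<lambda>n. u (fst (v n))) \<longlonglongrightarrow> u w"
      by (rule continuous_on_tendsto_compose[OF cont v1 w(1)]) (intro always_eventually allI memR)
    have u2: "(\<lambda>n. u (snd (v n))) \<longlonglongrightarrow> u w'"
      by (rule continuous_on_tendsto_compose[OF cont v2 w(2)]) (intro always_eventually allI memR)
    show ?thesis
    proof (rule LIMSEQ_le)
      show "(\<lambda>n. \<bar>u (fst (v n)) - u (snd (v n))\<bar>) \<longlonglongrightarrow> \<bar>u w - u w'\<bar>"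
        by (intro tendsto_intros u1 u2)
      show "(\<lambda>n. ?n * (\<bar>fst (fst (v n)) - fst (snd (v n))\<bar> + \<bar>snd (fst (v n)) - snd (snd (v n))\<bar>))
          \<longlonglongrightarrow> ?n * (\<bar>fst w - fst w'\<bar> + \<bar>snd w - snd w'\<bar>)"
        by (intro tendsto_intros v1 v2)
    qed (use lipO[OF mem] in blast)
  qed
  have sd: "\<exists>d. strict_deriv u w k d" if w: "w \<in> ?O" for w k
  proof -
    have "strict_deriv u w (1, 0) (partial_1 u w)"
    proof (rule strict_deriv_of_continuous_derivative[OF op w])
      show "continuous_on ?O (partial_1 u)" using adm by (simp add: admissible_datum_def)
      show "((\<lambda>s. u (x + s *\<^sub>R (1, 0))) has_real_derivative partial_1 u x) (at 0)" if "x \<in> ?O" for x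
        using DERIV_at_within_shift[of "\<lambda>s. u (s, snd x)" "partial_1 u x" "fst x" 0 UNIV]
          d1[of "fst x" "snd x"] that by (cases x) simp
    qed
    moreover have "strict_deriv u w (0, 1) (partial_2 u w)"
    proof (rule strict_deriv_of_continuous_derivative[OF op w])
      show "continuous_on ?O (partial_2 u)" using adm by (simp add: admissible_datum_def)
      show "((\<lambda>s. u (x + s *\<^sub>R (0, 1))) has_real_derivative partial_2 u x) (at 0)" if "x \<in> ?O" for x
        using DERIV_at_within_shift[of "\<lambda>s. u (fst x, s)" "partial_2 u x" "snd x" 0 UNIV]
          d2[of "fst x" "snd x"] that by (cases x) simp
    qed
    ultimately have "strict_deriv u w (fst k *\<^sub>R (1, 0) + snd k *\<^sub>R (0, 1))
        (fst k * partial_1 u w + snd k * partial_2 u w)"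
      by (intro strict_deriv_add_direction strict_deriv_scale_direction)
    then show ?thesis by auto
  qed
  have "0 \<le> u w \<and> u w \<le> ?n" if "w \<in> ?R" for w
    using admissible_datum_bounds(1)[OF adm that] adm that by (auto simp: admissible_datum_def)
  with lip sd show ?thesis unfolding regular_datum_def by blast
qed

section \<open>The datum at the entry point of a characteristic\<close>

text \<open>The norm adapted to the speed \<open>c\<close>: the velocity of each species has norm 2.\<close>

definition omega :: "real \<Rightarrow> real \<times> real \<times> real \<Rightarrow> real" where
  "omega c h = \<bar>fst h\<bar> + (\<bar>fst (snd h)\<bar> + \<bar>snd (snd h)\<bar>) / c"

lemma omega_nonneg: "c > 0 \<Longrightarrow> 0 \<le> omega c h"
  by (simp add: omega_def)

lemma omega_scaleR: "omega c (s *\<^sub>R h) = \<bar>s\<bar> * omega c h"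
  by (simp add: omega_def abs_mult distrib_left)

lemma omega_add: "c > 0 \<Longrightarrow> omega c (g + h) \<le> omega c g + omega c h"
proof -
  assume "c > 0"
  then have "(\<bar>fst (snd g) + fst (snd h)\<bar> + \<bar>snd (snd g) + snd (snd h)\<bar>) / c
      \<le> ((\<bar>fst (snd g)\<bar> + \<bar>fst (snd h)\<bar>) + (\<bar>snd (snd g)\<bar> + \<bar>snd (snd h)\<bar>)) / c"
    by (intro divide_right_mono add_mono abs_triangle_ineq) simp
  then show ?thesis
    unfolding omega_def using abs_triangle_ineq[of "fst g" "fst h"]
    by (simp add: add_divide_distrib)
qed

lemma omega_diff: "c > 0 \<Longrightarrow> omega c (g - h) \<le> omega c g + omega c h"
  using omega_add[of c g "(-1) *\<^sub>R h"] omega_scaleR[of c "-1" h] by simp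

lemma omega_lipschitz_isCont:
  assumes "\<And>x x'. \<bar>u x - u x'\<bar> \<le> L * omega c (x - x')"
  shows "isCont u z"
proof -
  have "((\<lambda>x. L * omega c (x - z)) \<longlongrightarrow> L * omega c (z - z)) (at z)"
    unfolding omega_def divide_inverse by (intro tendsto_intros)
  then have "((\<lambda>x. L * omega c (x - z)) \<longlongrightarrow> 0) (at z)" by (simp add: omega_def)
  then have "((\<lambda>x. u x - u z) \<longlongrightarrow> 0) (at z)"
    by (rule Lim_null_comparison[rotated]) (simp add: assms)
  then show ?thesis unfolding isCont_def by (rule LIM_zero_cancel)
qed

text \<open>The datum in coordinates in which the species moves with velocity \<open>(c, 0)\<close> away from the face \<open>\<xi> = a\<close>.
  The characteristic through \<open>(\<tau>, \<xi>, \<eta>)\<close> comes from the face \<open>\<tau> = 0\<close> if \<open>c \<tau> \<le> \<xi> - a\<close>, and otherwise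
  from the face \<open>\<xi> = a\<close>, which it left at time \<open>\<tau> - (\<xi> - a) / c\<close>.\<close>

definition entry_datum ::
  "real \<Rightarrow> real \<Rightarrow> (real \<times> real \<Rightarrow> real) \<Rightarrow> (real \<times> real \<Rightarrow> real) \<Rightarrow> real \<times> real \<times> real \<Rightarrow> real" where
  "entry_datum c a u0 um = (\<lambda>(\<tau>, \<xi>, \<eta>).
     if c * \<tau> \<le> \<xi> - a then u0 (\<xi> - c * \<tau>, \<eta>) else um (\<tau> - (\<xi> - a) / c, \<eta>))"

lemma regular_datumD:
  assumes "regular_datum l1 h1 l2 h2 n u" "w \<in> {l1..h1} \<times> {l2..h2}"
  shows "0 \<le> u w" "u w \<le> n"
    and "w' \<in> {l1..h1} \<times> {l2..h2} \<Longrightarrow> \<bar>u w - u w'\<bar> \<le> n * (\<bar>fst w - fst w'\<bar> + \<bar>snd w - snd w'\<bar>)"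
proof -
  note d = assms(1)[unfolded regular_datum_def]
  show "0 \<le> u w" "u w \<le> n" using bspec[OF conjunct1[OF d] assms(2)] by simp_all
  show "\<bar>u w - u w'\<bar> \<le> n * (\<bar>fst w - fst w'\<bar> + \<bar>snd w - snd w'\<bar>)"
    if "w' \<in> {l1..h1} \<times> {l2..h2}"
    using bspec[OF bspec[OF conjunct1[OF conjunct2[OF d]] assms(2)] that] .
qed

text \<open>The factor \<open>c\<close> in the sizes of the data makes up for the division by \<open>c\<close> in \<open>omega\<close>.\<close>

locale entry_data =
  fixes c T a b l h n0 n1 q :: real and u0 um :: "real \<times> real \<Rightarrow> real"
  assumes c: "c > 0" and T: "T > 0" and ab: "a < b" and lh: "l < h"
    and u0: "regular_datum a b l h n0 u0" and um: "regular_datum 0 T l h n1 um"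
    and compat: "\<And>\<eta>. \<eta> \<in> {l..h} \<Longrightarrow> u0 (a, \<eta>) = um (0, \<eta>)"
    and size: "n0 \<le> q" "c * n0 \<le> q" "n1 \<le> q" "c * n1 \<le> q"
begin

abbreviation "region \<equiv> {0..T} \<times> {a..b} \<times> {l..h}"

lemma n_nonneg: "0 \<le> n0" "0 \<le> n1" "0 \<le> q"
proof -
  have "0 \<le> u0 (a, l) \<and> u0 (a, l) \<le> n0" "0 \<le> um (0, l) \<and> um (0, l) \<le> n1"
    using u0 um ab lh T by (auto simp: regular_datum_def)
  with size show "0 \<le> n0" "0 \<le> n1" "0 \<le> q" by auto
qed

text \<open>By compatibility both branches agree on the plane \<open>\<xi> - a = c \<tau>\<close>.\<close>

lemma entry_datum_late:
  assumes "(\<tau>, \<xi>, \<eta>) \<in> region" "\<xi> - a \<le> c * \<tau>"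
  shows "entry_datum c a u0 um (\<tau>, \<xi>, \<eta>) = um (\<tau> - (\<xi> - a) / c, \<eta>)"
proof (cases "\<xi> - a = c * \<tau>")
  case True
  then have "\<tau> = (\<xi> - a) / c" "\<xi> - c * \<tau> = a" using c by (simp_all add: field_simps)
  with True compat[of \<eta>] assms show ?thesis by (simp add: entry_datum_def)
next
  case False
  with assms show ?thesis by (simp add: entry_datum_def)
qed

lemma early_foot:
  assumes "(\<tau>, \<xi>, \<eta>) \<in> region" "c * \<tau> \<le> \<xi> - a"
  shows "(\<xi> - c * \<tau>, \<eta>) \<in> {a..b} \<times> {l..h}"
proof -
  have "0 \<le> c * \<tau>" using assms c by simp
  with assms show ?thesis by auto
qed

lemma late_foot:
  assumes "(\<tau>, \<xi>, \<eta>) \<in> region" "\<xi> - a \<le> c * \<tau>"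
  shows "(\<tau> - (\<xi> - a) / c, \<eta>) \<in> {0..T} \<times> {l..h}"
proof -
  have "0 \<le> (\<xi> - a) / c" "(\<xi> - a) / c \<le> \<tau>"
    using assms c by (auto simp: divide_le_eq mult.commute)
  with assms show ?thesis by auto
qed

lemma entry_datum_bounds:
  assumes "z \<in> region"
  shows "0 \<le> entry_datum c a u0 um z" and "entry_datum c a u0 um z \<le> q"
proof -
  obtain \<tau> \<xi> \<eta> where z: "z = (\<tau>, \<xi>, \<eta>)" by (metis surj_pair)
  have "0 \<le> entry_datum c a u0 um z \<and> entry_datum c a u0 um z \<le> q"
  proof (cases "c * \<tau> \<le> \<xi> - a")
    case True
    then show ?thesis
      using regular_datumD(1,2)[OF u0 early_foot[OF assms[unfolded z] True]] size(1)
      by (simp add: z entry_datum_def)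
  next
    case False
    then show ?thesis
      using regular_datumD(1,2)[OF um late_foot[OF assms[unfolded z]]] size(3)
      by (simp add: z entry_datum_def)
  qed
  then show "0 \<le> entry_datum c a u0 um z" "entry_datum c a u0 um z \<le> q" by auto
qed

text \<open>On either closed side of the plane \<open>\<xi> - a = c \<tau>\<close> the bound comes from one datum. A segment that
  crosses the plane is cut at the crossing point, and \<open>omega\<close> is additive along the segment.\<close>

lemma entry_datum_lipschitz:
  assumes "z \<in> region" "z' \<in> region"
  shows "\<bar>entry_datum c a u0 um z - entry_datum c a u0 um z'\<bar> \<le> q * omega c (z - z')"
proof -
  let ?B = "entry_datum c a u0 um"
  have scaled: "x \<le> q / c * y" if "x \<le> n * y" "c * n \<le> q" "0 \<le> y" for x y n
  proof -
    have "n \<le> q / c" using that(2) c by (simp add: le_divide_eq mult.commute)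
    from mult_right_mono[OF this that(3)] that(1) show ?thesis by simp
  qed
  have early: "\<bar>?B z - ?B z'\<bar> \<le> q * omega c (z - z')"
    if mem: "z \<in> region" "z' \<in> region" and side: "c * fst z \<le> fst (snd z) - a" "c * fst z' \<le> fst (snd z') - a"
    for z z'
  proof -
    obtain \<tau> \<xi> \<eta> \<tau>' \<xi>' \<eta>' where z: "z = (\<tau>, \<xi>, \<eta>)" "z' = (\<tau>', \<xi>', \<eta>')" by (metis surj_pair)
    have "\<bar>?B z - ?B z'\<bar> \<le> n0 * (\<bar>(\<xi> - c * \<tau>) - (\<xi>' - c * \<tau>')\<bar> + \<bar>\<eta> - \<eta>'\<bar>)"
      using regular_datumD(3)[OF u0 early_foot early_foot, of \<tau> \<xi> \<eta> \<tau>' \<xi>' \<eta>'] side mem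
      by (simp add: z entry_datum_def)
    also have "\<dots> \<le> n0 * (c * \<bar>\<tau> - \<tau>'\<bar> + \<bar>\<xi> - \<xi>'\<bar> + \<bar>\<eta> - \<eta>'\<bar>)"
    proof (rule mult_left_mono)
      have "\<bar>(\<xi> - c * \<tau>) - (\<xi>' - c * \<tau>')\<bar> = \<bar>(\<xi> - \<xi>') - c * (\<tau> - \<tau>')\<bar>" by (simp add: algebra_simps)
      also have "\<dots> \<le> \<bar>\<xi> - \<xi>'\<bar> + c * \<bar>\<tau> - \<tau>'\<bar>"
        using abs_triangle_ineq4[of "\<xi> - \<xi>'" "c * (\<tau> - \<tau>')"] c by (simp add: abs_mult)
      finally show "\<bar>(\<xi> - c * \<tau>) - (\<xi>' - c * \<tau>')\<bar> + \<bar>\<eta> - \<eta>'\<bar> \<le> c * \<bar>\<tau> - \<tau>'\<bar> + \<bar>\<xi> - \<xi>'\<bar> + \<bar>\<eta> - \<eta>'\<bar>"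
        by simp
    qed (rule n_nonneg)
    finally have "\<bar>?B z - ?B z'\<bar> \<le> q / c * (c * \<bar>\<tau> - \<tau>'\<bar> + \<bar>\<xi> - \<xi>'\<bar> + \<bar>\<eta> - \<eta>'\<bar>)"
      by (rule scaled) (use size c in auto)
    also have "\<dots> = q * omega c (z - z')"
      unfolding z omega_def using c by (simp add: field_simps)
    finally show ?thesis .
  qed
  have late: "\<bar>?B z - ?B z'\<bar> \<le> q * omega c (z - z')"
    if mem: "z \<in> region" "z' \<in> region" and side: "fst (snd z) - a \<le> c * fst z" "fst (snd z') - a \<le> c * fst z'"
    for z z'
  proof -
    obtain \<tau> \<xi> \<eta> \<tau>' \<xi>' \<eta>' where z: "z = (\<tau>, \<xi>, \<eta>)" "z' = (\<tau>', \<xi>', \<eta>')" by (metis surj_pair)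
    have B: "?B z = um (\<tau> - (\<xi> - a) / c, \<eta>)" "?B z' = um (\<tau>' - (\<xi>' - a) / c, \<eta>')"
      using entry_datum_late mem side unfolding z by auto
    have "\<bar>?B z - ?B z'\<bar> \<le> n1 * (\<bar>(\<tau> - (\<xi> - a) / c) - (\<tau>' - (\<xi>' - a) / c)\<bar> + \<bar>\<eta> - \<eta>'\<bar>)"
      unfolding B using regular_datumD(3)[OF um late_foot late_foot, of \<tau> \<xi> \<eta> \<tau>' \<xi>' \<eta>'] side mem
      by (simp add: z)
    also have "\<dots> \<le> n1 * (\<bar>\<tau> - \<tau>'\<bar> + \<bar>\<xi> - \<xi>'\<bar> / c + \<bar>\<eta> - \<eta>'\<bar>)"
    proof (rule mult_left_mono)
      have "(\<tau> - (\<xi> - a) / c) - (\<tau>' - (\<xi>' - a) / c) = (\<tau> - \<tau>') - (\<xi> - \<xi>') / c"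
        by (simp add: diff_divide_distrib)
      then have "\<bar>(\<tau> - (\<xi> - a) / c) - (\<tau>' - (\<xi>' - a) / c)\<bar> \<le> \<bar>\<tau> - \<tau>'\<bar> + \<bar>\<xi> - \<xi>'\<bar> / c"
        using abs_triangle_ineq4[of "\<tau> - \<tau>'" "(\<xi> - \<xi>') / c"] c by simp
      then show "\<bar>(\<tau> - (\<xi> - a) / c) - (\<tau>' - (\<xi>' - a) / c)\<bar> + \<bar>\<eta> - \<eta>'\<bar>
          \<le> \<bar>\<tau> - \<tau>'\<bar> + \<bar>\<xi> - \<xi>'\<bar> / c + \<bar>\<eta> - \<eta>'\<bar>" by simp
    qed (rule n_nonneg)
    also have "\<dots> = n1 * (\<bar>\<tau> - \<tau>'\<bar> + \<bar>\<xi> - \<xi>'\<bar> / c) + n1 * \<bar>\<eta> - \<eta>'\<bar>"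
      by (simp add: algebra_simps)
    also have "\<dots> \<le> q * (\<bar>\<tau> - \<tau>'\<bar> + \<bar>\<xi> - \<xi>'\<bar> / c) + q / c * \<bar>\<eta> - \<eta>'\<bar>"
      by (intro add_mono mult_right_mono scaled[where n = n1]) (use size c in auto)
    also have "\<dots> = q * omega c (z - z')"
      unfolding z omega_def using c by (simp add: field_simps)
    finally show ?thesis .
  qed
  have mixed: "\<bar>?B z - ?B z'\<bar> \<le> q * omega c (z - z')"
    if mem: "z \<in> region" "z' \<in> region" and side: "c * fst z \<le> fst (snd z) - a" "fst (snd z') - a < c * fst z'"
    for z z'
  proof -
    \<comment> \<open>the point \<open>m\<close> is where the segment from \<open>z\<close> to \<open>z'\<close> meets the plane \<open>?g = 0\<close>\<close>
    let ?g = "\<lambda>z. fst (snd z) - a - c * fst z"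
    define r where "r = ?g z / (?g z - ?g z')"
    have pos: "?g z - ?g z' > 0" and r: "0 \<le> r" "r \<le> 1"
      using side by (auto simp: r_def divide_le_eq)
    define m where "m = (1 - r) *\<^sub>R z + r *\<^sub>R z'"
    have "convex region" by (intro convex_Times convex_real_interval)
    then have m_mem: "m \<in> region" unfolding m_def using r mem by (intro convexD) auto
    have "?g m = ?g z - r * (?g z - ?g z')"
      by (simp add: m_def algebra_simps)
    also have "\<dots> = 0" using pos by (simp add: r_def)
    finally have g: "?g m = 0" .
    have "z - m = r *\<^sub>R (z - z')" "m - z' = (1 - r) *\<^sub>R (z - z')"
      unfolding m_def by (simp_all add: algebra_simps)
    then have om: "omega c (z - m) = r * omega c (z - z')" "omega c (m - z') = (1 - r) * omega c (z - z')"
      using r by (simp_all add: omega_scaleR)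
    have "\<bar>?B z - ?B z'\<bar> \<le> \<bar>?B z - ?B m\<bar> + \<bar>?B m - ?B z'\<bar>" by simp
    also have "\<dots> \<le> q * omega c (z - m) + q * omega c (m - z')"
      using early[OF mem(1) m_mem] late[OF m_mem mem(2)] side g by simp
    also have "\<dots> = q * omega c (z - z')" by (simp add: om algebra_simps)
    finally show ?thesis .
  qed
  consider "c * fst z \<le> fst (snd z) - a" "c * fst z' \<le> fst (snd z') - a"
    | "fst (snd z) - a \<le> c * fst z" "fst (snd z') - a \<le> c * fst z'"
    | "c * fst z \<le> fst (snd z) - a" "fst (snd z') - a < c * fst z'"
    | "c * fst z' \<le> fst (snd z') - a" "fst (snd z) - a < c * fst z" by linarith
  then show ?thesis
  proof cases
    case 1 show ?thesis by (rule early[OF assms 1])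
  next
    case 2 show ?thesis by (rule late[OF assms 2])
  next
    case 3 show ?thesis by (rule mixed[OF assms 3])
  next
    case 4
    have "omega c (z' - z) = omega c (z - z')"
      using omega_scaleR[of c "-1" "z - z'"] by simp
    with mixed[OF assms(2,1) 4] show ?thesis by (simp add: abs_minus_commute)
  qed
qed

lemma entry_datum_strict_deriv:
  assumes "z \<in> {0<..<T} \<times> {a<..<b} \<times> {l<..<h}" "c * fst z \<noteq> fst (snd z) - a"
  shows "\<exists>d. strict_deriv (entry_datum c a u0 um) z k d"
proof (cases "c * fst z < fst (snd z) - a")
  case True
  let ?f = "\<lambda>z. (fst (snd z) - c * fst z, snd (snd z))"
  let ?V = "{z. c * fst z < fst (snd z) - a}"
  have "0 < c * fst z" using c assms(1) by auto
  then have "?f z \<in> {a<..<b} \<times> {l<..<h}" using assms(1) True by auto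
  then obtain d where d: "strict_deriv u0 (?f z) (?f k) d"
    using u0 unfolding regular_datum_def by blast
  have "strict_deriv (\<lambda>z. u0 (?f z)) z k d"
    by (rule strict_deriv_compose_affine[where f = ?f, OF d]) (auto intro!: continuous_intros simp: algebra_simps)
  moreover have "open ?V" by (intro open_Collect_less continuous_intros)
  ultimately have "strict_deriv (entry_datum c a u0 um) z k d"
    by (rule strict_deriv_transform) (use True in \<open>auto simp: entry_datum_def split: prod.splits\<close>)
  then show ?thesis by blast
next
  case False
  with assms(2) have late: "fst (snd z) - a < c * fst z" by simp
  let ?f = "\<lambda>z. (fst z - (fst (snd z) - a) / c, snd (snd z))"
  let ?k = "(fst k - fst (snd k) / c, snd (snd k))"
  let ?V = "{z. fst (snd z) - a < c * fst z}"
  have "0 < (fst (snd z) - a) / c" "(fst (snd z) - a) / c < fst z"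
    using c assms(1) late by (auto simp: divide_less_eq mult.commute)
  then have "?f z \<in> {0<..<T} \<times> {l<..<h}" using assms(1) by auto
  then obtain d where d: "strict_deriv um (?f z) ?k d"
    using um unfolding regular_datum_def by blast
  have "strict_deriv (\<lambda>z. um (?f z)) z k d"
    by (rule strict_deriv_compose_affine[where f = ?f, OF d])
       (use c in \<open>auto intro!: continuous_intros simp: algebra_simps add_divide_distrib diff_divide_distrib\<close>)
  moreover have "open ?V" by (intro open_Collect_less continuous_intros)
  ultimately have "strict_deriv (entry_datum c a u0 um) z k d"
    by (rule strict_deriv_transform) (use late in \<open>auto simp: entry_datum_def split: prod.splits\<close>)
  then show ?thesis by blast
qed

lemma entry_datum_along:
  "entry_datum c a u0 um (z + s *\<^sub>R (1, c, 0)) = entry_datum c a u0 um z"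
proof -
  obtain \<tau> \<xi> \<eta> where z: "z = (\<tau>, \<xi>, \<eta>)" by (metis surj_pair)
  have "(c * (\<tau> + s) \<le> \<xi> + s * c - a) = (c * \<tau> \<le> \<xi> - a)"
    "\<xi> + s * c - c * (\<tau> + s) = \<xi> - c * \<tau>" "\<tau> + s - (\<xi> + s * c - a) / c = \<tau> - (\<xi> - a) / c"
    using c by (simp_all add: field_simps)
  then show ?thesis unfolding z entry_datum_def by (simp only: scaleR_Pair add_Pair real_scaleR_def mult_1_right mult_zero_right add_0_right prod.case)
qed

end

section \<open>Characteristics in the slab\<close>

locale slab_geometry =
  fixes c T a1 b1 a2 b2 :: real
  assumes c: "c > 0" and T: "T > 0" and a1b1: "a1 < b1" and a2b2: "a2 < b2"
begin

definition vel :: "4 \<Rightarrow> real \<times> real \<times> real" where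
  "vel i = (1, if i = 1 then c else if i = 4 then - c else 0,
               if i = 2 then c else if i = 3 then - c else 0)"

text \<open>An exchange or reflection of the space coordinates under which species \<open>i\<close> moves with velocity
  \<open>(c, 0)\<close>, so that all four species are treated like the first. The slab becomes
  \<open>{0..T} \<times> {lo i..hi i} \<times> {tlo i..thi i}\<close>.\<close>

definition chart :: "4 \<Rightarrow> real \<times> real \<times> real \<Rightarrow> real \<times> real \<times> real" where
  "chart i z = (case z of (t, x, y) \<Rightarrow>
     if i = 1 then (t, x, y) else if i = 2 then (t, y, x)
     else if i = 3 then (t, - y, x) else (t, - x, y))"

definition lo :: "4 \<Rightarrow> real" where
  "lo i = (if i = 1 then a1 else if i = 2 then a2 else if i = 3 then - b2 else - b1)"
definition hi :: "4 \<Rightarrow> real" where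
  "hi i = (if i = 1 then b1 else if i = 2 then b2 else if i = 3 then - a2 else - a1)"
definition tlo :: "4 \<Rightarrow> real" where
  "tlo i = (if i = 1 \<or> i = 4 then a2 else a1)"
definition thi :: "4 \<Rightarrow> real" where
  "thi i = (if i = 1 \<or> i = 4 then b2 else b1)"

abbreviation "closed_slab \<equiv> slab T a1 b1 a2 b2"
abbreviation "open_slab \<equiv> slab_interior T a1 b1 a2 b2"

lemmas geo_defs = vel_def chart_def lo_def hi_def tlo_def thi_def

lemma mem_slab_chart:
  "z \<in> closed_slab \<longleftrightarrow> chart i z \<in> {0..T} \<times> {lo i..hi i} \<times> {tlo i..thi i}"
  "z \<in> open_slab \<longleftrightarrow> chart i z \<in> {0<..<T} \<times> {lo i<..<hi i} \<times> {tlo i<..<thi i}"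
  using exhaust_4[of i] by (auto simp: geo_defs slab_def slab_interior_def split: prod.splits)

lemma lo_less: "lo i < hi i" "tlo i < thi i"
  using exhaust_4[of i] a1b1 a2b2 by (auto simp: geo_defs)

lemma chart_add_scaleR: "chart i (z + s *\<^sub>R h) = chart i z + s *\<^sub>R chart i h"
  using exhaust_4[of i] by (auto simp: chart_def split: prod.splits)

lemma chart_diff: "chart i (z - h) = chart i z - chart i h"
  using chart_add_scaleR[of i z "-1" h] by simp

lemma chart_vel: "chart i (vel i) = (1, c, 0)"
  using exhaust_4[of i] by (auto simp: geo_defs)

lemma fst_chart: "fst (chart i z) = fst z"
  using exhaust_4[of i] by (auto simp: chart_def split: prod.splits)

lemma omega_chart: "omega c (chart i z) = omega c z"
  using exhaust_4[of i] by (auto simp: chart_def omega_def add.commute split: prod.splits)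

lemma isCont_chart: "isCont (chart i) z"
proof -
  have "chart i = (\<lambda>z. if i = 1 then z else if i = 2 then (fst z, snd (snd z), fst (snd z))
      else if i = 3 then (fst z, - snd (snd z), fst (snd z)) else (fst z, - fst (snd z), snd (snd z)))"
    by (auto simp: chart_def fun_eq_iff)
  then show ?thesis
    using exhaust_4[of i] by (elim disjE) (auto intro!: continuous_intros)
qed

lemma omega_vel: "omega c (vel i) = 2"
  using exhaust_4[of i] c by (auto simp: vel_def omega_def)

text \<open>The distance to the face through which species \<open>i\<close> enters.\<close>

definition lead :: "4 \<Rightarrow> real \<times> real \<times> real \<Rightarrow> real" where
  "lead i z = fst (snd (chart i z)) - lo i"

lemma lead_add_scaleR: "lead i (z + s *\<^sub>R h) = lead i z + s * fst (snd (chart i h))"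
  by (simp add: lead_def chart_add_scaleR)

lemma lead_lipschitz: "\<bar>lead i z / c - lead i z' / c\<bar> \<le> omega c (z - z')"
proof -
  have "\<bar>lead i z / c - lead i z' / c\<bar> = \<bar>fst (snd (chart i (z - z')))\<bar> / c"
    using c by (simp add: lead_def chart_diff diff_divide_distrib[symmetric])
  also have "\<dots> \<le> omega c (chart i (z - z'))"
    unfolding omega_def using c by (simp add: add_divide_distrib)
  finally show ?thesis by (simp add: omega_chart)
qed

lemma fst_lipschitz: "\<bar>fst z - fst z'\<bar> \<le> omega c (z - z')"
  unfolding omega_def using c by simp

text \<open>The time that species \<open>i\<close> has spent in the slab when it arrives at \<open>z\<close>.\<close>

definition len :: "4 \<Rightarrow> real \<times> real \<times> real \<Rightarrow> real" where
  "len i z = min (fst z) (lead i z / c)"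

lemma len_lipschitz: "\<bar>len i z - len i z'\<bar> \<le> omega c (z - z')"
  using lead_lipschitz[of i z z'] fst_lipschitz[of z z'] unfolding len_def by linarith

lemma lead_nonneg: "z \<in> closed_slab \<Longrightarrow> 0 \<le> lead i z"
  unfolding mem_slab_chart(1)[of _ i] lead_def by auto

lemma lead_pos: "z \<in> open_slab \<Longrightarrow> 0 < lead i z"
  unfolding mem_slab_chart(2)[of _ i] lead_def by auto

lemma len_bounds:
  assumes "z \<in> closed_slab" shows "0 \<le> len i z" "len i z \<le> T"
proof -
  have "0 \<le> fst z" "fst z \<le> T" using assms by (auto simp: slab_def)
  with lead_nonneg[OF assms, of i] c show "0 \<le> len i z" "len i z \<le> T" by (auto simp: len_def)
qed

lemma len_pos: "z \<in> open_slab \<Longrightarrow> 0 < len i z"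
  using lead_pos[of z i] c by (auto simp: len_def slab_interior_def)

lemma open_slab_subset: "open_slab \<subseteq> closed_slab"
  by (auto simp: slab_def slab_interior_def)

lemma open_open_slab: "open open_slab"
  unfolding slab_interior_def by (intro open_Times) auto

lemma closure_open_slab: "closure open_slab = closed_slab"
  unfolding slab_def slab_interior_def using T a1b1 a2b2 by (simp add: closure_Times)

lemma backward_mem_open_slab:
  assumes "z \<in> open_slab" "0 \<le> s" "s < len i z"
  shows "z - s *\<^sub>R vel i \<in> open_slab"
proof -
  have ch: "chart i (z - s *\<^sub>R vel i) = chart i z - s *\<^sub>R (1, c, 0)"
    using chart_add_scaleR[of i z "- s" "vel i"] by (simp add: chart_vel)
  have "s < fst z" "s * c < lead i z" using assms(3) c by (auto simp: len_def less_divide_eq)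
  moreover have "0 \<le> s * c" using assms(2) c by simp
  ultimately show ?thesis
    using assms unfolding mem_slab_chart(2)[of _ i] ch lead_def
    by (auto simp: mem_Times_iff fst_chart)
qed

lemma backward_mem_closed_slab:
  assumes "z \<in> closed_slab" "0 \<le> s" "s \<le> len i z"
  shows "z - s *\<^sub>R vel i \<in> closed_slab"
proof -
  have ch: "chart i (z - s *\<^sub>R vel i) = chart i z - s *\<^sub>R (1, c, 0)"
    using chart_add_scaleR[of i z "- s" "vel i"] by (simp add: chart_vel)
  have "s \<le> fst z" "s * c \<le> lead i z" using assms(3) c by (auto simp: len_def le_divide_eq)
  moreover have "0 \<le> s * c" using assms(2) c by simp
  ultimately show ?thesis
    using assms unfolding mem_slab_chart(1)[of _ i] ch lead_def
    by (auto simp: mem_Times_iff fst_chart)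
qed

text \<open>The open slab without the four characteristic planes (see \<open>regular_part_eq\<close>).\<close>

definition regular_part :: "(real \<times> real \<times> real) set" where
  "regular_part = {z \<in> open_slab. \<forall>j. lead j z \<noteq> c * fst z}"

text \<open>The rate at which \<open>lead j - c t\<close> changes on the way back along a characteristic of species \<open>i\<close>. It
  vanishes for \<open>j = i\<close> only: a characteristic is parallel to its own plane and transversal to the others.\<close>

definition drift :: "4 \<Rightarrow> 4 \<Rightarrow> real" where
  "drift i j = c - fst (snd (chart j (vel i)))"

lemma drift_nonzero: "i \<noteq> j \<Longrightarrow> drift i j \<noteq> 0"
  using exhaust_4[of i] exhaust_4[of j] c by (auto simp: drift_def geo_defs)

lemma drift_self: "drift i i = 0"
  by (simp add: drift_def chart_vel)

lemma offset_backward: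
  "lead j (z - s *\<^sub>R vel i) - c * fst (z - s *\<^sub>R vel i) = (lead j z - c * fst z) + s * drift i j"
  using lead_add_scaleR[of j z "- s" "vel i"]
  by (simp add: drift_def algebra_simps) (simp add: vel_def)

text \<open>The path runs from \<open>z\<close> back to its entry point, which lies on the boundary (\<open>\<theta> = 1\<close>). It stays off the
  plane of species \<open>i\<close> because \<open>z\<close> does, and meets every other plane at most once.\<close>

lemma finite_irregular_on_path:
  assumes z: "z \<in> regular_part"
  shows "finite {\<theta> \<in> {0..1}. z - (\<theta> * len i z) *\<^sub>R vel i \<notin> regular_part}"
proof -
  let ?cross = "\<lambda>j. - (lead j z - c * fst z) / (len i z * drift i j)"
  have zo: "z \<in> open_slab" using z by (simp add: regular_part_def)
  have pos: "len i z > 0" by (rule len_pos[OF zo])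
  have "\<theta> \<in> {1} \<union> range ?cross"
    if \<theta>: "\<theta> \<in> {0..1}" and bad: "z - (\<theta> * len i z) *\<^sub>R vel i \<notin> regular_part" for \<theta>
  proof (rule ccontr)
    assume not: "\<theta> \<notin> {1} \<union> range ?cross"
    have "z - (\<theta> * len i z) *\<^sub>R vel i \<in> open_slab"
      by (rule backward_mem_open_slab[OF zo]) (use \<theta> not pos in auto)
    with bad obtain j where j: "lead j z - c * fst z + (\<theta> * len i z) * drift i j = 0"
      unfolding offset_backward[symmetric] regular_part_def by auto
    show False
    proof (cases "i = j")
      case True
      with j z show False by (simp add: drift_self regular_part_def)
    next
      case False
      then have "len i z * drift i j \<noteq> 0" using drift_nonzero pos by simp
      with j have "\<theta> = ?cross j" by (simp add: eq_divide_eq algebra_simps)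
      with not show False by blast
    qed
  qed
  then have "{\<theta> \<in> {0..1}. z - (\<theta> * len i z) *\<^sub>R vel i \<notin> regular_part} \<subseteq> {1} \<union> range ?cross" by blast
  then show ?thesis by (rule finite_subset) simp
qed

text \<open>Composition with this projection extends fields on the slab to the whole space with the same bounds, so
  that estimates along paths need not ask whether a point belongs to the slab.\<close>

definition retract :: "real \<times> real \<times> real \<Rightarrow> real \<times> real \<times> real" where
  "retract = (\<lambda>(t, x, y). (max 0 (min T t), max a1 (min b1 x), max a2 (min b2 y)))"

lemma retract_mem: "retract z \<in> closed_slab"
  using T a1b1 a2b2 by (auto simp: retract_def slab_def split: prod.splits)

lemma retract_id: "z \<in> closed_slab \<Longrightarrow> retract z = z"
  by (auto simp: retract_def slab_def split: prod.splits)

lemma omega_retract: "omega c (retract z - retract z') \<le> omega c (z - z')"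
proof -
  have "\<bar>max l (min h u) - max l (min h v)\<bar> \<le> \<bar>u - v\<bar>" for l h u v :: real by linarith
  then show ?thesis
    unfolding omega_def retract_def using c
    by (auto intro!: add_mono divide_right_mono split: prod.splits)
qed

text \<open>The integral of \<open>F\<close> along the characteristic from its entry point to \<open>z\<close>, rescaled to \<open>{0..1}\<close> so
  that the domain of integration does not depend on \<open>z\<close>.\<close>

definition transport :: "4 \<Rightarrow> (real \<times> real \<times> real \<Rightarrow> real) \<Rightarrow> real \<times> real \<times> real \<Rightarrow> real" where
  "transport i F z = len i z * integral {0..1} (\<lambda>\<theta>. F (z - (\<theta> * len i z) *\<^sub>R vel i))"

lemma path_integrable:
  assumes "\<And>x x'. \<bar>F x - F x'\<bar> \<le> L * omega c (x - x')"
  shows "continuous_on {0..1} (\<lambda>\<theta>. F (z - (\<theta> * l) *\<^sub>R v))"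
    and "(\<lambda>\<theta>. F (z - (\<theta> * l) *\<^sub>R v)) integrable_on {0..1}"
proof -
  have "continuous_on UNIV F"
    using omega_lipschitz_isCont[OF assms] by (simp add: continuous_at_imp_continuous_on)
  then show *: "continuous_on {0..1} (\<lambda>\<theta>. F (z - (\<theta> * l) *\<^sub>R v))"
    by (rule continuous_on_compose2) (auto intro!: continuous_intros)
  show "(\<lambda>\<theta>. F (z - (\<theta> * l) *\<^sub>R v)) integrable_on {0..1}"
    by (rule integrable_continuous_real[OF *])
qed

text \<open>The factor 3 is made of the displacement of \<open>z\<close> and of the change of the length, which moves the point
  along the velocity of norm 2.\<close>

lemma path_diff_omega:
  assumes "\<bar>\<theta>\<bar> \<le> 1" "\<bar>l - l'\<bar> \<le> omega c (z - z')"
  shows "omega c ((z - (\<theta> * l) *\<^sub>R vel i) - (z' - (\<theta> * l') *\<^sub>R vel i)) \<le> 3 * omega c (z - z')"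
proof -
  have "(z - (\<theta> * l) *\<^sub>R vel i) - (z' - (\<theta> * l') *\<^sub>R vel i) = (z - z') - (\<theta> * (l - l')) *\<^sub>R vel i"
    by (simp add: algebra_simps)
  then have "omega c ((z - (\<theta> * l) *\<^sub>R vel i) - (z' - (\<theta> * l') *\<^sub>R vel i))
      \<le> omega c (z - z') + \<bar>\<theta> * (l - l')\<bar> * 2"
    using omega_diff[OF c, of "z - z'" "(\<theta> * (l - l')) *\<^sub>R vel i"] by (simp only: omega_scaleR omega_vel)
  moreover have "\<bar>\<theta> * (l - l')\<bar> \<le> 1 * omega c (z - z')"
    unfolding abs_mult using assms by (intro mult_mono) auto
  ultimately show ?thesis by simp
qed

lemma path_integral_lipschitz:
  assumes lip: "\<And>x x'. \<bar>F x - F x'\<bar> \<le> L * omega c (x - x')" and L: "0 \<le> L"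
    and l: "\<bar>l - l'\<bar> \<le> omega c (z - z')"
  shows "\<bar>integral {0..1} (\<lambda>\<theta>. F (z - (\<theta> * l) *\<^sub>R vel i)) - integral {0..1} (\<lambda>\<theta>. F (z' - (\<theta> * l') *\<^sub>R vel i))\<bar>
     \<le> 3 * L * omega c (z - z')"
proof -
  note ig = path_integrable(2)[OF lip]
  have "norm (integral {0..1} (\<lambda>\<theta>. F (z - (\<theta> * l) *\<^sub>R vel i) - F (z' - (\<theta> * l') *\<^sub>R vel i)))
      \<le> integral {0..1::real} (\<lambda>_. 3 * L * omega c (z - z'))"
  proof (rule integral_norm_bound_integral)
    fix \<theta> :: real assume "\<theta> \<in> {0..1}"
    then have "L * omega c ((z - (\<theta> * l) *\<^sub>R vel i) - (z' - (\<theta> * l') *\<^sub>R vel i)) \<le> L * (3 * omega c (z - z'))"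
      by (intro mult_left_mono[OF _ L] path_diff_omega l) auto
    with lip show "norm (F (z - (\<theta> * l) *\<^sub>R vel i) - F (z' - (\<theta> * l') *\<^sub>R vel i)) \<le> 3 * L * omega c (z - z')"
      by (simp add: mult.assoc mult.left_commute) (meson order_trans)
  qed (intro integrable_diff ig integrable_const_ivl)+
  then show ?thesis by (simp add: integral_diff[OF ig ig])
qed

lemma path_integral_bound:
  assumes lip: "\<And>x x'. \<bar>F x - F x'\<bar> \<le> L * omega c (x - x')" and bnd: "\<And>x. \<bar>F x\<bar> \<le> A"
  shows "\<bar>integral {0..1} (\<lambda>\<theta>. F (z - (\<theta> * l) *\<^sub>R v))\<bar> \<le> A"
proof -
  have "norm (integral {0..1} (\<lambda>\<theta>. F (z - (\<theta> * l) *\<^sub>R v))) \<le> integral {0..1::real} (\<lambda>_. A)"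
    by (rule integral_norm_bound_integral)
       (use bnd path_integrable(2)[OF lip] in \<open>auto intro: integrable_const_ivl\<close>)
  then show ?thesis by simp
qed

lemma transport_bound:
  assumes "\<And>x x'. \<bar>F x - F x'\<bar> \<le> L * omega c (x - x')" "\<And>x. \<bar>F x\<bar> \<le> A" "z \<in> closed_slab"
  shows "\<bar>transport i F z\<bar> \<le> T * A"
  unfolding transport_def abs_mult
  using len_bounds[OF assms(3), of i] T by (intro mult_mono path_integral_bound[OF assms(1,2)]) auto

lemma transport_lipschitz:
  assumes lip: "\<And>x x'. \<bar>F x - F x'\<bar> \<le> L * omega c (x - x')" and L: "0 \<le> L"
    and bnd: "\<And>x. \<bar>F x\<bar> \<le> A" and z: "z \<in> closed_slab" "z' \<in> closed_slab"
  shows "\<bar>transport i F z - transport i F z'\<bar> \<le> (A + 3 * T * L) * omega c (z - z')"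
proof -
  let ?I = "\<lambda>z. integral {0..1} (\<lambda>\<theta>. F (z - (\<theta> * len i z) *\<^sub>R vel i))"
  have "transport i F z - transport i F z' = (len i z - len i z') * ?I z + len i z' * (?I z - ?I z')"
    by (simp add: transport_def algebra_simps)
  then have "\<bar>transport i F z - transport i F z'\<bar>
      \<le> \<bar>(len i z - len i z') * ?I z\<bar> + \<bar>len i z' * (?I z - ?I z')\<bar>"
    by (metis abs_triangle_ineq)
  also have "\<dots> \<le> omega c (z - z') * A + T * (3 * L * omega c (z - z'))"
    unfolding abs_mult using len_bounds[OF z(2), of i] T omega_nonneg[OF c]
    by (intro add_mono mult_mono path_integral_bound[OF lip bnd] path_integral_lipschitz[OF lip L]
        len_lipschitz) auto
  finally show ?thesis by (simp add: algebra_simps)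
qed

lemma transport_diff:
  assumes "\<And>x x'. \<bar>F x - F x'\<bar> \<le> L * omega c (x - x')" "\<And>x x'. \<bar>G x - G x'\<bar> \<le> L' * omega c (x - x')"
  shows "transport i F z - transport i G z = transport i (\<lambda>x. F x - G x) z"
  unfolding transport_def
  by (simp add: integral_diff[OF path_integrable(2)[OF assms(1)] path_integrable(2)[OF assms(2)]]
      right_diff_distrib)

text \<open>Off its own plane \<open>len i\<close> coincides locally with one of its two affine branches \<open>l\<close>. Along the affine
  family of paths \<open>x \<mapsto> x - (\<theta> l x) vel i\<close> the integrand has strict derivatives for all but finitely many
  \<open>\<theta>\<close>.\<close>

lemma transport_strict_deriv:
  assumes lip: "\<And>x x'. \<bar>F x - F x'\<bar> \<le> L * omega c (x - x')" and L: "0 \<le> L"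
    and sd: "\<And>x k. x \<in> regular_part \<Longrightarrow> \<exists>d. strict_deriv F x k d"
    and z: "z \<in> regular_part"
  shows "\<exists>d. strict_deriv (transport i F) z h d"
proof -
  have "\<exists>l l' V. open V \<and> z \<in> V \<and> (\<forall>x\<in>V. len i x = l x) \<and> (\<forall>x s. l (x + s *\<^sub>R h) = l x + s * l')
      \<and> (\<forall>x x'. \<bar>l x - l x'\<bar> \<le> omega c (x - x'))"
  proof (cases "fst z < lead i z / c")
    case True
    show ?thesis
    proof (intro exI conjI)
      show "open {z. fst z < lead i z / c}" unfolding lead_def divide_inverse
        by (intro open_Collect_less continuous_intros continuous_at_imp_continuous_on ballI isCont_chart)
      show "\<forall>x s. fst (x + s *\<^sub>R h) = fst x + s * fst h" by simp
    qed (use True fst_lipschitz in \<open>auto simp: len_def\<close>)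
  next
    case False
    have "lead i z \<noteq> c * fst z" using z by (simp add: regular_part_def)
    with False c have lt: "lead i z / c < fst z" by (simp add: field_simps)
    show ?thesis
    proof (intro exI conjI)
      show "open {z. lead i z / c < fst z}" unfolding lead_def divide_inverse
        by (intro open_Collect_less continuous_intros continuous_at_imp_continuous_on ballI isCont_chart)
      show "\<forall>x s. lead i (x + s *\<^sub>R h) / c = lead i x / c + s * (fst (snd (chart i h)) / c)"
        by (simp add: lead_add_scaleR add_divide_distrib)
    qed (use lt lead_lipschitz in \<open>auto simp: len_def\<close>)
  qed
  then obtain l l' V where V: "open V" "z \<in> V" and lV: "\<And>x. x \<in> V \<Longrightarrow> len i x = l x"
    and laff: "\<And>x s. l (x + s *\<^sub>R h) = l x + s * l'"
    and llip: "\<And>x x'. \<bar>l x - l x'\<bar> \<le> omega c (x - x')" by blast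
  let ?\<phi> = "\<lambda>\<theta> x. F (x - (\<theta> * l x) *\<^sub>R vel i)"
  have isCont_l: "isCont l x" for x
    using omega_lipschitz_isCont[of l 1 c] llip by simp
  have "\<exists>d. strict_deriv (\<lambda>x. integral {0..1} (\<lambda>\<theta>. ?\<phi> \<theta> x)) z h d"
  proof (rule strict_deriv_integral)
    show "finite {\<theta> \<in> {0..1}. z - (\<theta> * l z) *\<^sub>R vel i \<notin> regular_part}"
      using finite_irregular_on_path[OF z, of i] lV[OF V(2)] by simp
    show "\<exists>d. strict_deriv (?\<phi> \<theta>) z h d"
      if \<theta>: "\<theta> \<in> {0..1} - {\<theta> \<in> {0..1}. z - (\<theta> * l z) *\<^sub>R vel i \<notin> regular_part}" for \<theta>
    proof -
      from \<theta> have "z - (\<theta> * l z) *\<^sub>R vel i \<in> regular_part" by blast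
      then obtain d where d: "strict_deriv F (z - (\<theta> * l z) *\<^sub>R vel i) (h - (\<theta> * l') *\<^sub>R vel i) d"
        using sd by blast
      have "strict_deriv (?\<phi> \<theta>) z h d"
        by (rule strict_deriv_compose_affine[where f = "\<lambda>x. x - (\<theta> * l x) *\<^sub>R vel i", OF d])
           (auto intro!: continuous_intros isCont_l simp: laff algebra_simps)
      then show ?thesis by blast
    qed
    show "\<bar>?\<phi> \<theta> (x + s *\<^sub>R h) - ?\<phi> \<theta> x\<bar> \<le> (L * (3 * omega c h)) * \<bar>s\<bar>" if "\<theta> \<in> {0..1}" for \<theta> x s
    proof -
      have "\<bar>?\<phi> \<theta> (x + s *\<^sub>R h) - ?\<phi> \<theta> x\<bar> \<le> L * (3 * omega c ((x + s *\<^sub>R h) - x))"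
        by (rule order_trans[OF lip mult_left_mono[OF path_diff_omega L]]) (use that in simp, rule llip)
      then show ?thesis by (simp add: omega_scaleR mult_ac)
    qed
    show "continuous_on {0..1} (\<lambda>\<theta>. ?\<phi> \<theta> x)" for x
      by (rule path_integrable(1)[OF lip])
  qed
  then obtain d where d: "strict_deriv (\<lambda>x. integral {0..1} (\<lambda>\<theta>. ?\<phi> \<theta> x)) z h d" by blast
  have "isCont (\<lambda>x. integral {0..1} (\<lambda>\<theta>. ?\<phi> \<theta> x)) z"
    by (rule omega_lipschitz_isCont[OF path_integral_lipschitz[OF lip L llip]])
  with strict_deriv_mult[OF strict_deriv_affine[of l h l' z, OF laff] d isCont_l]
  have "strict_deriv (\<lambda>x. l x * integral {0..1} (\<lambda>\<theta>. ?\<phi> \<theta> x)) z h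
      (l z * d + l' * integral {0..1} (\<lambda>\<theta>. ?\<phi> \<theta> z))" by blast
  then have "strict_deriv (transport i F) z h (l z * d + l' * integral {0..1} (\<lambda>\<theta>. ?\<phi> \<theta> z))"
    by (rule strict_deriv_transform[OF _ V]) (simp add: transport_def lV)
  then show ?thesis by blast
qed

end

section \<open>Picard iteration\<close>

lemma geometric_steps_converge:
  fixes x :: "nat \<Rightarrow> real"
  assumes r: "0 \<le> r" "r < 1" and step: "\<And>k. \<bar>x (Suc k) - x k\<bar> \<le> C * r ^ k"
  shows "convergent x" and "\<bar>x k - lim x\<bar> \<le> C / (1 - r) * r ^ k"
proof -
  have C: "0 \<le> C" using step[of 0] by simp
  have far: "\<bar>x (k + m) - x k\<bar> \<le> C / (1 - r) * (r ^ k - r ^ (k + m))" for k m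
  proof (induction m)
    case (Suc m)
    have "C / (1 - r) * (r ^ (k + m) - r ^ (k + Suc m)) = C / (1 - r) * ((1 - r) * r ^ (k + m))"
      by (simp add: algebra_simps)
    then have "C / (1 - r) * (r ^ (k + m) - r ^ (k + Suc m)) = C * r ^ (k + m)" using r by simp
    moreover have "C / (1 - r) * (r ^ k - r ^ (k + Suc m)) = C / (1 - r) * (r ^ k - r ^ (k + m))
        + C / (1 - r) * (r ^ (k + m) - r ^ (k + Suc m))"
      by (simp add: right_diff_distrib)
    moreover have "\<bar>x (k + Suc m) - x k\<bar> \<le> \<bar>x (Suc (k + m)) - x (k + m)\<bar> + \<bar>x (k + m) - x k\<bar>"
      by simp
    ultimately show ?case using add_mono[OF step[of "k + m"] Suc.IH] by (simp only: add.commute)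
  qed simp
  have near: "\<bar>x (k + m) - x k\<bar> \<le> C / (1 - r) * r ^ k" for k m
  proof -
    have "C / (1 - r) * (r ^ k - r ^ (k + m)) \<le> C / (1 - r) * r ^ k"
      using C r by (intro mult_left_mono) auto
    with far[of k m] show ?thesis by linarith
  qed
  have "Cauchy x"
  proof (rule metric_CauchyI)
    fix e :: real assume "e > 0"
    have "(\<lambda>k. C / (1 - r) * r ^ k) \<longlonglongrightarrow> C / (1 - r) * 0"
      by (intro tendsto_intros LIMSEQ_power_zero) (use r in auto)
    then have "\<forall>\<^sub>F k in sequentially. C / (1 - r) * r ^ k < e / 2"
      by (rule order_tendstoD) (use \<open>e > 0\<close> in simp)
    then obtain M where M: "C / (1 - r) * r ^ M < e / 2"
      by (auto simp: eventually_sequentially)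
    have "dist (x m) (x n) < e" if "m \<ge> M" "n \<ge> M" for m n
    proof -
      have "\<bar>x m - x M\<bar> < e / 2" "\<bar>x n - x M\<bar> < e / 2"
        using le_less_trans[OF near[of M "m - M"] M] le_less_trans[OF near[of M "n - M"] M] that by simp_all
      then show ?thesis
        using abs_triangle_ineq4[of "x m - x M" "x n - x M"] unfolding dist_real_def by simp
    qed
    then show "\<exists>M. \<forall>m\<ge>M. \<forall>n\<ge>M. dist (x m) (x n) < e" by blast
  qed
  then show conv: "convergent x" by (simp add: Cauchy_convergent_iff)
  have "(\<lambda>m. \<bar>x k - x (m + k)\<bar>) \<longlonglongrightarrow> \<bar>x k - lim x\<bar>"
    by (intro tendsto_intros LIMSEQ_ignore_initial_segment)
       (use conv in \<open>simp add: convergent_LIMSEQ_iff\<close>)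
  moreover have "\<bar>x k - x (m + k)\<bar> \<le> C / (1 - r) * r ^ k" for m
    using near[of k m] by (simp add: abs_minus_commute add.commute)
  ultimately show "\<bar>x k - lim x\<bar> \<le> C / (1 - r) * r ^ k" by (meson LIMSEQ_le_const2)
qed

text \<open>The right-hand side of the equation of species \<open>i\<close>.\<close>

definition gain :: "real \<Rightarrow> real \<Rightarrow> 4 \<Rightarrow> real ^ 4 \<Rightarrow> real" where
  "gain c S i N = (if i = 1 \<or> i = 4 then collision c S N else - collision c S N)"

lemma product_bound:
  fixes u v :: real
  assumes "\<bar>u\<bar> \<le> K" "\<bar>v\<bar> \<le> K"
  shows "\<bar>u * v\<bar> \<le> K * K"
  unfolding abs_mult using assms by (intro mult_mono) auto

lemma gain_bound:
  assumes "c > 0" "S > 0" "\<And>j. \<bar>N $ j\<bar> \<le> K"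
  shows "\<bar>gain c S i N\<bar> \<le> 4 * c * S * K * K"
proof -
  have "\<bar>N $ 2 * N $ 3 - N $ 1 * N $ 4\<bar> \<le> 2 * K * K"
    using product_bound[OF assms(3)[of 2] assms(3)[of 3]] product_bound[OF assms(3)[of 1] assms(3)[of 4]]
    by linarith
  then have "2 * c * S * \<bar>N $ 2 * N $ 3 - N $ 1 * N $ 4\<bar> \<le> 2 * c * S * (2 * K * K)"
    using assms by (intro mult_left_mono) auto
  moreover have "\<bar>gain c S i N\<bar> = 2 * c * S * \<bar>N $ 2 * N $ 3 - N $ 1 * N $ 4\<bar>"
    using assms by (simp add: gain_def collision_def abs_mult)
  ultimately show ?thesis by (simp add: mult_ac)
qed

lemma product_diff:
  fixes u v u' v' :: real
  assumes "\<bar>u\<bar> \<le> K" "\<bar>v'\<bar> \<le> K" "\<bar>u - u'\<bar> \<le> d" "\<bar>v - v'\<bar> \<le> d"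
  shows "\<bar>u * v - u' * v'\<bar> \<le> 2 * K * d"
proof -
  have "u * v - u' * v' = u * (v - v') + (u - u') * v'" by (simp add: algebra_simps)
  moreover have "\<bar>u * (v - v')\<bar> \<le> K * d" "\<bar>(u - u') * v'\<bar> \<le> d * K"
    unfolding abs_mult using assms by (auto intro!: mult_mono)
  ultimately show ?thesis by (simp add: mult_ac)
qed

lemma gain_diff:
  assumes "c > 0" "S > 0" "\<And>j. \<bar>N $ j\<bar> \<le> K" "\<And>j. \<bar>M $ j\<bar> \<le> K" "\<And>j. \<bar>N $ j - M $ j\<bar> \<le> d"
  shows "\<bar>gain c S i N - gain c S i M\<bar> \<le> 8 * c * S * K * d"
proof -
  have "\<bar>(N $ 2 * N $ 3 - M $ 2 * M $ 3) - (N $ 1 * N $ 4 - M $ 1 * M $ 4)\<bar> \<le> 4 * K * d"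
  proof -
    have P: "\<bar>N $ j * N $ k - M $ j * M $ k\<bar> \<le> 2 * K * d" for j k
      by (rule product_diff) (rule assms)+
    show ?thesis using order_trans[OF abs_triangle_ineq4 add_mono[OF P[of 2 3] P[of 1 4]]] by simp
  qed
  then have "2 * c * S * \<bar>(N $ 2 * N $ 3 - M $ 2 * M $ 3) - (N $ 1 * N $ 4 - M $ 1 * M $ 4)\<bar>
      \<le> 2 * c * S * (4 * K * d)"
    using assms by (intro mult_left_mono) auto
  moreover have "\<bar>gain c S i N - gain c S i M\<bar>
      = \<bar>2 * c * S * ((N $ 2 * N $ 3 - M $ 2 * M $ 3) - (N $ 1 * N $ 4 - M $ 1 * M $ 4))\<bar>"
    unfolding gain_def collision_def by (cases "i = 1 \<or> i = 4") (simp_all add: algebra_simps)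
  ultimately show ?thesis using assms(1,2) by (simp add: abs_mult mult_ac)
qed

text \<open>Differences of differences control the Lipschitz seminorm of \<open>N \<mapsto> Q(N)\<close> applied to two fields: the
  primed letters are the values at a second point at distance \<open>w\<close>.\<close>

lemma product_second_diff:
  fixes u v m n u' v' m' n' :: real
  assumes "\<bar>v\<bar> \<le> K" "\<bar>v - v'\<bar> \<le> K * w" "\<bar>m\<bar> \<le> K" "\<bar>m - m'\<bar> \<le> K * w"
    and "\<bar>u' - m'\<bar> \<le> d" "\<bar>v' - n'\<bar> \<le> d"
    and "\<bar>(u - m) - (u' - m')\<bar> \<le> e * w" "\<bar>(v - n) - (v' - n')\<bar> \<le> e * w"
  shows "\<bar>(u * v - m * n) - (u' * v' - m' * n')\<bar> \<le> 2 * K * (e + d) * w"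
proof -
  have "(u * v - m * n) - (u' * v' - m' * n')
      = ((u - m) - (u' - m')) * v + (u' - m') * (v - v') + m * ((v - n) - (v' - n')) + (m - m') * (v' - n')"
    by (simp add: algebra_simps)
  moreover have "\<bar>((u - m) - (u' - m')) * v\<bar> \<le> (e * w) * K" "\<bar>(u' - m') * (v - v')\<bar> \<le> d * (K * w)"
    "\<bar>m * ((v - n) - (v' - n'))\<bar> \<le> K * (e * w)" "\<bar>(m - m') * (v' - n')\<bar> \<le> (K * w) * d"
    unfolding abs_mult using assms by (auto intro!: mult_mono)
  ultimately have "\<bar>(u * v - m * n) - (u' * v' - m' * n')\<bar>
      \<le> (e * w) * K + d * (K * w) + K * (e * w) + (K * w) * d" by linarith
  then show ?thesis by (simp add: algebra_simps)
qed

lemma gain_second_diff: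
  assumes "c > 0" "S > 0" "\<And>j. \<bar>N $ j\<bar> \<le> K" "\<And>j. \<bar>M $ j\<bar> \<le> K"
    and "\<And>j. \<bar>N $ j - N' $ j\<bar> \<le> K * w" "\<And>j. \<bar>M $ j - M' $ j\<bar> \<le> K * w"
    and "\<And>j. \<bar>N' $ j - M' $ j\<bar> \<le> d"
    and "\<And>j. \<bar>(N $ j - M $ j) - (N' $ j - M' $ j)\<bar> \<le> e * w"
  shows "\<bar>(gain c S i N - gain c S i M) - (gain c S i N' - gain c S i M')\<bar> \<le> 8 * c * S * K * (e + d) * w"
proof -
  let ?P = "\<lambda>j k. (N $ j * N $ k - M $ j * M $ k) - (N' $ j * N' $ k - M' $ j * M' $ k)"
  have P: "\<bar>?P j k\<bar> \<le> 2 * K * (e + d) * w" for j k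
    by (rule product_second_diff) (rule assms)+
  have "\<bar>?P 2 3 - ?P 1 4\<bar> \<le> 4 * K * (e + d) * w"
    using order_trans[OF abs_triangle_ineq4 add_mono[OF P[of 2 3] P[of 1 4]]]
    by (simp add: mult_ac)
  then have "2 * c * S * \<bar>?P 2 3 - ?P 1 4\<bar> \<le> 2 * c * S * (4 * K * (e + d) * w)"
    using assms by (intro mult_left_mono) auto
  moreover have "\<bar>(gain c S i N - gain c S i M) - (gain c S i N' - gain c S i M')\<bar>
      = \<bar>2 * c * S * (?P 2 3 - ?P 1 4)\<bar>"
    unfolding gain_def collision_def by (cases "i = 1 \<or> i = 4") (simp_all add: algebra_simps)
  moreover have "\<bar>2 * c * S * (?P 2 3 - ?P 1 4)\<bar> = 2 * c * S * \<bar>?P 2 3 - ?P 1 4\<bar>"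
    using assms(1,2) by (simp add: abs_mult)
  moreover have "2 * c * S * (4 * K * (e + d) * w) = 8 * c * S * K * (e + d) * w" by simp
  ultimately show ?thesis by (simp only:)
qed

text \<open>Here \<open>B i\<close> is the transported datum of species \<open>i\<close>, constant along its characteristics. The two inequalities \<open>small\<close> and \<open>invariant\<close>
  follow from \<open>p K \<le> 1\<close> and \<open>q + p K\<^sup>2 = K\<close>.\<close>

locale picard = slab_geometry +
  fixes S q K :: real and B :: "4 \<Rightarrow> real \<times> real \<times> real \<Rightarrow> real"
  assumes S: "S > 0" and K: "K > 0"
    and small: "4 * c * S * (1 + 8 * T) * K \<le> 1"
    and invariant: "q + 4 * c * S * (1 + 8 * T) * K * K \<le> K"
    and B_nonneg: "\<And>i z. z \<in> slab T a1 b1 a2 b2 \<Longrightarrow> 0 \<le> B i z"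
    and B_le: "\<And>i z. z \<in> slab T a1 b1 a2 b2 \<Longrightarrow> B i z \<le> q"
    and B_lipschitz: "\<And>i z z'. \<lbrakk>z \<in> slab T a1 b1 a2 b2; z' \<in> slab T a1 b1 a2 b2\<rbrakk>
        \<Longrightarrow> \<bar>B i z - B i z'\<bar> \<le> q * omega c (z - z')"
    and B_strict_deriv: "\<And>i z h. z \<in> regular_part \<Longrightarrow> \<exists>d. strict_deriv (B i) z h d"
    and B_along: "\<And>i z s. B i (z + s *\<^sub>R vel i) = B i z"
begin

definition picard_step :: "(real \<times> real \<times> real \<Rightarrow> real ^ 4) \<Rightarrow> real \<times> real \<times> real \<Rightarrow> real ^ 4" where
  "picard_step N z = (\<chi> i. B i (retract z) + transport i (\<lambda>y. gain c S i (N y)) (retract z))"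

definition tame :: "(real \<times> real \<times> real \<Rightarrow> real ^ 4) \<Rightarrow> bool" where
  "tame N \<longleftrightarrow> (\<forall>i z. \<bar>N z $ i\<bar> \<le> K) \<and> (\<forall>i z z'. \<bar>N z $ i - N z' $ i\<bar> \<le> K * omega c (z - z'))"

definition near :: "real \<Rightarrow> real \<Rightarrow> (real \<times> real \<times> real \<Rightarrow> real ^ 4) \<Rightarrow> (real \<times> real \<times> real \<Rightarrow> real ^ 4) \<Rightarrow> bool" where
  "near d e N M \<longleftrightarrow> (\<forall>i z. \<bar>N z $ i - M z $ i\<bar> \<le> d) \<and>
     (\<forall>i z z'. \<bar>(N z $ i - M z $ i) - (N z' $ i - M z' $ i)\<bar> \<le> e * omega c (z - z'))"

text \<open>Continuous differentiability on the regular part, in the form of strict derivatives.\<close>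

definition smooth :: "(real \<times> real \<times> real \<Rightarrow> real ^ 4) \<Rightarrow> bool" where
  "smooth N \<longleftrightarrow> (\<forall>i. \<forall>z\<in>regular_part. \<forall>h. \<exists>d. strict_deriv (\<lambda>z. N z $ i) z h d)"

lemma tameD:
  assumes "tame N"
  shows "\<bar>N z $ i\<bar> \<le> K" "\<bar>N z $ i - N z' $ i\<bar> \<le> K * omega c (z - z')"
  using assms unfolding tame_def by blast+

lemma nearD:
  assumes "near d e N M"
  shows "\<bar>N z $ i - M z $ i\<bar> \<le> d"
    and "\<bar>(N z $ i - M z $ i) - (N z' $ i - M z' $ i)\<bar> \<le> e * omega c (z - z')"
  using assms unfolding near_def by blast+

lemma smoothD:
  assumes "smooth N" "z \<in> regular_part"
  shows "\<exists>d. strict_deriv (\<lambda>z. N z $ i) z h d"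
  by (rule spec[OF bspec[OF spec[OF assms(1)[unfolded smooth_def]] assms(2)]])

lemma tame_gain:
  assumes "tame N"
  shows "\<bar>gain c S i (N z)\<bar> \<le> 4 * c * S * K * K"
    and "\<bar>gain c S i (N z) - gain c S i (N z')\<bar> \<le> (8 * c * S * K * K) * omega c (z - z')"
proof -
  show "\<bar>gain c S i (N z)\<bar> \<le> 4 * c * S * K * K"
    by (rule gain_bound[OF c S tameD(1)[OF assms]])
  have "\<bar>gain c S i (N z) - gain c S i (N z')\<bar> \<le> 8 * c * S * K * (K * omega c (z - z'))"
    by (rule gain_diff[OF c S tameD(1)[OF assms] tameD(1)[OF assms] tameD(2)[OF assms]])
  then show "\<bar>gain c S i (N z) - gain c S i (N z')\<bar> \<le> (8 * c * S * K * K) * omega c (z - z')"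
    by (simp add: mult_ac)
qed

lemma cSK_nonneg: "0 \<le> c * S * K" "0 \<le> c * S * K * K" "0 \<le> T * (c * S * K)" "0 \<le> T * (c * S * K * K)"
  using c S K T by simp_all

text \<open>The collision term is bounded by \<open>4 c S K\<^sup>2\<close> and has Lipschitz constant \<open>8 c S K\<^sup>2\<close>. Transport adds
  the bound \<open>4 c S T K\<^sup>2\<close> and the Lipschitz constant \<open>(4 c S + 24 c S T) K\<^sup>2\<close>; with \<open>q\<close> both stay below
  \<open>K\<close>.\<close>

lemma tame_step:
  assumes "tame N" shows "tame (picard_step N)"
proof -
  have q: "q + 4 * (c * S * K * K) + 32 * (T * (c * S * K * K)) \<le> K"
    using invariant by (simp add: algebra_simps)
  have "\<bar>picard_step N z $ i\<bar> \<le> K" for z i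
  proof -
    have "\<bar>transport i (\<lambda>y. gain c S i (N y)) (retract z)\<bar> \<le> T * (4 * c * S * K * K)"
      by (rule transport_bound[OF tame_gain(2,1)[OF assms] retract_mem])
    moreover have "\<bar>B i (retract z)\<bar> \<le> q"
      using B_nonneg[OF retract_mem] B_le[OF retract_mem] by simp
    ultimately have "\<bar>picard_step N z $ i\<bar> \<le> q + T * (4 * c * S * K * K)"
      unfolding picard_step_def by simp
    also have "\<dots> = q + 4 * (T * (c * S * K * K))" by simp
    also have "\<dots> \<le> K" using q cSK_nonneg(2,4) by linarith
    finally show ?thesis .
  qed
  moreover have "\<bar>picard_step N z $ i - picard_step N z' $ i\<bar> \<le> K * omega c (z - z')" for z z' i
  proof -
    have "\<bar>transport i (\<lambda>y. gain c S i (N y)) (retract z) - transport i (\<lambda>y. gain c S i (N y)) (retract z')\<bar>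
        \<le> (4 * c * S * K * K + 3 * T * (8 * c * S * K * K)) * omega c (retract z - retract z')"
      by (rule transport_lipschitz[OF tame_gain(2)[OF assms] _ tame_gain(1)[OF assms] retract_mem retract_mem])
         (use cSK_nonneg in \<open>simp add: mult_ac\<close>)
    moreover have "\<bar>B i (retract z) - B i (retract z')\<bar> \<le> q * omega c (retract z - retract z')"
      by (rule B_lipschitz[OF retract_mem retract_mem])
    ultimately have "\<bar>picard_step N z $ i - picard_step N z' $ i\<bar>
        \<le> (q + (4 * c * S * K * K + 3 * T * (8 * c * S * K * K))) * omega c (retract z - retract z')"
      unfolding picard_step_def by (simp add: distrib_right)
    also have "\<dots> \<le> K * omega c (z - z')"
    proof (rule mult_mono[OF _ omega_retract])
      have "q + (4 * c * S * K * K + 3 * T * (8 * c * S * K * K))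
          = q + 4 * (c * S * K * K) + 24 * (T * (c * S * K * K))" by simp
      with q cSK_nonneg(4) show "q + (4 * c * S * K * K + 3 * T * (8 * c * S * K * K)) \<le> K" by linarith
    qed (use K omega_nonneg[OF c] in auto)
    finally show ?thesis .
  qed
  ultimately show ?thesis by (simp add: tame_def)
qed

text \<open>The difference of the collision terms is bounded by \<open>8 c S K d\<close> with Lipschitz constant
  \<open>8 c S K (e + d)\<close>, and \<open>8 c S K \<le> 2\<close>, \<open>8 c S T K \<le> 1 / 4\<close>. The seminorm \<open>e\<close> also receives a multiple of
  \<open>d\<close>, but \<open>d\<close> contracts independently of \<open>e\<close>.\<close>

lemma near_step:
  assumes N: "tame N" and M: "tame M" and near: "near d e N M" and de: "0 \<le> d" "0 \<le> e"
  shows "near (d / 4) (3 / 4 * e + 11 / 4 * d) (picard_step N) (picard_step M)"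
proof -
  have sm: "4 * (c * S * K) + 32 * (T * (c * S * K)) \<le> 1"
    using small by (simp add: algebra_simps)
  define F where "F i y = gain c S i (N y) - gain c S i (M y)" for i y
  have tr: "picard_step N z $ i - picard_step M z $ i = transport i (F i) (retract z)" for i z
    unfolding picard_step_def F_def[abs_def]
    by (simp add: transport_diff[OF tame_gain(2)[OF N] tame_gain(2)[OF M], symmetric])
  have bnd: "\<bar>F i y\<bar> \<le> 8 * c * S * K * d" for i y
    unfolding F_def by (rule gain_diff[OF c S tameD(1)[OF N] tameD(1)[OF M] nearD(1)[OF near]])
  have lip: "\<bar>F i y - F i y'\<bar> \<le> (8 * c * S * K * (e + d)) * omega c (y - y')" for i y y'
    unfolding F_def
    by (rule gain_second_diff[OF c S tameD(1)[OF N] tameD(1)[OF M] tameD(2)[OF N] tameD(2)[OF M]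
        nearD[OF near]])
  have "\<bar>transport i (F i) (retract z)\<bar> \<le> d / 4" for i z
  proof -
    have "\<bar>transport i (F i) (retract z)\<bar> \<le> T * (8 * c * S * K * d)"
      by (rule transport_bound[OF lip bnd retract_mem])
    also have "\<dots> = (8 * (T * (c * S * K))) * d" by (simp add: mult_ac)
    also have "\<dots> \<le> (1 / 4) * d"
      using sm cSK_nonneg de by (intro mult_right_mono) auto
    finally show ?thesis by simp
  qed
  moreover have "\<bar>transport i (F i) (retract z) - transport i (F i) (retract z')\<bar>
      \<le> (3 / 4 * e + 11 / 4 * d) * omega c (z - z')" for i z z'
  proof -
    have "\<bar>transport i (F i) (retract z) - transport i (F i) (retract z')\<bar>
        \<le> (8 * c * S * K * d + 3 * T * (8 * c * S * K * (e + d))) * omega c (retract z - retract z')"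
      by (rule transport_lipschitz[OF lip _ bnd retract_mem retract_mem]) (use c S K de in simp)
    also have "8 * c * S * K * d + 3 * T * (8 * c * S * K * (e + d))
        = (8 * (c * S * K)) * d + (24 * (T * (c * S * K))) * (e + d)" by (simp add: algebra_simps)
    also have "((8 * (c * S * K)) * d + (24 * (T * (c * S * K))) * (e + d)) * omega c (retract z - retract z')
        \<le> (2 * d + 3 / 4 * (e + d)) * omega c (z - z')"
    proof (rule mult_mono[OF _ omega_retract])
      have "8 * (c * S * K) \<le> 2" "24 * (T * (c * S * K)) \<le> 3 / 4"
        using sm cSK_nonneg(1,3) by linarith+
      then show "8 * (c * S * K) * d + 24 * (T * (c * S * K)) * (e + d) \<le> 2 * d + 3 / 4 * (e + d)"
        by (intro add_mono mult_right_mono) (use de in auto)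
    qed (use de omega_nonneg[OF c] in auto)
    also have "2 * d + 3 / 4 * (e + d) = 3 / 4 * e + 11 / 4 * d"
      by (simp add: add_divide_distrib)
    finally show ?thesis .
  qed
  ultimately show ?thesis unfolding near_def tr by blast
qed

lemma tame_isCont: "tame N \<Longrightarrow> isCont (\<lambda>z. N z $ i) z"
  by (rule omega_lipschitz_isCont[OF tameD(2)])

lemma smooth_gain:
  assumes "tame N" "smooth N" "z \<in> regular_part"
  shows "\<exists>d. strict_deriv (\<lambda>y. gain c S i (N y)) z h d"
proof -
  obtain d where d: "strict_deriv (\<lambda>y. N y $ j) z h (d j)" for j
    using choice[of "\<lambda>j e. strict_deriv (\<lambda>y. N y $ j) z h e"] smoothD[OF assms(2,3)] by blast
  note prod = strict_deriv_mult[OF d d tame_isCont[OF assms(1)] tame_isCont[OF assms(1)]]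
  define k where "k = (if i = 1 \<or> i = 4 then 2 * c * S else - (2 * c * S))"
  have "(\<lambda>y. gain c S i (N y)) = (\<lambda>y. k * (N y $ 2 * N y $ 3 + (-1) * (N y $ 1 * N y $ 4)))"
    by (simp add: gain_def collision_def k_def)
  then show ?thesis
    using strict_deriv_cmult[OF strict_deriv_add[OF prod strict_deriv_cmult[OF prod]]] by (simp only:) blast
qed

lemma smooth_step:
  assumes "tame N" "smooth N" shows "smooth (picard_step N)"
  unfolding smooth_def
proof (intro allI ballI)
  fix i z h assume z: "z \<in> regular_part"
  obtain d where d: "strict_deriv (B i) z h d" using B_strict_deriv[OF z] by blast
  have "0 \<le> 8 * c * S * K * K" using cSK_nonneg by (simp add: mult_ac)
  then obtain e where e: "strict_deriv (transport i (\<lambda>y. gain c S i (N y))) z h e"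
    using transport_strict_deriv[OF tame_gain(2)[OF assms(1)] _ smooth_gain[OF assms] z] by blast
  have "strict_deriv (\<lambda>z. picard_step N z $ i) z h (d + e)"
  proof (rule strict_deriv_transform[OF strict_deriv_add[OF d e] open_open_slab])
    show "z \<in> slab_interior T a1 b1 a2 b2" using z by (simp add: regular_part_def)
    show "B i x + transport i (\<lambda>y. gain c S i (N y)) x = picard_step N x $ i"
      if "x \<in> slab_interior T a1 b1 a2 b2" for x
      using that open_slab_subset retract_id[of x] by (auto simp: picard_step_def)
  qed
  then show "\<exists>d. strict_deriv (\<lambda>z. picard_step N z $ i) z h d" by blast
qed

definition iterate :: "nat \<Rightarrow> real \<times> real \<times> real \<Rightarrow> real ^ 4" where
  "iterate k = (picard_step ^^ k) (\<lambda>_. 0)"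

lemma iterate_Suc: "iterate (Suc k) = picard_step (iterate k)"
  by (simp add: iterate_def)

lemma tame_iterate: "tame (iterate k)"
proof (induction k)
  case 0
  show ?case using K omega_nonneg[OF c] by (simp add: iterate_def tame_def)
qed (simp add: iterate_Suc tame_step)

lemma smooth_iterate: "smooth (iterate k)"
proof (induction k)
  case 0
  show ?case using strict_deriv_const by (auto simp: iterate_def smooth_def)
qed (simp add: iterate_Suc smooth_step tame_iterate)

text \<open>The weights solve the recursion of \<open>near_step\<close>: \<open>2 / 4 \<le> (7/8) * 2\<close> and
  \<open>(3/4) * 44 + (11/4) * 2 = (7/8) * 44\<close>.\<close>

lemma near_iterate: "near (2 * K * (7/8) ^ k) (44 * K * (7/8) ^ k) (iterate (Suc k)) (iterate k)"
proof (induction k)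
  case 0
  have "\<bar>iterate 1 z $ i - iterate 0 z $ i\<bar> \<le> 2 * K" for z i
    using tameD(1)[OF tame_iterate[of 1], of z i] K by (simp add: iterate_def)
  moreover have "\<bar>(iterate 1 z $ i - iterate 0 z $ i) - (iterate 1 z' $ i - iterate 0 z' $ i)\<bar>
      \<le> 44 * K * omega c (z - z')" for z z' i
  proof -
    have "\<bar>iterate 1 z $ i - iterate 1 z' $ i\<bar> \<le> K * omega c (z - z')"
      by (rule tameD(2)[OF tame_iterate])
    also have "\<dots> \<le> 44 * K * omega c (z - z')"
      using K omega_nonneg[OF c] by (intro mult_right_mono) auto
    finally show ?thesis by (simp add: iterate_def)
  qed
  ultimately show ?case by (simp add: near_def del: split_paired_All)
next
  case (Suc k)
  let ?r = "(7/8::real) ^ k"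
  have step: "near (2 * K * ?r / 4) (3 / 4 * (44 * K * ?r) + 11 / 4 * (2 * K * ?r))
      (iterate (Suc (Suc k))) (iterate (Suc k))"
    unfolding iterate_Suc[of "Suc k"]
    using near_step[OF tame_iterate tame_iterate Suc.IH] K by (simp add: iterate_Suc)
  have "2 * K * ?r / 4 \<le> 2 * K * (7/8) ^ Suc k" "3 / 4 * (44 * K * ?r) + 11 / 4 * (2 * K * ?r) \<le> 44 * K * (7/8) ^ Suc k"
    using K by simp_all
  with step show ?case
    using omega_nonneg[OF c] unfolding near_def by (meson mult_right_mono order_trans)
qed

definition solution :: "real \<times> real \<times> real \<Rightarrow> real ^ 4" where
  "solution z = (\<chi> i. lim (\<lambda>k. iterate k z $ i))"

lemma solution_tendsto: "(\<lambda>k. iterate k z $ i) \<longlonglongrightarrow> solution z $ i"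
proof -
  have "convergent (\<lambda>k. iterate k z $ i)"
    by (rule geometric_steps_converge(1)[where r = "7/8", OF _ _ nearD(1)[OF near_iterate]]) simp_all
  then show ?thesis by (simp add: solution_def convergent_LIMSEQ_iff)
qed

lemma tame_solution: "tame solution"
  unfolding tame_def
proof (intro conjI allI)
  show "\<bar>solution z $ i\<bar> \<le> K" for i z
    by (rule LIMSEQ_le_const2[OF tendsto_rabs[OF solution_tendsto]])
       (use tameD(1)[OF tame_iterate] in blast)
  show "\<bar>solution z $ i - solution z' $ i\<bar> \<le> K * omega c (z - z')" for i z z'
    by (rule LIMSEQ_le_const2[OF tendsto_rabs[OF tendsto_diff[OF solution_tendsto solution_tendsto]]])
       (use tameD(2)[OF tame_iterate] in blast)
qed

text \<open>The geometric tail multiplies the distance of successive iterates by \<open>1 / (1 - 7/8) = 8\<close>.\<close>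

lemma near_solution: "near (16 * K * (7/8) ^ k) (352 * K * (7/8) ^ k) (iterate k) solution"
proof -
  have "\<bar>iterate k z $ i - solution z $ i\<bar> \<le> 16 * K * (7/8) ^ k" for i z
  proof -
    have "\<bar>iterate (Suc k) z $ i - iterate k z $ i\<bar> \<le> 2 * K * (7/8) ^ k" for k
      by (rule nearD(1)[OF near_iterate])
    from geometric_steps_converge(2)[where x = "\<lambda>k. iterate k z $ i", OF _ _ this, of k]
    show ?thesis by (simp add: solution_def)
  qed
  moreover have "\<bar>(iterate k z $ i - solution z $ i) - (iterate k z' $ i - solution z' $ i)\<bar>
      \<le> 352 * K * (7/8) ^ k * omega c (z - z')" for i z z'
  proof -
    let ?x = "\<lambda>k. iterate k z $ i - iterate k z' $ i"
    have "\<bar>?x (Suc k) - ?x k\<bar> \<le> (44 * K * omega c (z - z')) * (7/8) ^ k" for k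
      using nearD(2)[OF near_iterate, of k z i z'] by (simp add: algebra_simps)
    from geometric_steps_converge(2)[OF _ _ this, of k]
    have "\<bar>?x k - lim ?x\<bar> \<le> 352 * K * (7/8) ^ k * omega c (z - z')" by (simp add: mult_ac)
    moreover have "lim ?x = solution z $ i - solution z' $ i"
      by (rule limI[OF tendsto_diff[OF solution_tendsto solution_tendsto]])
    ultimately show ?thesis by (simp add: algebra_simps)
  qed
  ultimately show ?thesis unfolding near_def by blast
qed

lemma smooth_solution: "smooth solution"
  unfolding smooth_def
proof (intro allI ballI)
  fix i z h assume z: "z \<in> regular_part"
  show "\<exists>d. strict_deriv (\<lambda>z. solution z $ i) z h d"
  proof (rule strict_deriv_limit)
    show "\<exists>d. strict_deriv (\<lambda>z. iterate k z $ i) z h d" for k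
      by (rule smoothD[OF smooth_iterate z])
    show "\<bar>(iterate k (x + s *\<^sub>R h) $ i - solution (x + s *\<^sub>R h) $ i) - (iterate k x $ i - solution x $ i)\<bar>
        \<le> (352 * K * (7/8) ^ k * omega c h) * \<bar>s\<bar>" for k x s
    proof -
      have "\<bar>(iterate k (x + s *\<^sub>R h) $ i - solution (x + s *\<^sub>R h) $ i) - (iterate k x $ i - solution x $ i)\<bar>
          \<le> 352 * K * (7/8) ^ k * omega c (x + s *\<^sub>R h - x)"
        by (rule nearD(2)[OF near_solution])
      then show ?thesis
        by (simp only: add_diff_cancel_left' omega_scaleR mult.assoc mult.commute[of "\<bar>s\<bar>"])
    qed
    have "(\<lambda>k. 352 * K * (7/8) ^ k * omega c h) \<longlonglongrightarrow> 352 * K * 0 * omega c h"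
      by (intro tendsto_intros LIMSEQ_power_zero) auto
    then show "(\<lambda>k. 352 * K * (7/8) ^ k * omega c h) \<longlonglongrightarrow> 0" by simp
  qed
qed

lemma solution_fixed: "picard_step solution = solution"
proof -
  have "picard_step solution z $ i = solution z $ i" for z i
  proof -
    have "near (16 * K * (7/8) ^ k / 4) (3 / 4 * (352 * K * (7/8) ^ k) + 11 / 4 * (16 * K * (7/8) ^ k))
        (iterate (Suc k)) (picard_step solution)" for k
      unfolding iterate_Suc using K
      by (intro near_step tame_iterate tame_solution near_solution) auto
    from nearD(1)[OF this]
    have "\<bar>iterate (Suc k) z $ i - picard_step solution z $ i\<bar> \<le> 4 * K * (7/8) ^ k" for k
      by (simp add: mult_ac)
    then have le: "\<forall>k. norm (iterate (Suc k) z $ i - picard_step solution z $ i) \<le> 4 * K * (7/8) ^ k"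
      by (intro allI) (simp only: real_norm_def)
    have "(\<lambda>k. 4 * K * (7/8) ^ k) \<longlonglongrightarrow> 4 * K * 0"
      by (intro tendsto_intros LIMSEQ_power_zero) auto
    then have "(\<lambda>k. 4 * K * (7/8) ^ k) \<longlonglongrightarrow> 0"
      by (simp only: mult_zero_right)
    with always_eventually[OF le]
    have "(\<lambda>k. iterate (Suc k) z $ i - picard_step solution z $ i) \<longlonglongrightarrow> 0"
      by (rule Lim_null_comparison)
    then have "(\<lambda>k. iterate (Suc k) z $ i) \<longlonglongrightarrow> picard_step solution z $ i"
      by (rule LIM_zero_cancel)
    then show ?thesis
      using LIMSEQ_unique LIMSEQ_Suc[OF solution_tendsto] by blast
  qed
  then show ?thesis by (simp add: fun_eq_iff vec_eq_iff)
qed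

lemma solution_eq:
  "z \<in> slab T a1 b1 a2 b2 \<Longrightarrow>
     solution z $ i = B i z + transport i (\<lambda>y. gain c S i (solution y)) z"
  using arg_cong[OF fun_cong[OF solution_fixed, of z], of "\<lambda>v. v $ i"]
  by (simp add: picard_step_def retract_id)

end

section \<open>Mild solutions: sign and uniqueness\<close>

lemma scaled_path_integral:
  fixes f :: "real \<Rightarrow> real"
  assumes f: "continuous_on {s - l..s} f" and l: "0 \<le> l"
  shows "l * integral {0..1} (\<lambda>\<theta>. f (s - \<theta> * l)) = integral {s - l..s} f"
proof -
  obtain p where p: "\<And>x. x \<in> {s - l..s} \<Longrightarrow> (p has_vector_derivative f x) (at x within {s - l..s})"
    using antiderivative_continuous[OF f] by blast
  have "((\<lambda>\<theta>. (- l) *\<^sub>R f (s - \<theta> * l)) has_integral (p \<circ> (\<lambda>\<theta>. s - \<theta> * l)) 1 - (p \<circ> (\<lambda>\<theta>. s - \<theta> * l)) 0) {0..1}"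
  proof (rule fundamental_theorem_of_calculus)
    fix \<theta> :: real assume \<theta>: "\<theta> \<in> {0..1}"
    have sub: "s - \<theta> * l \<in> {s - l..s}" if "\<theta> \<in> {0..1}" for \<theta>
      using that l by (auto simp: mult_left_le_one_le)
    show "((p \<circ> (\<lambda>\<theta>. s - \<theta> * l)) has_vector_derivative (- l) *\<^sub>R f (s - \<theta> * l)) (at \<theta> within {0..1})"
    proof (rule vector_diff_chain_within)
      show "((\<lambda>\<theta>. s - \<theta> * l) has_vector_derivative - l) (at \<theta> within {0..1})"
        by (auto intro!: derivative_eq_intros)
      show "(p has_vector_derivative f (s - \<theta> * l)) (at (s - \<theta> * l) within (\<lambda>\<theta>. s - \<theta> * l) ` {0..1})"
        by (rule has_vector_derivative_within_subset[OF p[OF sub[OF \<theta>]]]) (use sub in blast)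
    qed
  qed simp
  from integral_unique[OF this]
  have "- (l * integral {0..1} (\<lambda>\<theta>. f (s - \<theta> * l))) = p (s - l) - p s"
    by simp
  moreover have "integral {s - l..s} f = p s - p (s - l)"
    by (intro integral_unique fundamental_theorem_of_calculus p) (use l in auto)
  ultimately show ?thesis by simp
qed

lemma product_ge:
  fixes u v m K :: real
  assumes "- m \<le> u" "- m \<le> v" "\<bar>u\<bar> \<le> K" "\<bar>v\<bar> \<le> K" "0 \<le> m"
  shows "- (K * m) \<le> u * v"
proof -
  have K: "0 \<le> K" using assms(3) by linarith
  consider "0 \<le> u * v" | "u < 0" "0 < v" | "0 < u" "v < 0"
    by (metis linorder_neqE_linordered_idom mult_neg_neg mult_pos_pos mult_zero_left mult_zero_right order.order_iff_strict)
  then show ?thesis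
  proof cases
    case 1
    moreover have "0 \<le> K * m" using K assms(5) by simp
    ultimately show ?thesis by linarith
  next
    case 2
    have "(- u) * v \<le> m * K" using 2 assms by (intro mult_mono) auto
    then show ?thesis by (simp add: mult.commute)
  next
    case 3
    have "u * (- v) \<le> K * m" using 3 assms K by (intro mult_mono) auto
    then show ?thesis by simp
  qed
qed

lemma product_le:
  fixes u v m K :: real
  assumes "- m \<le> u" "- m \<le> v" "\<bar>u\<bar> \<le> K" "u \<le> 0" "0 \<le> m"
  shows "u * v \<le> K * m"
proof (cases "0 \<le> v")
  case True
  then have "u * v \<le> 0" using assms(4) by (rule mult_nonpos_nonneg[rotated])
  moreover have "0 \<le> K * m" using assms by (intro mult_nonneg_nonneg) auto
  ultimately show ?thesis by linarith
next
  case False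
  have "(- u) * (- v) \<le> K * m" using assms False by (intro mult_mono) auto
  then show ?thesis by simp
qed

text \<open>The loss term of species \<open>i\<close> contains the factor \<open>N $ i\<close>, so where this component is not positive the
  rate can be negative only through negative parts of some component.\<close>

lemma gain_ge_where_nonpositive:
  assumes "c > 0" "S > 0" and ge: "\<And>j. - m \<le> N $ j" and le: "\<And>j. \<bar>N $ j\<bar> \<le> K"
    and "N $ i \<le> 0" "0 \<le> m"
  shows "- (4 * c * S * K * m) \<le> gain c S i N"
proof -
  have split: "- (4 * c * S * K * m) \<le> 2 * c * S * (u * v - w * y)"
    if "- (K * m) \<le> u * v" "w * y \<le> K * m" for u v w y
  proof -
    have "2 * c * S * (- (2 * (K * m))) \<le> 2 * c * S * (u * v - w * y)"
      using that assms(1,2) by (intro mult_left_mono) auto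
    then show ?thesis by simp
  qed
  have ge': "- (K * m) \<le> N $ j * N $ k" for j k
    by (rule product_ge[OF ge ge le le \<open>0 \<le> m\<close>])
  have le': "N $ i * N $ k \<le> K * m" for k
    by (rule product_le[OF ge ge le \<open>N $ i \<le> 0\<close> \<open>0 \<le> m\<close>])
  consider "i = 1" | "i = 2" | "i = 3" | "i = 4" using exhaust_4[of i] by blast
  then show ?thesis
  proof cases
    case 1
    then show ?thesis using split[OF ge'[of 2 3] le'[of 4]] by (simp add: gain_def collision_def)
  next
    case 2
    then show ?thesis using split[OF ge'[of 1 4] le'[of 3]]
      by (simp add: gain_def collision_def right_diff_distrib)
  next
    case 3
    then show ?thesis using split[OF ge'[of 1 4] le'[of 2]]
      by (simp add: gain_def collision_def right_diff_distrib mult.commute[of "N $ 3"])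
  next
    case 4
    then show ?thesis using split[OF ge'[of 2 3] le'[of 1]]
      by (simp add: gain_def collision_def mult.commute[of "N $ 4"])
  qed
qed

context picard
begin

text \<open>A formulation of the problem that is uniform in the species: \<open>len i z = 0\<close> says that \<open>z\<close> lies on a face
  where species \<open>i\<close> enters.\<close>

definition mild :: "(real \<times> real \<times> real \<Rightarrow> real ^ 4) \<Rightarrow> bool" where
  "mild M \<longleftrightarrow> continuous_on closed_slab M \<and>
     (\<forall>z\<in>open_slab. \<forall>i. ((\<lambda>s. M (z + s *\<^sub>R vel i) $ i) has_real_derivative gain c S i (M z)) (at 0)) \<and>
     (\<forall>z\<in>closed_slab. \<forall>i. len i z = 0 \<longrightarrow> M z $ i = B i z)"

lemma len_shift: "len i (z + s *\<^sub>R vel i) = len i z + s"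
proof -
  have "fst (vel i) = 1" by (simp add: vel_def)
  moreover have "lead i (z + s *\<^sub>R vel i) / c = lead i z / c + s"
    using c by (simp add: lead_add_scaleR chart_vel add_divide_distrib)
  ultimately show ?thesis by (simp add: len_def)
qed

lemma solution_isCont: "isCont (\<lambda>y. gain c S i (solution y)) z"
  by (rule omega_lipschitz_isCont[OF tame_gain(2)[OF tame_solution]])

text \<open>Moving \<open>z\<close> along the characteristic keeps \<open>B i\<close> and the entry point fixed, so only the upper limit of
  the path integral varies.\<close>

lemma solution_char_derivative:
  assumes z: "z \<in> open_slab"
  shows "((\<lambda>s. solution (z + s *\<^sub>R vel i) $ i) has_real_derivative gain c S i (solution z)) (at 0)"
proof -
  define l where "l = len i z"
  define f where "f s = gain c S i (solution (z + s *\<^sub>R vel i))" for s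
  have l: "l > 0" unfolding l_def by (rule len_pos[OF z])
  have cont: "continuous_on X f" for X
    unfolding f_def
    by (intro continuous_at_imp_continuous_on ballI isCont_o2[OF _ solution_isCont]) (auto intro!: continuous_intros)
  have "(\<lambda>s. z + s *\<^sub>R vel i) \<midarrow>0\<rightarrow> z + 0 *\<^sub>R vel i"
    by (intro tendsto_intros)
  then have "\<forall>\<^sub>F s in at 0. z + s *\<^sub>R vel i \<in> open_slab"
    by (rule topological_tendstoD) (use z open_open_slab in auto)
  moreover have "\<forall>\<^sub>F s in at 0. s \<in> {- l<..<l}"
    using l by (intro eventually_at_in_open') auto
  ultimately have ev: "\<forall>\<^sub>F s in nhds 0. B i z + integral {- l..s} f = solution (z + s *\<^sub>R vel i) $ i"
    unfolding eventually_nhds_conv_at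
  proof (intro conjI)
    have "B i (z + s *\<^sub>R vel i) + transport i (\<lambda>y. gain c S i (solution y)) (z + s *\<^sub>R vel i)
        = B i z + integral {- l..s} f" if "s \<in> {- l<..<l}" for s
    proof -
      have "transport i (\<lambda>y. gain c S i (solution y)) (z + s *\<^sub>R vel i)
          = (l + s) * integral {0..1} (\<lambda>\<theta>. f (s - \<theta> * (l + s)))"
        unfolding transport_def len_shift l_def[symmetric] f_def by (simp add: algebra_simps)
      also have "\<dots> = integral {s - (l + s)..s} f"
        by (rule scaled_path_integral[OF cont]) (use that in auto)
      finally show ?thesis by (simp add: B_along)
    qed
    then have eq: "B i z + integral {- l..s} f = solution (z + s *\<^sub>R vel i) $ i"
      if "z + s *\<^sub>R vel i \<in> open_slab" "s \<in> {- l<..<l}" for s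
      using solution_eq[OF subsetD[OF open_slab_subset that(1)], of i] that(2) by (simp only:)
    assume "\<forall>\<^sub>F s in at 0. z + s *\<^sub>R vel i \<in> open_slab" "\<forall>\<^sub>F s in at 0. s \<in> {- l<..<l}"
    then show "\<forall>\<^sub>F s in at 0. B i z + integral {- l..s} f = solution (z + s *\<^sub>R vel i) $ i"
      by eventually_elim (rule eq)
    show "B i z + integral {- l..0} f = solution (z + 0 *\<^sub>R vel i) $ i"
      by (rule eq) (use z l in auto)
  qed
  have at0: "at 0 within {- l..l} = at 0"
    by (rule at_within_interior) (use l in simp)
  have "((\<lambda>s. integral {- l..s} f) has_vector_derivative f 0) (at 0 within {- l..l})"
    by (rule integral_has_vector_derivative[OF cont]) (use l in auto)
  then have "((\<lambda>s. integral {- l..s} f) has_real_derivative f 0) (at 0)"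
    unfolding at0 has_real_derivative_iff_has_vector_derivative .
  then have "((\<lambda>s. B i z + integral {- l..s} f) has_real_derivative f 0) (at 0)"
    using DERIV_add[OF DERIV_const] by fastforce
  then have "((\<lambda>s. solution (z + s *\<^sub>R vel i) $ i) has_real_derivative f 0) (at 0)"
    using DERIV_cong_ev[OF refl ev refl] by simp
  then show ?thesis by (simp add: f_def)
qed

lemma mild_solution: "mild solution"
  unfolding mild_def
proof (intro conjI ballI allI impI)
  have "continuous_on closed_slab (\<lambda>z. \<chi> i. solution z $ i)"
    by (intro continuous_on_vec_lambda continuous_at_imp_continuous_on ballI tame_isCont[OF tame_solution])
  then show "continuous_on closed_slab solution" by simp
  show "solution z $ i = B i z" if "z \<in> closed_slab" "len i z = 0" for z i
    using that by (simp add: solution_eq transport_def)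
qed (rule solution_char_derivative)

lemma mild_along_characteristic:
  fixes M :: "real \<times> real \<times> real \<Rightarrow> real ^ 4" and z :: "real \<times> real \<times> real" and i :: 4
  assumes M: "mild M" and z: "z \<in> open_slab"
  defines "\<phi> \<equiv> \<lambda>s. M (z - (len i z - s) *\<^sub>R vel i) $ i"
  shows "continuous_on {0..len i z} \<phi>" and "\<phi> 0 = B i z"
    and "\<And>s. \<lbrakk>0 < s; s < len i z\<rbrakk>
          \<Longrightarrow> (\<phi> has_real_derivative gain c S i (M (z - (len i z - s) *\<^sub>R vel i))) (at s)"
proof -
  have zc: "z \<in> closed_slab" using z open_slab_subset by blast
  have mem: "z - (len i z - s) *\<^sub>R vel i \<in> closed_slab" if "s \<in> {0..len i z}" for s
    by (rule backward_mem_closed_slab[OF zc]) (use that in auto)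
  have cM: "continuous_on closed_slab M" using M by (simp add: mild_def)
  show "continuous_on {0..len i z} \<phi>" unfolding \<phi>_def
    by (intro continuous_on_component continuous_on_compose2[OF cM] continuous_intros) (use mem in auto)
  have "len i (z - len i z *\<^sub>R vel i) = 0"
    using len_shift[of i z "- len i z"] by simp
  then have "\<phi> 0 = B i (z - len i z *\<^sub>R vel i)"
    using M mem[of 0] len_bounds[OF zc, of i] unfolding mild_def \<phi>_def by simp
  then show "\<phi> 0 = B i z" using B_along[of i z "- len i z"] by simp
  fix s assume s: "0 < s" "s < len i z"
  let ?y = "z - (len i z - s) *\<^sub>R vel i"
  have "?y \<in> open_slab" by (rule backward_mem_open_slab[OF z]) (use s in auto)
  then have "((\<lambda>r. M (?y + r *\<^sub>R vel i) $ i) has_real_derivative gain c S i (M ?y)) (at 0)"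
    using M unfolding mild_def by blast
  moreover have "(\<lambda>r. M (?y + r *\<^sub>R vel i) $ i) = (\<lambda>r. \<phi> (s + r))"
    unfolding \<phi>_def by (simp add: algebra_simps)
  ultimately show "(\<phi> has_real_derivative gain c S i (M ?y)) (at s)"
    using DERIV_at_within_shift[of \<phi> "gain c S i (M ?y)" s 0 UNIV] by simp
qed

text \<open>If component \<open>i\<close> is negative at \<open>z\<close>, let \<open>s0\<close> be the last time on its characteristic at which it was not.
  From then on it decreases at most at the rate \<open>4 c S K m\<close>, and \<open>4 c S T K \<le> 1 / 2\<close>.\<close>

lemma negative_part_halves:
  assumes m: "0 \<le> m" and ge: "\<And>z i. z \<in> closed_slab \<Longrightarrow> - m \<le> solution z $ i" and z: "z \<in> closed_slab"
  shows "- (m / 2) \<le> solution z $ i"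
proof -
  have inner: "- (m / 2) \<le> solution z $ i" if z: "z \<in> open_slab" for z
  proof (cases "0 \<le> solution z $ i")
    case True
    with m show ?thesis by linarith
  next
    case False
    define l where "l = len i z"
    define y where "y s = z - (l - s) *\<^sub>R vel i" for s
    define \<phi> where "\<phi> s = solution (y s) $ i" for s
    note along = mild_along_characteristic[OF mild_solution z, where i = i, folded l_def, folded y_def, folded \<phi>_def]
    have zc: "z \<in> closed_slab" using z open_slab_subset by blast
    have l: "0 < l" "l \<le> T" unfolding l_def by (rule len_pos[OF z]) (rule len_bounds[OF zc])
    have "closed ({0..l} \<inter> \<phi> -` {0..})"
      by (rule continuous_closed_preimage[OF along(1)]) auto
    then have "compact ({0..l} \<inter> \<phi> -` {0..})"
      using compact_Int_closed[OF compact_Icc, of _ 0 l] by (metis inf.right_idem inf_commute)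
    moreover have "0 \<in> {0..l} \<inter> \<phi> -` {0..}"
      using l along(2) B_nonneg[OF zc] by simp
    ultimately obtain s0 where s0: "s0 \<in> {0..l}" "0 \<le> \<phi> s0"
        and max: "\<And>s. \<lbrakk>s \<in> {0..l}; 0 \<le> \<phi> s\<rbrakk> \<Longrightarrow> s \<le> s0"
      using compact_attains_sup[of "{0..l} \<inter> \<phi> -` {0..}"] by (metis IntE IntI atLeast_iff empty_iff vimage_eq)
    have "\<phi> l < 0" using False by (simp add: \<phi>_def y_def)
    with s0 have "s0 < l" by (metis atLeastAtMost_iff less_eq_real_def not_le)
    moreover have "continuous_on {s0..l} \<phi>"
      by (rule continuous_on_subset[OF along(1)]) (use s0 in auto)
    moreover have "\<phi> differentiable (at s)" if "s0 < s" "s < l" for s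
      using along(3)[of s] that s0 by (auto simp: real_differentiable_def)
    ultimately obtain d s where s: "s0 < s" "s < l" "DERIV \<phi> s :> d" "\<phi> l - \<phi> s0 = (l - s0) * d"
      using MVT[of s0 l \<phi>] by blast
    have ys: "y s \<in> closed_slab" unfolding y_def
      by (rule backward_mem_closed_slab[OF zc]) (use s s0 l_def in auto)
    have "\<phi> s < 0" using max[of s] s s0 by fastforce
    then have "- (4 * c * S * K * m) \<le> gain c S i (solution (y s))"
      by (intro gain_ge_where_nonpositive[OF c S ge[OF ys] tameD(1)[OF tame_solution]] m) (simp add: \<phi>_def)
    moreover have "d = gain c S i (solution (y s))"
      by (rule DERIV_unique[OF s(3) along(3)]) (use s s0 in auto)
    ultimately have "(l - s0) * - (4 * c * S * K * m) \<le> (l - s0) * d"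
      using \<open>s0 < l\<close> by (intro mult_left_mono) auto
    moreover have "(l - s0) * (4 * c * S * K * m) \<le> T * (4 * c * S * K * m)"
    proof (rule mult_right_mono)
      have "0 \<le> 4 * ((c * S * K) * m)" using mult_nonneg_nonneg[OF cSK_nonneg(1) m] by simp
      then show "0 \<le> 4 * c * S * K * m" by (simp only: mult.assoc)
    qed (use l s0 in auto)
    moreover have "T * (4 * c * S * K * m) \<le> m / 2"
    proof -
      have "4 * (c * S * K) + 32 * (T * (c * S * K)) \<le> 1"
        using small by (simp add: algebra_simps)
      then have "4 * (T * (c * S * K)) \<le> 1 / 2" using cSK_nonneg(1,3) by linarith
      from mult_right_mono[OF this m] show ?thesis by (simp add: mult_ac)
    qed
    moreover have "\<phi> l = solution z $ i" by (simp add: \<phi>_def y_def)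
    ultimately show ?thesis using s(4) s0(2) by linarith
  qed
  have "continuous_on (closure open_slab) (\<lambda>z. solution z $ i)"
    by (intro continuous_at_imp_continuous_on ballI tame_isCont[OF tame_solution])
  then show ?thesis
    by (rule continuous_ge_on_closure) (use z inner in \<open>simp_all add: closure_open_slab\<close>)
qed

lemma solution_nonneg:
  assumes "z \<in> closed_slab" shows "0 \<le> solution z $ i"
proof -
  have ge: "- (K * (1 / 2) ^ n) \<le> solution z $ i" if "z \<in> closed_slab" for n z i
    using that
  proof (induction n arbitrary: z i)
    case 0
    have "\<bar>solution z $ i\<bar> \<le> K" by (rule tameD(1)[OF tame_solution])
    then show ?case by simp
  next
    case (Suc n)
    have "- (K * (1 / 2) ^ n / 2) \<le> solution z $ i"
      by (rule negative_part_halves[OF _ Suc.IH Suc.prems]) (use K in auto)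
    then show ?case by simp
  qed
  have "(\<lambda>n. - (K * (1 / 2) ^ n)) \<longlonglongrightarrow> - (K * 0)"
    by (intro tendsto_intros LIMSEQ_power_zero) auto
  then have "(\<lambda>n. - (K * (1 / 2) ^ n)) \<longlonglongrightarrow> 0" by simp
  then show ?thesis by (rule LIMSEQ_le_const2) (use ge[OF assms] in blast)
qed

text \<open>On fields bounded by \<open>A0\<close> the collision term has Lipschitz constant \<open>8 c S A0 = L / 2\<close>, and integrating
  \<open>exp (L t)\<close> gains the factor \<open>1 / L\<close>.\<close>

lemma difference_halves:
  fixes A0 :: real
  defines "L \<equiv> 16 * c * S * A0"
  assumes M: "mild M" and N: "mild N" and A0: "A0 > 0"
    and Mb: "\<And>z i. z \<in> closed_slab \<Longrightarrow> \<bar>M z $ i\<bar> \<le> A0" and Nb: "\<And>z i. z \<in> closed_slab \<Longrightarrow> \<bar>N z $ i\<bar> \<le> A0"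
    and le: "\<And>z i. z \<in> closed_slab \<Longrightarrow> \<bar>M z $ i - N z $ i\<bar> \<le> A * exp (L * fst z)" and A: "0 \<le> A"
    and z: "z \<in> closed_slab"
  shows "\<bar>M z $ i - N z $ i\<bar> \<le> A / 2 * exp (L * fst z)"
proof -
  have L: "L > 0" using c S A0 by (simp add: L_def)
  have inner: "\<bar>M z $ i - N z $ i\<bar> - A / 2 * exp (L * fst z) \<le> 0" if z: "z \<in> open_slab" for z
  proof -
    define l where "l = len i z"
    define y where "y s = z - (l - s) *\<^sub>R vel i" for s
    note mc = mild_along_characteristic[OF M z, where i = i, folded l_def, folded y_def]
    note nc = mild_along_characteristic[OF N z, where i = i, folded l_def, folded y_def]
    have zc: "z \<in> closed_slab" using z open_slab_subset by blast
    have l: "0 < l" unfolding l_def by (rule len_pos[OF z])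
    have fsty: "fst (y s) = fst z - l + s" for s by (simp add: y_def vel_def)
    let ?E = "\<lambda>s. A / 2 * exp (L * (fst z - l + s))"
    have "norm ((M (y l) $ i - N (y l) $ i) - (M (y 0) $ i - N (y 0) $ i)) \<le> ?E l - ?E 0"
    proof (rule differentiable_bound_general[OF l])
      show "continuous_on {0..l} (\<lambda>s. M (y s) $ i - N (y s) $ i)"
        by (intro continuous_on_diff mc(1) nc(1))
      show "continuous_on {0..l} ?E" by (intro continuous_intros)
      fix s assume s: "0 < s" "s < l"
      show "((\<lambda>s. M (y s) $ i - N (y s) $ i) has_vector_derivative
          gain c S i (M (y s)) - gain c S i (N (y s))) (at s)"
        using DERIV_diff[OF mc(3)[OF s] nc(3)[OF s]]
        by (simp add: has_real_derivative_iff_has_vector_derivative)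
      have "(?E has_real_derivative A / 2 * (exp (L * (fst z - l + s)) * L)) (at s)"
        by (auto intro!: derivative_eq_intros)
      then show "(?E has_vector_derivative A / 2 * (exp (L * (fst z - l + s)) * L)) (at s)"
        by (simp add: has_real_derivative_iff_has_vector_derivative)
      have ys: "y s \<in> closed_slab" unfolding y_def
        by (rule backward_mem_closed_slab[OF zc]) (use s l_def in auto)
      have "\<bar>gain c S i (M (y s)) - gain c S i (N (y s))\<bar> \<le> 8 * c * S * A0 * (A * exp (L * fst (y s)))"
        by (rule gain_diff[OF c S Mb[OF ys] Nb[OF ys] le[OF ys]])
      also have "\<dots> = A / 2 * (exp (L * (fst z - l + s)) * L)" by (simp add: fsty L_def)
      finally show "norm (gain c S i (M (y s)) - gain c S i (N (y s))) \<le> A / 2 * (exp (L * (fst z - l + s)) * L)"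
        by simp
    qed
    moreover have "M (y 0) $ i - N (y 0) $ i = 0" using mc(2) nc(2) by simp
    moreover have "y l = z" by (simp add: y_def)
    moreover have "0 \<le> ?E 0" using A by simp
    ultimately show ?thesis by simp
  qed
  have "continuous_on closed_slab M" "continuous_on closed_slab N" using M N by (simp_all add: mild_def)
  then have "continuous_on (closure open_slab) (\<lambda>z. \<bar>M z $ i - N z $ i\<bar> - A / 2 * exp (L * fst z))"
    unfolding closure_open_slab by (intro continuous_intros)
  then have "\<bar>M z $ i - N z $ i\<bar> - A / 2 * exp (L * fst z) \<le> 0"
    by (rule continuous_le_on_closure) (use z inner in \<open>simp_all add: closure_open_slab\<close>)
  then show ?thesis by simp
qed

lemma mild_unique:
  assumes M: "mild M" and N: "mild N" and z: "z \<in> closed_slab"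
  shows "M z = N z"
proof -
  have "compact closed_slab" unfolding slab_def by (intro compact_Times compact_Icc)
  then have "bounded (M ` closed_slab)" "bounded (N ` closed_slab)"
    using M N by (auto intro!: compact_imp_bounded compact_continuous_image simp: mild_def)
  then obtain A1 A2 where "\<And>z. z \<in> closed_slab \<Longrightarrow> norm (M z) \<le> A1" "\<And>z. z \<in> closed_slab \<Longrightarrow> norm (N z) \<le> A2"
    unfolding bounded_iff by blast
  then have A12: "\<bar>M z $ i\<bar> \<le> A1" "\<bar>N z $ i\<bar> \<le> A2" if "z \<in> closed_slab" for z i
    using that component_le_norm_cart order_trans by blast+
  define A0 where "A0 = \<bar>A1\<bar> + \<bar>A2\<bar> + 1"
  have A0: "A0 > 0" by (simp add: A0_def)
  have Mb: "\<bar>M z $ i\<bar> \<le> A0" and Nb: "\<bar>N z $ i\<bar> \<le> A0" if "z \<in> closed_slab" for z i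
    using A12[OF that, of i] by (simp_all add: A0_def)
  let ?L = "16 * c * S * A0"
  have le: "\<bar>M z $ i - N z $ i\<bar> \<le> (2 * A0 * (1 / 2) ^ n) * exp (?L * fst z)" if "z \<in> closed_slab" for n z i
    using that
  proof (induction n arbitrary: z i)
    case 0
    have "0 \<le> ?L * fst z" using 0 c S A0 by (auto simp: slab_def)
    then have "1 \<le> exp (?L * fst z)" by simp
    then have "2 * A0 * 1 \<le> 2 * A0 * exp (?L * fst z)" using A0 by (intro mult_left_mono) auto
    with Mb[OF 0, of i] Nb[OF 0, of i] show ?case by simp
  next
    case (Suc n)
    have "\<bar>M z $ i - N z $ i\<bar> \<le> (2 * A0 * (1 / 2) ^ n) / 2 * exp (?L * fst z)"
      by (rule difference_halves[OF M N A0 Mb Nb Suc.IH _ Suc.prems]) (use A0 in auto)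
    then show ?case by simp
  qed
  have "M z $ i = N z $ i" for i
  proof -
    have "(\<lambda>n. (2 * A0 * (1 / 2) ^ n) * exp (?L * fst z)) \<longlonglongrightarrow> (2 * A0 * 0) * exp (?L * fst z)"
      by (intro tendsto_intros LIMSEQ_power_zero) auto
    then have "(\<lambda>n. (2 * A0 * (1 / 2) ^ n) * exp (?L * fst z)) \<longlonglongrightarrow> 0" by simp
    then have "\<bar>M z $ i - N z $ i\<bar> \<le> 0"
      by (rule LIMSEQ_le_const) (use le[OF z] in blast)
    then show ?thesis by simp
  qed
  then show ?thesis by (simp add: vec_eq_iff)
qed

end

section \<open>The transported data\<close>

lemma regular_datum_compose:
  assumes u: "regular_datum l1 h1 l2 h2 n u" and f: "\<And>w s k. f (w + s *\<^sub>R k) = f w + s *\<^sub>R f k"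
    and closed: "\<And>w. w \<in> {l1'..h1'} \<times> {l2'..h2'} \<Longrightarrow> f w \<in> {l1..h1} \<times> {l2..h2}"
    and opened: "\<And>w. w \<in> {l1'<..<h1'} \<times> {l2'<..<h2'} \<Longrightarrow> f w \<in> {l1<..<h1} \<times> {l2<..<h2}"
    and iso: "\<And>w w'. \<bar>fst (f w) - fst (f w')\<bar> + \<bar>snd (f w) - snd (f w')\<bar> = \<bar>fst w - fst w'\<bar> + \<bar>snd w - snd w'\<bar>"
    and cont: "\<And>w. isCont f w"
  shows "regular_datum l1' h1' l2' h2' n (\<lambda>w. u (f w))"
  unfolding regular_datum_def
proof (intro conjI ballI allI)
  fix w assume w: "w \<in> {l1'..h1'} \<times> {l2'..h2'}"
  show "0 \<le> u (f w)" "u (f w) \<le> n" by (rule regular_datumD(1,2)[OF u closed[OF w]])+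
  fix w' assume w': "w' \<in> {l1'..h1'} \<times> {l2'..h2'}"
  show "\<bar>u (f w) - u (f w')\<bar> \<le> n * (\<bar>fst w - fst w'\<bar> + \<bar>snd w - snd w'\<bar>)"
    using regular_datumD(3)[OF u closed[OF w] closed[OF w']] by (simp only: iso)
next
  fix w k assume w: "w \<in> {l1'<..<h1'} \<times> {l2'<..<h2'}"
  from u opened[OF w] obtain d where "strict_deriv u (f w) (f k) d"
    unfolding regular_datum_def by metis
  from strict_deriv_compose_affine[OF this cont f]
  show "\<exists>d. strict_deriv (\<lambda>w. u (f w)) w k d" by blast
qed

context slab_geometry
begin

text \<open>The inverse of the space part of \<open>chart i\<close>, see \<open>untwist_chart\<close>.\<close>

definition untwist :: "4 \<Rightarrow> real \<times> real \<Rightarrow> real \<times> real" where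
  "untwist i w = (if i = 1 then (fst w, snd w) else if i = 2 then (snd w, fst w)
     else if i = 3 then (snd w, - fst w) else (- fst w, snd w))"

lemma untwist_chart: "untwist i (snd (chart i z)) = snd z"
  using exhaust_4[of i] by (cases z) (auto simp: untwist_def chart_def)

lemma regular_datum_untwist:
  assumes "regular_datum a1 b1 a2 b2 n u"
  shows "regular_datum (lo i) (hi i) (tlo i) (thi i) n (\<lambda>w. u (untwist i w))"
proof (rule regular_datum_compose[OF assms])
  have "untwist i = (\<lambda>w. if i = 1 then (fst w, snd w) else if i = 2 then (snd w, fst w)
     else if i = 3 then (snd w, - fst w) else (- fst w, snd w))" by (simp add: untwist_def fun_eq_iff)
  then show "isCont (untwist i) w" for w
    using exhaust_4[of i] by (elim disjE) (auto intro!: continuous_intros)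
qed (use exhaust_4[of i] in \<open>auto simp: untwist_def geo_defs\<close>)

definition inflow :: "(real \<times> real \<Rightarrow> real ^ 4) \<Rightarrow> (4 \<Rightarrow> real \<times> real \<Rightarrow> real) \<Rightarrow> 4 \<Rightarrow> real \<times> real \<times> real \<Rightarrow> real" where
  "inflow N0 Nb i z = entry_datum c (lo i) (\<lambda>w. N0 (untwist i w) $ i) (Nb i) (chart i z)"

lemma has_char_derivative_iff:
  "has_char_derivative u (fst (snd (vel i))) (snd (snd (vel i))) D z \<longleftrightarrow>
     ((\<lambda>s. u (z + s *\<^sub>R vel i)) has_real_derivative D) (at 0)"
proof -
  obtain t x y where z: "z = (t, x, y)" by (metis surj_pair)
  have "z + s *\<^sub>R vel i = (t + s, x + fst (snd (vel i)) * s, y + snd (snd (vel i)) * s)" for s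
    by (simp add: z vel_def mult.commute)
  then show ?thesis by (simp add: has_char_derivative_def z)
qed

lemma regular_part_eq: "regular_part = open_slab - \<Union> (char_planes c a1 b1 a2 b2)"
  unfolding regular_part_def char_planes_def forall_4
  by (auto simp: lead_def geo_defs algebra_simps)

text \<open>Since \<open>lead j\<close> does not depend on time, a vertical line meets the four planes in finitely many points.\<close>

lemma regular_part_nonempty: "regular_part \<noteq> {}"
proof -
  define x where "x = (a1 + b1) / 2"
  define y where "y = (a2 + b2) / 2"
  have lead: "lead j (t, x, y) = lead j (0, x, y)" for j t
    using exhaust_4[of j] by (auto simp: lead_def chart_def)
  have "infinite ({0<..<T} - range (\<lambda>j. lead j (0, x, y) / c))"
    using T by (intro Diff_infinite_finite) auto
  from infinite_imp_nonempty[OF this]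
  obtain t where t: "t \<in> {0<..<T}" "t \<notin> range (\<lambda>j. lead j (0, x, y) / c)"
    by blast
  have "lead j (t, x, y) \<noteq> c * fst (t, x, y)" for j
  proof
    assume "lead j (t, x, y) = c * fst (t, x, y)"
    then have "c * t = lead j (0, x, y)" unfolding lead[of j t] by simp
    then have "t = lead j (0, x, y) / c" using c by (simp add: field_simps)
    with t(2) show False by blast
  qed
  moreover have "(t, x, y) \<in> open_slab"
    using t(1) a1b1 a2b2 by (simp add: slab_interior_def x_def y_def)
  ultimately have "(t, x, y) \<in> regular_part" by (simp add: regular_part_def)
  then show ?thesis by blast
qed

end

text \<open>The data of the problem with \<open>Nb i\<close> for the boundary datum of species \<open>i\<close>; \<open>n0\<close> and \<open>n1\<close> stand for
  their norms.\<close>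

locale inflow_problem = slab_geometry +
  fixes S q K :: real and N0 :: "real \<times> real \<Rightarrow> real ^ 4" and Nb :: "4 \<Rightarrow> real \<times> real \<Rightarrow> real"
    and n0 n1 :: "4 \<Rightarrow> real"
  assumes S: "S > 0" and K: "K > 0"
    and small: "4 * c * S * (1 + 8 * T) * K \<le> 1"
    and invariant: "q + 4 * c * S * (1 + 8 * T) * K * K \<le> K"
    and N0: "\<And>i. regular_datum a1 b1 a2 b2 (n0 i) (\<lambda>w. N0 w $ i)"
    and Nb: "\<And>i. regular_datum 0 T (tlo i) (thi i) (n1 i) (Nb i)"
    and compat: "\<And>i \<eta>. \<eta> \<in> {tlo i..thi i} \<Longrightarrow> N0 (untwist i (lo i, \<eta>)) $ i = Nb i (0, \<eta>)"
    and size: "\<And>i. n0 i \<le> q" "\<And>i. c * n0 i \<le> q" "\<And>i. n1 i \<le> q" "\<And>i. c * n1 i \<le> q"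
begin

lemma entry: "entry_data c T (lo i) (hi i) (tlo i) (thi i) (n0 i) (n1 i) q (\<lambda>w. N0 (untwist i w) $ i) (Nb i)"
  by unfold_locales
     (use c T lo_less[of i] regular_datum_untwist[OF N0] Nb compat size in auto)

sublocale picard c T a1 b1 a2 b2 S q K "inflow N0 Nb"
proof
  fix i z z' h and s :: real
  show "0 \<le> inflow N0 Nb i z" "inflow N0 Nb i z \<le> q" if "z \<in> closed_slab"
    using entry_data.entry_datum_bounds[OF entry, of "chart i z" i] that
    by (simp_all only: mem_slab_chart(1)[of z i] inflow_def)
  show "\<bar>inflow N0 Nb i z - inflow N0 Nb i z'\<bar> \<le> q * omega c (z - z')" if "z \<in> closed_slab" "z' \<in> closed_slab"
    using entry_data.entry_datum_lipschitz[OF entry, of "chart i z" i "chart i z'"] that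
    by (simp only: mem_slab_chart(1)[of _ i] inflow_def chart_diff[symmetric] omega_chart)
  show "inflow N0 Nb i (z + s *\<^sub>R vel i) = inflow N0 Nb i z"
    using entry_data.entry_datum_along[OF entry, of i "chart i z" s]
    by (simp only: inflow_def chart_add_scaleR chart_vel)
  show "\<exists>d. strict_deriv (inflow N0 Nb i) z h d" if z: "z \<in> regular_part"
  proof -
    have inside: "chart i z \<in> {0<..<T} \<times> {lo i<..<hi i} \<times> {tlo i<..<thi i}"
      using z mem_slab_chart(2)[of z i] by (simp only: regular_part_def mem_Collect_eq)
    have off: "c * fst (chart i z) \<noteq> fst (snd (chart i z)) - lo i"
    proof -
      have "lead i z \<noteq> c * fst z" using z by (simp add: regular_part_def)
      then show ?thesis unfolding fst_chart lead_def by simp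
    qed
    obtain d where "strict_deriv (entry_datum c (lo i) (\<lambda>w. N0 (untwist i w) $ i) (Nb i)) (chart i z) (chart i h) d"
      using entry_data.entry_datum_strict_deriv[OF entry inside off] by (rule exE)
    from strict_deriv_compose_affine[OF this isCont_chart chart_add_scaleR]
    show ?thesis unfolding inflow_def[abs_def] by (rule exI)
  qed
qed (use S K small invariant in auto)

lemma inflow_initial:
  assumes "(0, x, y) \<in> closed_slab" shows "inflow N0 Nb i (0, x, y) = N0 (x, y) $ i"
proof -
  obtain \<xi> \<eta> where ch: "chart i (0, x, y) = (0, \<xi>, \<eta>)"
    using fst_chart[of i "(0, x, y)"] by (metis fst_conv surj_pair)
  have "0 \<le> \<xi> - lo i" using lead_nonneg[OF assms, of i] by (simp add: lead_def ch)
  then have "inflow N0 Nb i (0, x, y) = N0 (untwist i (\<xi>, \<eta>)) $ i"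
    by (simp add: inflow_def ch entry_datum_def)
  then show ?thesis using untwist_chart[of i "(0, x, y)"] by (simp add: ch)
qed

lemma inflow_boundary:
  assumes "z \<in> closed_slab" "lead i z = 0"
  shows "inflow N0 Nb i z = Nb i (fst z, snd (snd (chart i z)))"
proof -
  obtain \<xi> \<eta> where ch: "chart i z = (fst z, \<xi>, \<eta>)"
    using fst_chart[of i z] by (metis fst_conv surj_pair)
  have \<xi>: "\<xi> = lo i" using assms(2) by (simp add: lead_def ch)
  have "0 \<le> c * fst z" using assms(1) c by (auto simp: slab_def)
  then show ?thesis
    using entry_data.entry_datum_late[OF entry, of "fst z" \<xi> \<eta> i] assms(1) mem_slab_chart(1)[of z i]
    by (simp add: inflow_def ch \<xi>)
qed

text \<open>The points where species \<open>i\<close> enters form the face \<open>t = 0\<close> together with one lateral face, and there the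
  transported datum is the prescribed one.\<close>

lemma mild_iff_solves:
  assumes "continuous_on closed_slab M"
  shows "mild M \<longleftrightarrow> solves_Sigma0 c S T a1 b1 a2 b2 N0 (Nb 1) (Nb 2) (Nb 3) (Nb 4) M"
    (is "_ \<longleftrightarrow> ?solves")
proof -
  have der: "(\<forall>i. ((\<lambda>s. M (z + s *\<^sub>R vel i) $ i) has_real_derivative gain c S i (M z)) (at 0)) \<longleftrightarrow>
      has_char_derivative (\<lambda>z. M z $ 1) c 0 (collision c S (M z)) z \<and>
      has_char_derivative (\<lambda>z. M z $ 2) 0 c (- collision c S (M z)) z \<and>
      has_char_derivative (\<lambda>z. M z $ 3) 0 (- c) (- collision c S (M z)) z \<and>
      has_char_derivative (\<lambda>z. M z $ 4) (- c) 0 (collision c S (M z)) z" for z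
    unfolding forall_4 has_char_derivative_iff[of "\<lambda>z. M z $ _", symmetric] by (simp add: vel_def gain_def)
  have data: "(\<forall>z\<in>closed_slab. \<forall>i. len i z = 0 \<longrightarrow> M z $ i = inflow N0 Nb i z) \<longleftrightarrow>
      (\<forall>x\<in>{a1..b1}. \<forall>y\<in>{a2..b2}. \<forall>i. M (0, x, y) $ i = N0 (x, y) $ i) \<and>
      (\<forall>z\<in>closed_slab. \<forall>i. lead i z = 0 \<longrightarrow> M z $ i = Nb i (fst z, snd (snd (chart i z))))"
    (is "?L \<longleftrightarrow> ?I \<and> ?F")
  proof (intro iffI conjI)
    assume L: ?L
    show ?I
    proof (intro ballI allI)
      fix x y i assume "x \<in> {a1..b1}" "y \<in> {a2..b2}"
      then have z: "(0, x, y) \<in> closed_slab" using T by (simp add: slab_def)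
      have "len i (0, x, y) = 0" using lead_nonneg[OF z, of i] c by (simp add: len_def)
      with L z inflow_initial[OF z] show "M (0, x, y) $ i = N0 (x, y) $ i" by metis
    qed
    show ?F
    proof (intro ballI allI impI)
      fix z i assume z: "z \<in> closed_slab" and lead: "lead i z = 0"
      have "len i z = 0" using z lead by (auto simp: len_def slab_def)
      with L z inflow_boundary[OF z lead] show "M z $ i = Nb i (fst z, snd (snd (chart i z)))" by metis
    qed
  next
    assume IF: "?I \<and> ?F"
    show ?L
    proof (intro ballI allI impI)
      fix z i assume z: "z \<in> closed_slab" and len: "len i z = 0"
      show "M z $ i = inflow N0 Nb i z"
      proof (cases "lead i z = 0")
        case True
        with IF z inflow_boundary[OF z True] show ?thesis by metis
      next
        case False
        then have "fst z = 0" using len c by (auto simp: len_def min_def split: if_splits)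
        then obtain x y where xy: "z = (0, x, y)" by (metis prod.collapse)
        with z have "x \<in> {a1..b1}" "y \<in> {a2..b2}" by (auto simp: slab_def)
        with IF inflow_initial[OF z[unfolded xy]] xy show ?thesis by metis
      qed
    qed
  qed
  have faces: "(\<forall>z\<in>closed_slab. \<forall>i. lead i z = 0 \<longrightarrow> M z $ i = Nb i (fst z, snd (snd (chart i z)))) \<longleftrightarrow>
      (\<forall>t\<in>{0..T}. \<forall>y\<in>{a2..b2}. M (t, a1, y) $ 1 = Nb 1 (t, y) \<and> M (t, b1, y) $ 4 = Nb 4 (t, y)) \<and>
      (\<forall>t\<in>{0..T}. \<forall>x\<in>{a1..b1}. M (t, x, a2) $ 2 = Nb 2 (t, x) \<and> M (t, x, b2) $ 3 = Nb 3 (t, x))"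
    (is "?F \<longleftrightarrow> ?G")
  proof
    assume F: ?F
    have F': "M z $ i = Nb i (fst z, snd (snd (chart i z)))" if "z \<in> closed_slab" "lead i z = 0" for z i
      using F that by blast
    show ?G
      using F'[of "(_, a1, _)" 1] F'[of "(_, b1, _)" 4] F'[of "(_, _, a2)" 2] F'[of "(_, _, b2)" 3] a1b1 a2b2
      by (simp add: slab_def lead_def geo_defs)
  next
    assume G: ?G
    show ?F
    proof (intro ballI allI impI)
      fix z i assume "z \<in> closed_slab" "lead i z = 0"
      moreover obtain t x y where "z = (t, x, y)" by (metis surj_pair)
      ultimately show "M z $ i = Nb i (fst z, snd (snd (chart i z)))"
        using G exhaust_4[of i] by (auto simp: slab_def lead_def geo_defs)
    qed
  qed
  show ?thesis
    unfolding mild_def solves_Sigma0_def der data faces using assms by blast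
qed

text \<open>A strict derivative along a coordinate axis is the partial derivative, and the Lipschitz constant \<open>K\<close>
  bounds it by \<open>K\<close> times the \<open>omega\<close>-norm of the axis: 1 for time and \<open>1 / c\<close> for space.\<close>

lemma solution_partials:
  fixes i :: 4
  defines "u \<equiv> \<lambda>z. solution z $ i"
  shows "z \<in> regular_part \<Longrightarrow> has_partials_at u z"
    and "continuous_on regular_part (partial_t u)" "continuous_on regular_part (partial_x u)"
      "continuous_on regular_part (partial_y u)"
    and "z \<in> regular_part \<Longrightarrow> \<bar>partial_t u z\<bar> \<le> K"
      "z \<in> regular_part \<Longrightarrow> \<bar>partial_x u z\<bar> \<le> K / c"
      "z \<in> regular_part \<Longrightarrow> \<bar>partial_y u z\<bar> \<le> K / c"
proof -
  have along: "((\<lambda>r. f (r0 + r)) has_real_derivative d) (at 0) \<Longrightarrow> (f has_real_derivative d) (at r0)"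
    for f :: "real \<Rightarrow> real" and r0 d
    using DERIV_at_within_shift[of f d r0 0 UNIV] by simp
  have bound: "\<bar>d\<bar> \<le> K * omega c h" if "strict_deriv u z h d" for z h d
  proof (rule strict_deriv_abs_le[OF that])
    show "\<bar>u (x + s *\<^sub>R h) - u x\<bar> \<le> K * omega c h * \<bar>s\<bar>" for x s
      using tameD(2)[OF tame_solution, of "x + s *\<^sub>R h" i x]
      by (simp add: u_def omega_scaleR mult.assoc mult.commute[of "\<bar>s\<bar>"])
  qed
  have dt: "((\<lambda>s. u (s, x, y)) has_real_derivative d) (at t)" if "strict_deriv u (t, x, y) (1, 0, 0) d" for t x y d
    by (rule along) (use strict_deriv_imp_DERIV[OF that] in simp)
  have dx: "((\<lambda>s. u (t, s, y)) has_real_derivative d) (at x)" if "strict_deriv u (t, x, y) (0, 1, 0) d" for t x y d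
    by (rule along) (use strict_deriv_imp_DERIV[OF that] in simp)
  have dy: "((\<lambda>s. u (t, x, s)) has_real_derivative d) (at y)" if "strict_deriv u (t, x, y) (0, 0, 1) d" for t x y d
    by (rule along) (use strict_deriv_imp_DERIV[OF that] in simp)
  have ex: "\<exists>d. strict_deriv u z h d" if "z \<in> regular_part" for z h
    unfolding u_def by (rule smoothD[OF smooth_solution that])
  have st: "strict_deriv u z (1, 0, 0) (partial_t u z)" and sx: "strict_deriv u z (0, 1, 0) (partial_x u z)"
    and sy: "strict_deriv u z (0, 0, 1) (partial_y u z)" if z: "z \<in> regular_part" for z
  proof -
    obtain t x y where txy: "z = (t, x, y)" by (metis surj_pair)
    obtain d e f where "strict_deriv u z (1, 0, 0) d" "strict_deriv u z (0, 1, 0) e" "strict_deriv u z (0, 0, 1) f"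
      using ex[OF z] by metis
    then show "strict_deriv u z (1, 0, 0) (partial_t u z)" "strict_deriv u z (0, 1, 0) (partial_x u z)"
      "strict_deriv u z (0, 0, 1) (partial_y u z)"
      using DERIV_imp_deriv[OF dt, of t x y d] DERIV_imp_deriv[OF dx, of t x y e] DERIV_imp_deriv[OF dy, of t x y f]
      by (simp_all add: txy partial_t_def partial_x_def partial_y_def)
  qed
  show "has_partials_at u z" if z: "z \<in> regular_part"
  proof -
    obtain t x y where txy: "z = (t, x, y)" by (metis surj_pair)
    show ?thesis
      using dt[OF st[OF z, unfolded txy]] dx[OF sx[OF z, unfolded txy]] dy[OF sy[OF z, unfolded txy]]
      by (auto simp: has_partials_at_def txy real_differentiable_def)
  qed
  show "continuous_on regular_part (partial_t u)" "continuous_on regular_part (partial_x u)"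
    "continuous_on regular_part (partial_y u)"
    by (rule strict_deriv_continuous_on, erule st sx sy)+
  show "\<bar>partial_t u z\<bar> \<le> K" "\<bar>partial_x u z\<bar> \<le> K / c" "\<bar>partial_y u z\<bar> \<le> K / c" if z: "z \<in> regular_part"
    using bound[OF st[OF z]] bound[OF sx[OF z]] bound[OF sy[OF z]] by (simp_all add: omega_def)
qed

end

section \<open>The theorem\<close>

lemma sup_norm_le:
  assumes "D \<noteq> {}" "\<And>z. z \<in> D \<Longrightarrow> \<bar>u z\<bar> \<le> C"
  shows "sup_norm D u \<le> C"
  unfolding sup_norm_def using assms by (rule cSUP_least)

lemma bounded_imageI:
  fixes u :: "'a \<Rightarrow> real"
  assumes "\<And>z. z \<in> D \<Longrightarrow> \<bar>u z\<bar> \<le> C"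
  shows "bounded (u ` D)"
  using assms by (intro boundedI[of _ C]) auto

lemma char_planes_are_planes:
  assumes "H \<in> char_planes c a1 b1 a2 b2" shows "is_plane H"
proof -
  have plane: "is_plane {(t, x, y). \<alpha> * t + \<beta> * x + \<gamma> * y = d}" if "(\<alpha>, \<beta>, \<gamma>) \<noteq> 0" for \<alpha> \<beta> \<gamma> d :: real
    unfolding is_plane_def using that by (intro exI[of _ "(\<alpha>, \<beta>, \<gamma>)"] exI[of _ d]) (auto simp: inner_prod_def)
  from assms consider "H = {(t, x, y). - c * t + x = a1}" | "H = {(t, x, y). - c * t + y = a2}"
    | "H = {(t, x, y). c * t + y = b2}" | "H = {(t, x, y). c * t + x = b1}"
    by (auto simp: char_planes_def)
  then show ?thesis
  proof cases
    case 1 then show ?thesis using plane[of "- c" 1 0 a1] by (simp add: zero_prod_def)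
  next
    case 2 then show ?thesis using plane[of "- c" 0 1 a2] by (simp add: zero_prod_def)
  next
    case 3 then show ?thesis using plane[of c 0 1 b2] by (simp add: zero_prod_def)
  next
    case 4 then show ?thesis using plane[of c 1 0 b1] by (simp add: zero_prod_def)
  qed
qed

lemma norm1_nonneg:
  assumes "l1 < h1" "l2 < h2" "admissible_datum l1 h1 l2 h2 u"
  shows "0 \<le> norm1 l1 h1 l2 h2 u"
proof -
  have "(l1, l2) \<in> {l1..h1} \<times> {l2..h2}" using assms(1,2) by simp
  from admissible_datum_bounds(1)[OF assms(3) this] show ?thesis by linarith
qed

text \<open>The number \<open>K\<close> is the larger root of \<open>p K\<^sup>2 - K + q = 0\<close>. It is positive even if all data vanish, in
  contrast to the smaller one.\<close>

lemma quadratic_root: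
  fixes p q :: real
  assumes "p > 0" "q \<ge> 0" "p * q \<le> 1 / 4"
  defines "K \<equiv> (1 + sqrt (1 - 4 * p * q)) / (2 * p)"
  shows "K > 0" "p * K \<le> 1" "q + p * K * K = K"
proof -
  define r where "r = sqrt (1 - 4 * p * q)"
  have r: "0 \<le> r" "r \<le> 1" "r * r = 1 - 4 * p * q"
    using assms(1-3) by (auto simp: r_def)
  have K: "K = (1 + r) / (2 * p)" by (simp add: K_def r_def)
  show "K > 0" using r assms(1) by (simp add: K)
  have pK: "p * K = (1 + r) / 2" using assms(1) by (simp add: K)
  then show "p * K \<le> 1" using r by simp
  have pK2: "2 * (p * K) = 1 + r" using pK by simp
  have "4 * p * (q + p * K * K) = 4 * p * q + (2 * (p * K)) * (2 * (p * K))" by (simp add: algebra_simps)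
  also have "\<dots> = 4 * p * q + (1 + r) * (1 + r)" by (simp only: pK2)
  also have "\<dots> = 2 * (1 + r)" using r(3) by (simp add: algebra_simps)
  also have "\<dots> = 4 * p * K" using pK by simp
  finally show "q + p * K * K = K" using assms(1) by simp
qed

theorem theorem2p1:
  fixes c S T a1 b1 a2 b2 p q :: real
    and N0 :: "real \<times> real \<Rightarrow> real ^ 4"
    and N1m N2m N3p N4p :: "real \<times> real \<Rightarrow> real"
  assumes "c > 0" and "S > 0" and "T > 0" and "a1 < b1" and "a2 < b2"
    and "\<forall>i. admissible_datum a1 b1 a2 b2 (\<lambda>w. N0 w $ i)"
    and "admissible_datum 0 T a2 b2 N1m"
    and "admissible_datum 0 T a1 b1 N2m"
    and "admissible_datum 0 T a1 b1 N3p"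
    and "admissible_datum 0 T a2 b2 N4p"
    and "\<forall>y \<in> {a2..b2}. N0 (a1, y) $ 1 = N1m (0, y) \<and> N0 (b1, y) $ 4 = N4p (0, y)"
    and "\<forall>x \<in> {a1..b1}. N0 (x, a2) $ 2 = N2m (0, x) \<and> N0 (x, b2) $ 3 = N3p (0, x)"
    and "p = const_p c S T a1 b1 a2 b2"
    and "q = const_q c T a1 b1 a2 b2 N0 N1m N2m N3p N4p"
    and "p * q \<le> 1 / 4"
  shows "\<exists>N. nonneg_solution c S T a1 b1 a2 b2 N0 N1m N2m N3p N4p N \<and>
    (\<forall>M. nonneg_solution c S T a1 b1 a2 b2 N0 N1m N2m N3p N4p M \<longrightarrow>
       (\<forall>z \<in> slab T a1 b1 a2 b2. M z = N z)) \<and>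
    sup_norm4 (slab T a1 b1 a2 b2) N \<le> (1 + sqrt (1 - 4 * p * q)) / (2 * p) \<and>
    (\<exists>\<H> D. finite \<H> \<and> (\<forall>H \<in> \<H>. is_plane H) \<and> char_planes c a1 b1 a2 b2 \<subseteq> \<H> \<and>
       D = slab_interior T a1 b1 a2 b2 - \<Union>\<H> \<and>
       (\<forall>i. (\<forall>z \<in> D. has_partials_at (\<lambda>z. N z $ i) z) \<and>
            continuous_on D (partial_t (\<lambda>z. N z $ i)) \<and>
            continuous_on D (partial_x (\<lambda>z. N z $ i)) \<and>
            continuous_on D (partial_y (\<lambda>z. N z $ i)) \<and>
            bounded (partial_t (\<lambda>z. N z $ i) ` D) \<and>
            bounded (partial_x (\<lambda>z. N z $ i) ` D) \<and>
            bounded (partial_y (\<lambda>z. N z $ i) ` D)) \<and>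
       Max (range (\<lambda>i. Max {sup_norm (slab T a1 b1 a2 b2) (\<lambda>z. N z $ i),
                            sup_norm D (partial_t (\<lambda>z. N z $ i)),
                            sup_norm D (partial_x (\<lambda>z. N z $ i)),
                            sup_norm D (partial_y (\<lambda>z. N z $ i))}))
         \<le> max 1 (2 / c) * ((1 + sqrt (1 - 4 * p * q)) / (2 * p)))"
proof -
  note c = assms(1) and S = assms(2) and T = assms(3) and lt1 = assms(4) and lt2 = assms(5)
  note N0 = spec[OF assms(6)]
  interpret slab_geometry c T a1 b1 a2 b2 by unfold_locales (rule c T lt1 lt2)+
  define Nb where "Nb i = (if i = 1 then N1m else if i = 2 then N2m else if i = 3 then N3p else N4p)" for i :: 4
  define n0 where "n0 i = norm1 a1 b1 a2 b2 (\<lambda>w. N0 w $ i)" for i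
  define n1 where "n1 i = norm1 0 T (tlo i) (thi i) (Nb i)" for i
  have Nb: "admissible_datum 0 T (tlo i) (thi i) (Nb i)" for i
    using exhaust_4[of i] assms(7-10) by (auto simp: Nb_def tlo_def thi_def)
  have n_nonneg: "0 \<le> n0 i" "0 \<le> n1 i" for i
    unfolding n0_def n1_def
    by (rule norm1_nonneg[OF lt1 lt2 N0]) (rule norm1_nonneg[OF T lo_less(2) Nb])
  have n1_eq: "n1 1 = norm1 0 T a2 b2 N1m" "n1 2 = norm1 0 T a1 b1 N2m" "n1 3 = norm1 0 T a1 b1 N3p"
    "n1 4 = norm1 0 T a2 b2 N4p"
    by (simp_all add: n1_def Nb_def tlo_def thi_def)
  have q_eq: "q = Max {max 1 (2 * c) * n0 1, (1 + c) * n1 1, max 1 (2 * c) * n0 2, max 2 (1 + c) * n1 2,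
      max 1 (2 * c) * n0 3, max 2 (1 + c) * n1 3, max 1 (2 * c) * n0 4, (2 + c) * n1 4}"
    unfolding assms(14) const_q_def by (simp only: n0_def n1_eq)
  have q_ge: "max 1 (2 * c) * n0 1 \<le> q" "max 1 (2 * c) * n0 2 \<le> q" "max 1 (2 * c) * n0 3 \<le> q"
    "max 1 (2 * c) * n0 4 \<le> q" "(1 + c) * n1 1 \<le> q" "max 2 (1 + c) * n1 2 \<le> q"
    "max 2 (1 + c) * n1 3 \<le> q" "(2 + c) * n1 4 \<le> q"
    unfolding q_eq by (rule Max_ge, simp, simp only: insert_iff simp_thms)+
  have qn0: "max 1 (2 * c) * n0 i \<le> q" for i
    using exhaust_4[of i] q_ge(1-4) by (elim disjE) simp_all
  have qn1: "(1 + c) * n1 i \<le> q" for i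
  proof -
    have "(1 + c) * n1 i \<le> max 2 (1 + c) * n1 i" "(1 + c) * n1 i \<le> (2 + c) * n1 i"
      by (intro mult_right_mono n_nonneg, simp)+
    moreover have "(1 + c) * n1 i \<le> q \<or> max 2 (1 + c) * n1 i \<le> q \<or> (2 + c) * n1 i \<le> q"
      using exhaust_4[of i] q_ge(5-8) by (elim disjE) simp_all
    ultimately show ?thesis by linarith
  qed
  have size: "n0 i \<le> q" "c * n0 i \<le> q" "n1 i \<le> q" "c * n1 i \<le> q" for i
  proof -
    have "1 * n0 i \<le> max 1 (2 * c) * n0 i" "c * n0 i \<le> max 1 (2 * c) * n0 i"
      using c by (intro mult_right_mono n_nonneg, simp)+
    with qn0[of i] show "n0 i \<le> q" "c * n0 i \<le> q" by simp_all
    have "1 * n1 i \<le> (1 + c) * n1 i" "c * n1 i \<le> (1 + c) * n1 i"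
      using c by (intro mult_right_mono n_nonneg, simp)+
    with qn1[of i] show "n1 i \<le> q" "c * n1 i \<le> q" by simp_all
  qed
  have q: "0 \<le> q" using size(1)[of 1] n_nonneg(1)[of 1] by linarith
  have p_ge: "4 * c * S * (1 + 8 * T) \<le> p"
  proof -
    have "4 * T \<le> Max {4 * T, 2 / c * (b1 - a1), 1 / c * (b2 - a2)}" by (rule Max_ge) auto
    then have "1 + 8 * T \<le> 1 + 2 * Max {4 * T, 2 / c * (b1 - a1), 1 / c * (b2 - a2)}" by linarith
    then show ?thesis unfolding assms(13) const_p_def
      using c S by (intro mult_left_mono) auto
  qed
  have "0 < 4 * c * S * (1 + 8 * T)" using c S T by simp
  with p_ge have p: "p > 0" by linarith
  define K where "K = (1 + sqrt (1 - 4 * p * q)) / (2 * p)"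
  note K = quadratic_root[OF p q assms(15), folded K_def]
  have KK: "4 * c * S * (1 + 8 * T) * K \<le> p * K" "4 * c * S * (1 + 8 * T) * K * K \<le> p * K * K"
    using K(1) by (intro mult_right_mono p_ge; simp)+
  have small: "4 * c * S * (1 + 8 * T) * K \<le> 1" using KK(1) K(2) by linarith
  have invariant: "q + 4 * c * S * (1 + 8 * T) * K * K \<le> K" using KK(2) K(3) by linarith
  interpret inflow_problem c T a1 b1 a2 b2 S q K N0 Nb n0 n1
  proof
    show "regular_datum a1 b1 a2 b2 (n0 i) (\<lambda>w. N0 w $ i)" for i
      unfolding n0_def by (rule admissible_imp_regular_datum[OF lt1 lt2 N0])
    show "regular_datum 0 T (tlo i) (thi i) (n1 i) (Nb i)" for i
      unfolding n1_def by (rule admissible_imp_regular_datum[OF T lo_less(2) Nb])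
    show "N0 (untwist i (lo i, \<eta>)) $ i = Nb i (0, \<eta>)" if "\<eta> \<in> {tlo i..thi i}" for i \<eta>
      using exhaust_4[of i] that assms(11,12) by (auto simp: untwist_def geo_defs Nb_def)
  qed (rule S K(1) small invariant size)+
  have Nb_simps: "Nb 1 = N1m" "Nb 2 = N2m" "Nb 3 = N3p" "Nb 4 = N4p" by (simp_all add: Nb_def)
  have cont: "continuous_on closed_slab solution" using mild_solution by (simp add: mild_def)
  have slab_ne: "closed_slab \<noteq> {}" using retract_mem by blast
  have bnd: "sup_norm closed_slab (\<lambda>z. solution z $ i) \<le> K" for i
    by (rule sup_norm_le[OF slab_ne tameD(1)[OF tame_solution]])
  note parts = solution_partials
  have "nonneg_solution c S T a1 b1 a2 b2 N0 N1m N2m N3p N4p solution"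
    unfolding nonneg_solution_def
    using cont solution_nonneg mild_solution mild_iff_solves[OF cont, unfolded Nb_simps] by blast
  moreover have "\<forall>z\<in>closed_slab. M z = solution z"
    if M: "nonneg_solution c S T a1 b1 a2 b2 N0 N1m N2m N3p N4p M" for M
  proof -
    have "mild M"
      using M mild_iff_solves[of M, unfolded Nb_simps] unfolding nonneg_solution_def by blast
    then show ?thesis using mild_unique[OF _ mild_solution] by blast
  qed
  moreover have "sup_norm4 closed_slab solution \<le> K"
    unfolding sup_norm4_def using bnd by (subst Max_le_iff) auto
  moreover have "\<exists>\<H> D. finite \<H> \<and> (\<forall>H \<in> \<H>. is_plane H) \<and> char_planes c a1 b1 a2 b2 \<subseteq> \<H> \<and>
       D = open_slab - \<Union>\<H> \<and>
       (\<forall>i. (\<forall>z \<in> D. has_partials_at (\<lambda>z. solution z $ i) z) \<and>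
            continuous_on D (partial_t (\<lambda>z. solution z $ i)) \<and>
            continuous_on D (partial_x (\<lambda>z. solution z $ i)) \<and>
            continuous_on D (partial_y (\<lambda>z. solution z $ i)) \<and>
            bounded (partial_t (\<lambda>z. solution z $ i) ` D) \<and>
            bounded (partial_x (\<lambda>z. solution z $ i) ` D) \<and>
            bounded (partial_y (\<lambda>z. solution z $ i) ` D)) \<and>
       Max (range (\<lambda>i. Max {sup_norm closed_slab (\<lambda>z. solution z $ i),
                            sup_norm D (partial_t (\<lambda>z. solution z $ i)),
                            sup_norm D (partial_x (\<lambda>z. solution z $ i)),
                            sup_norm D (partial_y (\<lambda>z. solution z $ i))}))
         \<le> max 1 (2 / c) * K"
  proof (intro exI conjI allI)
    show "finite (char_planes c a1 b1 a2 b2)" by (simp add: char_planes_def)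
    show "\<forall>H\<in>char_planes c a1 b1 a2 b2. is_plane H" using char_planes_are_planes by blast
    show "regular_part = open_slab - \<Union> (char_planes c a1 b1 a2 b2)" by (rule regular_part_eq)
    fix i
    show "\<forall>z\<in>regular_part. has_partials_at (\<lambda>z. solution z $ i) z" using parts(1) by blast
    show "bounded (partial_t (\<lambda>z. solution z $ i) ` regular_part)"
      "bounded (partial_x (\<lambda>z. solution z $ i) ` regular_part)"
      "bounded (partial_y (\<lambda>z. solution z $ i) ` regular_part)"
      by (rule bounded_imageI, erule parts)+
  next
    have "1 * K \<le> max 1 (2 / c) * K" "1 / c * K \<le> max 1 (2 / c) * K"
      using K(1) c by (intro mult_right_mono; simp add: le_max_iff_disj divide_right_mono)+
    then have le: "x \<le> K \<Longrightarrow> x \<le> max 1 (2 / c) * K" "x \<le> K / c \<Longrightarrow> x \<le> max 1 (2 / c) * K" for x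
      by simp_all
    note ne = regular_part_nonempty
    show "Max (range (\<lambda>i. Max {sup_norm closed_slab (\<lambda>z. solution z $ i),
                            sup_norm regular_part (partial_t (\<lambda>z. solution z $ i)),
                            sup_norm regular_part (partial_x (\<lambda>z. solution z $ i)),
                            sup_norm regular_part (partial_y (\<lambda>z. solution z $ i))}))
         \<le> max 1 (2 / c) * K"
      using le(1)[OF bnd] le(1)[OF sup_norm_le[OF ne parts(5)]]
        le(2)[OF sup_norm_le[OF ne parts(6)]] le(2)[OF sup_norm_le[OF ne parts(7)]]
      by (simp add: image_iff)
  qed (rule parts(2-4) subset_refl)+
  ultimately show ?thesis unfolding K_def by blast
qed

end
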